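(* Let $p\ge 3$ be a prime, let $k$ be a field of characteristic $p$, let $\lambda=(a,b)$ be a two part partition, $a\ge b>0$, and suppose that $x\in M^\lambda$ is such that $\langle S^\lambda,x\rangle$ is a non-split extension of the Specht module $S^\lambda$ by the trivial module $k$. Then either - $\lambda$ is pointed and $\langle S^\lambda,x\rangle$ is equivalent to $\langle S^\lambda,u_{\mathbf U}\rangle$, where $u_{\mathbf U}\in M^\lambda$ is the element constructed in the context for pointed partitions; or - $\lambda$ is James and $\langle S^\lambda,x\rangle$ is equivalent to $\langle S^\lambda,u\rangle$, where $u\in M^\lambda$ is the element described in the context for James partitions.
   Context: Basic notation. $M^\lambda$ is the permutation module over $k$ of $\mathcal{S}_{a+b}$ on $\lambda$-tabloids, and $S^\lambda\subseteq M^\lambda$ is the Specht module (spanned by polytabloids). For $\lambda=(a,b)$ a tabloid is identified with the $b$-subset of $[a+b]=\{1,\dots,a+b\}$ formed by its second row, so $M^{(a,b)}$ is the $k$-space of formal sums of $b$-subsets of $[a+b]$. $\langle S^\lambda,x\rangle$ is the subspace spanned by $S^\lambda$ and $x$; it is an extension of $S^\lambda$ by the trivial module if it is a submodule, $x\notin S^\lambda$, and the quotient by $S^\lambda$ is the one dimensional trivial module. Two such extensions are equivalent if there is an isomorphism of $k\mathcal{S}_{a+b}$-modules between them restricting to the identity on $S^\lambda$ (that is, the extension classes agree up to a non-zero scalar). For a positive integer $x$ with base $p$ expansion $\sum_{i=0}^{\alpha}x_ip^i$, $x_\alpha\ne0$, $l_p(x)=\alpha$, and $\mathrm{val}_p(x)$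 is the least $i$ with $x_i\neq 0$. The partition $(a,b)$ is James if $\mathrm{val}_p(a+1)>l_p(b)$; it is pointed if $b=p^\beta+\hat b$ with $\beta,\hat b\ge 0$ integers and $\hat b<p^{\mathrm{val}_p(a+1)}<p^\beta$. Construction of $u_{\mathbf U}$ for $(a,b)$ pointed, $b=p^\beta+\hat b$ with $\beta,\hat b\ge 0$ integers and $\hat b<p^{\mathrm{val}_p(a+1)}<p^\beta$. Let $m=a-p^\beta+1$ and let $u_0\in M^{(a,p^\beta)}$ be the sum of all $p^\beta$-subsets of $[a+p^\beta]$ disjoint from $\{1,\dots,m\}$ (all tabloids having $1,\dots,m$ in the top row). For a subset $Y\subseteq[a+b]$ with $|Y|=\hat b$, relabel $u_0$ along the order-preserving bijection $[a+p^\beta]\to[a+b]\setminus Y$, and let $u_Y\in M^{(a,b)}$ be the sum of the sets $X\cup Y$, over all sets $X$ occurring in the relabelled $u_0$. For $X\subseteq[a+b]$ with $|X|=b-1$ let $u_{\bar X}=\sum_{Y\subseteq X,\ |Y|=\hat b}u_Y$. Let $\mathbf U$ be a non-null $p$-ary $\hat b$-design of block size $b-1$, i.e. a function $\mathbf U$ from the $(b-1)$-subsets of $[a+b]$ to $k$ such that for some $\alpha\in k$, $\alpha\neq0$, one has $\sum_{X\supseteq Y}\mathbf U(X)=\alpha$ for every $\hat b$-subset $Y$ of $[a+b]$ (such a $\mathbf U$ exists by a result of Wilson). Set $u_{\mathbf U}=\sum_{X}\mathbf U(X)\,u_{\bar X}$, the sum being over all $(b-1)$-subsets $X$ of $[a+b]$.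 Description of $u$ for $(a,b)$ James. Let $d=\min_{0\le s<b}\mathrm{val}_p\binom{a+b-s}{a}$ and $\mu_s=\binom{a+b-s}{a}/p^d$ for $0\le s<b$. Let $c$ be a function from the $b$-subsets of $[a+b]$ to $\mathbb Z$ such that for every $0\le s<b$ and every $s$-subset $Z$ of $[a+b]$, $\sum_{Y\supseteq Z}c(Y)=\mu_s$, the sum being over $b$-subsets $Y$ (such a $c$ exists by a theorem of Graver and Jurkat). Then $u=\sum_Y c(Y)\,Y\in M^{(a,b)}$, with coefficients reduced modulo $p$. *)

theory Defs
  imports
    Complex_Main
    "HOL-Computational_Algebra.Primes"
    "HOL-Combinatorics.Permutations"
    "HOL-Library.Function_Algebras"
begin

subsection \<open>Base \<open>p\<close> expansions\<close>

definition pdigit :: "nat \<Rightarrow> nat \<Rightarrow> nat \<Rightarrow> nat" where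
  "pdigit p x i = (x div p ^ i) mod p"

text \<open>The next two are meaningful for \<open>p \<ge> 2\<close> and \<open>x > 0\<close> only.\<close>

definition pval :: "nat \<Rightarrow> nat \<Rightarrow> nat" where
  "pval p x = (LEAST i. pdigit p x i \<noteq> 0)"

definition plen :: "nat \<Rightarrow> nat \<Rightarrow> nat" where
  "plen p x = (GREATEST i. pdigit p x i \<noteq> 0)"

definition James :: "nat \<Rightarrow> nat \<Rightarrow> nat \<Rightarrow> bool" where
  "James p a b \<longleftrightarrow> pval p (a + 1) > plen p b"

definition pointed_decomp :: "nat \<Rightarrow> nat \<Rightarrow> nat \<Rightarrow> nat \<Rightarrow> nat \<Rightarrow> bool" where
  "pointed_decomp p a b \<beta> bh \<longleftrightarrow>
     b = p ^ \<beta> + bh \<and> bh < p ^ pval p (a + 1) \<and> p ^ pval p (a + 1) < p ^ \<beta>"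

definition pointed :: "nat \<Rightarrow> nat \<Rightarrow> nat \<Rightarrow> bool" where
  "pointed p a b \<longleftrightarrow> (\<exists>\<beta> bh. pointed_decomp p a b \<beta> bh)"


subsection \<open>Formal sums of sets and the action of the symmetric group\<close>

text \<open>
  A formal sum of sets is represented by its coefficient function. All formal sums that occur are
  supported on subsets of some \<open>{1..n}\<close>, and the symmetric group of degree \<open>n\<close> is the set of all
  \<open>\<sigma>\<close> with \<open>\<sigma> permutes {1..n}\<close>.
\<close>

definition fscale :: "'k::field \<Rightarrow> (nat set \<Rightarrow> 'k) \<Rightarrow> (nat set \<Rightarrow> 'k)" where
  "fscale c f = (\<lambda>X. c * f X)"

global_interpretation fs: vector_space "fscale :: 'k::field \<Rightarrow> (nat set \<Rightarrow> 'k) \<Rightarrow> (nat set \<Rightarrow> 'k)"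
  by standard (auto simp: fscale_def fun_eq_iff algebra_simps)

definition single :: "nat set \<Rightarrow> (nat set \<Rightarrow> 'k::field)" where
  "single X = (\<lambda>Y. if Y = X then 1 else 0)"

text \<open>Linear extension of \<open>X \<mapsto> \<sigma> ` X\<close>, see \<open>act_single\<close> below.\<close>

definition act :: "(nat \<Rightarrow> nat) \<Rightarrow> (nat set \<Rightarrow> 'k::field) \<Rightarrow> (nat set \<Rightarrow> 'k)" where
  "act \<sigma> f = (\<lambda>X. f (inv \<sigma> ` X))"

lemma act_single:
  assumes "\<sigma> permutes A"
  shows "act \<sigma> (single X) = single (\<sigma> ` X)"
proof -
  have "bij \<sigma>" using assms by (rule permutes_bij)
  then have "inv \<sigma> ` Y = X \<longleftrightarrow> Y = \<sigma> ` X" for Y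
    by (metis bij_image_Collect_eq bij_is_inj bij_is_surj image_f_inv_f image_inv_f_f)
  then show ?thesis by (simp add: act_def single_def fun_eq_iff)
qed

definition submodule :: "nat \<Rightarrow> (nat set \<Rightarrow> 'k::field) set \<Rightarrow> bool" where
  "submodule n V \<longleftrightarrow> fs.subspace V \<and> (\<forall>\<sigma>. \<sigma> permutes {1..n} \<longrightarrow> (\<forall>f\<in>V. act \<sigma> f \<in> V))"

definition subsets_of_size :: "nat \<Rightarrow> nat \<Rightarrow> nat set set" where
  "subsets_of_size n r = {X. X \<subseteq> {1..n} \<and> card X = r}"

definition perm_module :: "nat \<Rightarrow> nat \<Rightarrow> (nat set \<Rightarrow> 'k::field) set" where
  "perm_module a b = {f. \<forall>X. f X \<noteq> 0 \<longrightarrow> X \<in> subsets_of_size (a + b) b}"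


subsection \<open>The Specht module\<close>

definition diagram :: "nat \<Rightarrow> nat \<Rightarrow> (nat \<times> nat) set" where
  "diagram a b = {1} \<times> {1..a} \<union> {2} \<times> {1..b}"

definition tableau :: "nat \<Rightarrow> nat \<Rightarrow> (nat \<times> nat \<Rightarrow> nat) \<Rightarrow> bool" where
  "tableau a b t \<longleftrightarrow> bij_betw t (diagram a b) {1..a + b}"

definition second_row :: "nat \<Rightarrow> (nat \<times> nat \<Rightarrow> nat) \<Rightarrow> nat set" where
  "second_row b t = t ` ({2} \<times> {1..b})"

definition column :: "nat \<Rightarrow> nat \<Rightarrow> (nat \<times> nat \<Rightarrow> nat) \<Rightarrow> nat \<Rightarrow> nat set" where
  "column a b t j = t ` {c \<in> diagram a b. snd c = j}"

definition column_stabilizer :: "nat \<Rightarrow> nat \<Rightarrow> (nat \<times> nat \<Rightarrow> nat) \<Rightarrow> (nat \<Rightarrow> nat) set" where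
  "column_stabilizer a b t =
     {\<pi>. \<pi> permutes {1..a + b} \<and> (\<forall>j. \<pi> ` column a b t j = column a b t j)}"

definition polytabloid :: "nat \<Rightarrow> nat \<Rightarrow> (nat \<times> nat \<Rightarrow> nat) \<Rightarrow> (nat set \<Rightarrow> 'k::field)" where
  "polytabloid a b t =
     (\<Sum>\<pi>\<in>column_stabilizer a b t. fscale (of_int (sign \<pi>)) (act \<pi> (single (second_row b t))))"

definition specht :: "nat \<Rightarrow> nat \<Rightarrow> (nat set \<Rightarrow> 'k::field) set" where
  "specht a b = fs.span {polytabloid a b t | t. tableau a b t}"


subsection \<open>Extensions of the Specht module by the trivial module\<close>

definition adjoin :: "nat \<Rightarrow> nat \<Rightarrow> (nat set \<Rightarrow> 'k::field) \<Rightarrow> (nat set \<Rightarrow> 'k) set" where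
  "adjoin a b x = fs.span (insert x (specht a b))"

text \<open>
  Since \<open>x\<close> spans \<open>adjoin a b x\<close> modulo \<open>specht a b\<close>, the condition \<open>x \<notin> specht a b\<close> says that the
  quotient is one dimensional; the last condition says that the group acts trivially on it.
\<close>

definition trivial_extension :: "nat \<Rightarrow> nat \<Rightarrow> (nat set \<Rightarrow> 'k::field) \<Rightarrow> bool" where
  "trivial_extension a b x \<longleftrightarrow>
     submodule (a + b) (adjoin a b x) \<and> x \<notin> specht a b \<and>
     (\<forall>\<sigma>. \<sigma> permutes {1..a + b} \<longrightarrow> (\<forall>y\<in>adjoin a b x. act \<sigma> y - y \<in> specht a b))"

definition split_extension :: "nat \<Rightarrow> nat \<Rightarrow> (nat set \<Rightarrow> 'k::field) \<Rightarrow> bool" where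
  "split_extension a b x \<longleftrightarrow>
     (\<exists>T. submodule (a + b) T \<and> specht a b \<inter> T = {0} \<and>
          adjoin a b x = {s + t | s t. s \<in> specht a b \<and> t \<in> T})"

definition module_iso ::
  "nat \<Rightarrow> (nat set \<Rightarrow> 'k::field) set \<Rightarrow> (nat set \<Rightarrow> 'k) set \<Rightarrow>
   ((nat set \<Rightarrow> 'k) \<Rightarrow> (nat set \<Rightarrow> 'k)) \<Rightarrow> bool" where
  "module_iso n E F \<phi> \<longleftrightarrow> bij_betw \<phi> E F \<and>
     (\<forall>y\<in>E. \<forall>z\<in>E. \<phi> (y + z) = \<phi> y + \<phi> z) \<and>
     (\<forall>c. \<forall>y\<in>E. \<phi> (fscale c y) = fscale c (\<phi> y)) \<and>
     (\<forall>\<sigma>. \<sigma> permutes {1..n} \<longrightarrow> (\<forall>y\<in>E. \<phi> (act \<sigma> y) = act \<sigma> (\<phi> y)))"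

definition equivalent_extensions ::
  "nat \<Rightarrow> nat \<Rightarrow> (nat set \<Rightarrow> 'k::field) \<Rightarrow> (nat set \<Rightarrow> 'k) \<Rightarrow> bool" where
  "equivalent_extensions a b x y \<longleftrightarrow>
     trivial_extension a b x \<and> trivial_extension a b y \<and>
     (\<exists>\<phi>. module_iso (a + b) (adjoin a b x) (adjoin a b y) \<phi> \<and> (\<forall>s\<in>specht a b. \<phi> s = s))"


subsection \<open>The element attached to a pointed partition\<close>

text \<open>Here \<open>q\<close> stands for \<open>p ^ \<beta>\<close>, so that \<open>b = q + bh\<close> and \<open>1 \<le> q \<le> a\<close>.\<close>

definition u0_sets :: "nat \<Rightarrow> nat \<Rightarrow> nat set set" where
  "u0_sets a q = {X \<in> subsets_of_size (a + q) q. X \<inter> {1..a - q + 1} = {}}"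

text \<open>The order-preserving bijection from \<open>{1..n - card Y}\<close> to \<open>{1..n} - Y\<close>.\<close>

definition relabel :: "nat \<Rightarrow> nat set \<Rightarrow> nat \<Rightarrow> nat" where
  "relabel n Y i = sorted_list_of_set ({1..n} - Y) ! (i - 1)"

definition u_Y :: "nat \<Rightarrow> nat \<Rightarrow> nat \<Rightarrow> nat set \<Rightarrow> (nat set \<Rightarrow> 'k::field)" where
  "u_Y a b q Y = (\<Sum>X\<in>u0_sets a q. single (relabel (a + b) Y ` X \<union> Y))"

definition u_bar :: "nat \<Rightarrow> nat \<Rightarrow> nat \<Rightarrow> nat \<Rightarrow> nat set \<Rightarrow> (nat set \<Rightarrow> 'k::field)" where
  "u_bar a b q bh X = (\<Sum>Y | Y \<subseteq> X \<and> card Y = bh. u_Y a b q Y)"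

text \<open>
  A non-null \<open>p\<close>-ary \<open>r\<close>-design of block size \<open>l\<close> on \<open>{1..n}\<close>; only the values of \<open>U\<close> on the
  \<open>l\<close>-subsets of \<open>{1..n}\<close> matter.
\<close>

definition nonnull_design :: "nat \<Rightarrow> nat \<Rightarrow> nat \<Rightarrow> (nat set \<Rightarrow> 'k::field) \<Rightarrow> bool" where
  "nonnull_design n r l U \<longleftrightarrow>
     (\<exists>\<alpha>. \<alpha> \<noteq> 0 \<and> (\<forall>Y\<in>subsets_of_size n r. (\<Sum>X | X \<in> subsets_of_size n l \<and> Y \<subseteq> X. U X) = \<alpha>))"

definition u_design :: "nat \<Rightarrow> nat \<Rightarrow> nat \<Rightarrow> nat \<Rightarrow> (nat set \<Rightarrow> 'k::field) \<Rightarrow> (nat set \<Rightarrow> 'k)" where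
  "u_design a b q bh U = (\<Sum>X\<in>subsets_of_size (a + b) (b - 1). fscale (U X) (u_bar a b q bh X))"


subsection \<open>The element attached to a James partition\<close>

definition james_d :: "nat \<Rightarrow> nat \<Rightarrow> nat \<Rightarrow> nat" where
  "james_d p a b = Min ((\<lambda>s. pval p ((a + b - s) choose a)) ` {..<b})"

text \<open>The division is exact for \<open>s < b\<close>.\<close>

definition james_mu :: "nat \<Rightarrow> nat \<Rightarrow> nat \<Rightarrow> nat \<Rightarrow> nat" where
  "james_mu p a b s = ((a + b - s) choose a) div p ^ james_d p a b"

definition james_coeffs :: "nat \<Rightarrow> nat \<Rightarrow> nat \<Rightarrow> (nat set \<Rightarrow> int) \<Rightarrow> bool" where
  "james_coeffs p a b c \<longleftrightarrow>
     (\<forall>s<b. \<forall>Z\<in>subsets_of_size (a + b) s.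
        (\<Sum>Y | Y \<in> subsets_of_size (a + b) b \<and> Z \<subseteq> Y. c Y) = int (james_mu p a b s))"

definition u_james :: "nat \<Rightarrow> nat \<Rightarrow> (nat set \<Rightarrow> int) \<Rightarrow> (nat set \<Rightarrow> 'k::field)" where
  "u_james a b c = (\<Sum>Y\<in>subsets_of_size (a + b) b. fscale (of_int (c Y)) (single Y))"

end

theory Submission
  imports Defs
begin

text \<open>
  Write \<open>n = a + b\<close>, and for \<open>Z \<subseteq> {1..n}\<close> consider the sum of the coefficients of an element of \<open>M\<close> over
  the \<open>b\<close>-sets that contain \<open>Z\<close>. The Specht module is the set of those elements of \<open>M\<close> for which all
  these sums with \<open>card Z < b\<close> vanish (\<open>specht_iff_kernel\<close>). Since the symmetric group is transitive on
  sets of a given size, an element \<open>x\<close> outside the Specht module spans a trivial extension exactly if these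
  sums depend only on \<open>card Z\<close>; such an \<open>x\<close> is a kind of block design with coefficients in the field. Write
  \<open>g (b - card Z)\<close> for the sums, so that \<open>g\<close> is a function on \<open>{1..b}\<close> (\<open>has_counts\<close>). It determines \<open>x\<close>
  modulo the Specht module. The extension splits exactly if \<open>x\<close> is congruent to a multiple of the sum of all
  \<open>b\<close>-sets, whose function is \<open>s \<mapsto> C(a + s, s)\<close>; and two non-split extensions whose functions are proportional
  modulo this one are equivalent, because subtracting a suitable multiple of the sum of all \<open>b\<close>-sets
  moves one into the other without changing the Specht module (\<open>equivalent_of_counts\<close>).

  So everything depends on which functions \<open>g\<close> occur. Counting pairs of nested sets gives
  \<open>C(s, t) g(s) = C(a + s, s - t) g(t)\<close> for \<open>1 \<le> t < s \<le> b\<close> (\<open>admissible\<close>). Modulo \<open>p\<close> these equations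
  express \<open>g\<close> through its values at powers of \<open>p\<close>, and relate the values at different powers in such a way
  that, modulo the multiples of \<open>C(a + s, s)\<close>, only the value at the largest power \<open>p ^ l \<le> b\<close> may remain free;
  it is free only if \<open>(a, b)\<close> is James or pointed
  (\<open>admissible_trivial_or_special\<close>, \<open>admissible_codim_1\<close>). Hence any single element with constant sums
  whose function is not a multiple of \<open>C(a + s, s)\<close> yields the only non-split extension up to equivalence,
  and it remains to see that the two explicit elements are of this kind.

  For James partitions the sums of \<open>u\<close> are the numbers \<open>\<mu>\<^sub>s\<close>, not all of them zero modulo \<open>p\<close>, while
  \<open>C(a + s, s)\<close> vanishes for \<open>1 \<le> s \<le> b\<close>. For pointed partitions \<open>u_design\<close> is a multiple of the
  sum of all \<open>u_Y\<close>, and in the sums of its coefficients the part that is not obviously constant cancels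
  modulo \<open>p\<close> (\<open>count_late_remainder\<close>).

  The designs needed for the two constructions come from the same circle of ideas. The divisibility
  conditions given by double counting are sufficient for the existence of a design with prescribed sums over
  any commutative ring (\<open>design_exists\<close>): one corrects the sums one set size at a time, and each
  correction lies in a kernel that is spanned by explicit products of differences
  (\<open>kernel_intersection\<close>), which lift to larger sets.
\<close>

section \<open>Sums of coefficients over supersets\<close>

text \<open>
  A function on sets stands for a formal sum of sets, or for a squarefree polynomial with the points of
  \<open>V\<close> as variables.
\<close>

definition superset_sum :: "'v set \<Rightarrow> ('v set \<Rightarrow> 'r::comm_ring_1) \<Rightarrow> 'v set \<Rightarrow> 'r" where
  "superset_sum V f Z = (\<Sum>Y | Y \<subseteq> V \<and> Z \<subseteq> Y. f Y)"

definition homog :: "'v set \<Rightarrow> nat \<Rightarrow> ('v set \<Rightarrow> 'r::comm_ring_1) set" where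
  "homog V l = {f. \<forall>X. \<not> (X \<subseteq> V \<and> card X = l) \<longrightarrow> f X = 0}"

lemma superset_sum_add: "superset_sum V (\<lambda>X. f X + g X) Z = superset_sum V f Z + superset_sum V g Z"
  by (simp add: superset_sum_def sum.distrib)

lemma superset_sum_diff: "superset_sum V (\<lambda>X. f X - g X) Z = superset_sum V f Z - superset_sum V g Z"
  by (simp add: superset_sum_def sum_subtractf)

lemma superset_sum_scale: "superset_sum V (\<lambda>X. c * f X) Z = c * superset_sum V f Z"
  by (simp add: superset_sum_def sum_distrib_left)

lemma homog_eq_zero:
  assumes "f \<in> homog V l" "\<not> (X \<subseteq> V \<and> card X = l)"
  shows "f X = 0"
  using assms by (auto simp: homog_def)

lemma homog_add: "f \<in> homog V l \<Longrightarrow> g \<in> homog V l \<Longrightarrow> (\<lambda>X. f X + g X) \<in> homog V l"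
  by (simp add: homog_def)

lemma homog_diff: "f \<in> homog V l \<Longrightarrow> g \<in> homog V l \<Longrightarrow> (\<lambda>X. f X - g X) \<in> homog V l"
  by (simp add: homog_def)

lemma homog_scale: "f \<in> homog V l \<Longrightarrow> (\<lambda>X. c * f X) \<in> homog V l"
  by (simp add: homog_def)

lemma superset_sum_homog:
  assumes "finite V" "f \<in> homog V l"
  shows "superset_sum V f Z = (\<Sum>Y | Y \<subseteq> V \<and> card Y = l \<and> Z \<subseteq> Y. f Y)"
  unfolding superset_sum_def
  by (rule sum.mono_neutral_right) (use assms in \<open>auto simp: homog_def\<close>)

lemma superset_sum_same_size:
  assumes "finite V" "f \<in> homog V l" "card Z = l" "Z \<subseteq> V"
  shows "superset_sum V f Z = f Z"
proof -
  have "{Y. Y \<subseteq> V \<and> card Y = l \<and> Z \<subseteq> Y} = {Z}"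
    using assms card_subset_eq[of _ Z] finite_subset[OF _ assms(1)] by blast
  then show ?thesis using assms by (simp add: superset_sum_homog)
qed

lemma card_intermediate_sets:
  assumes "finite Y" "Z \<subseteq> Y" "card Z \<le> t"
  shows "card {T. Z \<subseteq> T \<and> T \<subseteq> Y \<and> card T = t} = (card Y - card Z) choose (t - card Z)"
proof -
  have fZ: "finite Z" using assms finite_subset by blast
  have "bij_betw (\<lambda>T. T - Z) {T. Z \<subseteq> T \<and> T \<subseteq> Y \<and> card T = t}
          {B. B \<subseteq> Y - Z \<and> card B = t - card Z}"
  proof (rule bij_betwI[where g = "\<lambda>B. B \<union> Z"])
    show "(\<lambda>T. T - Z) \<in> {T. Z \<subseteq> T \<and> T \<subseteq> Y \<and> card T = t} \<rightarrow> {B. B \<subseteq> Y - Z \<and> card B = t - card Z}"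
      using fZ by (auto simp: card_Diff_subset)
    show "(\<lambda>B. B \<union> Z) \<in> {B. B \<subseteq> Y - Z \<and> card B = t - card Z} \<rightarrow> {T. Z \<subseteq> T \<and> T \<subseteq> Y \<and> card T = t}"
    proof
      fix B assume "B \<in> {B. B \<subseteq> Y - Z \<and> card B = t - card Z}"
      then have B: "B \<subseteq> Y - Z" "card B = t - card Z" by auto
      have "card (B \<union> Z) = card B + card Z"
        by (rule card_Un_disjoint) (use B fZ assms(1) finite_subset in blast)+
      then show "B \<union> Z \<in> {T. Z \<subseteq> T \<and> T \<subseteq> Y \<and> card T = t}" using B assms by auto
    qed
  qed auto
  then have "card {T. Z \<subseteq> T \<and> T \<subseteq> Y \<and> card T = t} = card {B. B \<subseteq> Y - Z \<and> card B = t - card Z}"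
    by (rule bij_betw_same_card)
  also have "\<dots> = card (Y - Z) choose (t - card Z)"
    by (rule n_subsets) (use assms in auto)
  finally show ?thesis using assms fZ by (simp add: card_Diff_subset)
qed

text \<open>
  Both sides count the pairs \<open>Z \<subseteq> T \<subseteq> Y\<close> with weight \<open>f Y\<close>: given \<open>Y\<close>, the number of choices for \<open>T\<close> is
  the binomial coefficient.
\<close>

lemma sum_superset_sum:
  assumes V: "finite V" and f: "f \<in> homog V l" and Z: "Z \<subseteq> V" and t: "card Z \<le> t"
  shows "(\<Sum>T | T \<subseteq> V \<and> card T = t \<and> Z \<subseteq> T. superset_sum V f T)
           = of_nat ((l - card Z) choose (t - card Z)) * superset_sum V f Z"
proof -
  let ?A = "{T. T \<subseteq> V \<and> card T = t \<and> Z \<subseteq> T}" and ?B = "{Y. Y \<subseteq> V}"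
  have "(\<Sum>T\<in>?A. superset_sum V f T) = (\<Sum>T\<in>?A. \<Sum>Y | Y \<in> ?B \<and> T \<subseteq> Y. f Y)"
    by (simp add: superset_sum_def)
  also have "\<dots> = (\<Sum>Y\<in>?B. \<Sum>T | T \<in> ?A \<and> T \<subseteq> Y. f Y)"
    by (rule sum.swap_restrict) (use V in auto)
  also have "\<dots> = (\<Sum>Y | Y \<subseteq> V \<and> Z \<subseteq> Y. of_nat ((l - card Z) choose (t - card Z)) * f Y)"
  proof (rule sum.mono_neutral_cong_right)
    show "\<forall>Y\<in>?B - {Y. Y \<subseteq> V \<and> Z \<subseteq> Y}. (\<Sum>T | T \<in> ?A \<and> T \<subseteq> Y. f Y) = 0"
    proof
      fix Y assume "Y \<in> ?B - {Y. Y \<subseteq> V \<and> Z \<subseteq> Y}"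
      then have "{T. T \<in> ?A \<and> T \<subseteq> Y} = {}" by auto
      then show "(\<Sum>T | T \<in> ?A \<and> T \<subseteq> Y. f Y) = 0" by (simp only: sum.empty)
    qed
    fix Y assume Y: "Y \<in> {Y. Y \<subseteq> V \<and> Z \<subseteq> Y}"
    show "(\<Sum>T | T \<in> ?A \<and> T \<subseteq> Y. f Y) = of_nat ((l - card Z) choose (t - card Z)) * f Y"
    proof (cases "f Y = 0")
      case False
      then have cY: "card Y = l" using f by (auto simp: homog_def)
      have "{T. T \<in> ?A \<and> T \<subseteq> Y} = {T. Z \<subseteq> T \<and> T \<subseteq> Y \<and> card T = t}" using Y by auto
      moreover have "finite Y" using Y V finite_subset by blast
      ultimately show ?thesis using Y t card_intermediate_sets[of Y Z t] by (simp add: cY)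
    qed simp
  qed (use V in auto)
  finally show ?thesis by (simp add: superset_sum_def sum_distrib_left)
qed

text \<open>
  Inclusion and exclusion over the points of \<open>B\<close> that belong to \<open>Y\<close>.
\<close>

lemma superset_sum_eq_sum_avoiding:
  fixes f :: "'v set \<Rightarrow> 'r::comm_ring_1"
  assumes "finite V" "finite B" "B \<subseteq> V"
  shows "(\<Sum>Y | Y \<subseteq> V \<and> A \<subseteq> Y \<and> Y \<inter> B = {}. f Y) = (\<Sum>C\<in>Pow B. (-1) ^ card C * superset_sum V f (A \<union> C))"
  using assms(2,3)
proof (induction B arbitrary: A)
  case empty
  then show ?case by (simp add: superset_sum_def)
next
  case (insert v B)
  have split: "{Y. Y \<subseteq> V \<and> A \<subseteq> Y \<and> Y \<inter> B = {}}
      = {Y. Y \<subseteq> V \<and> A \<subseteq> Y \<and> Y \<inter> insert v B = {}} \<union> {Y. Y \<subseteq> V \<and> insert v A \<subseteq> Y \<and> Y \<inter> B = {}}"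
    using insert.prems by auto
  have "(\<Sum>Y | Y \<subseteq> V \<and> A \<subseteq> Y \<and> Y \<inter> B = {}. f Y) =
      (\<Sum>Y | Y \<subseteq> V \<and> A \<subseteq> Y \<and> Y \<inter> insert v B = {}. f Y) +
      (\<Sum>Y | Y \<subseteq> V \<and> insert v A \<subseteq> Y \<and> Y \<inter> B = {}. f Y)"
    unfolding split by (rule sum.union_disjoint) (use assms(1) insert.hyps in auto)
  then have e1: "(\<Sum>C\<in>Pow B. (-1) ^ card C * superset_sum V f (A \<union> C)) =
      (\<Sum>Y | Y \<subseteq> V \<and> A \<subseteq> Y \<and> Y \<inter> insert v B = {}. f Y) +
      (\<Sum>C\<in>Pow B. (-1) ^ card C * superset_sum V f (insert v A \<union> C))"
    using insert.IH[of A] insert.IH[of "insert v A"] insert.prems by (simp only: insert_subset)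
  have e2: "(\<Sum>C\<in>Pow (insert v B). (-1) ^ card C * superset_sum V f (A \<union> C))
     = (\<Sum>C\<in>Pow B. (-1) ^ card C * superset_sum V f (A \<union> C))
       + (\<Sum>C\<in>insert v ` Pow B. (-1) ^ card C * superset_sum V f (A \<union> C))"
    unfolding Pow_insert by (rule sum.union_disjoint) (use insert.hyps in auto)
  have e3: "(\<Sum>C\<in>insert v ` Pow B. (-1) ^ card C * superset_sum V f (A \<union> C))
     = (\<Sum>C\<in>Pow B. - ((-1) ^ card C * superset_sum V f (insert v A \<union> C)))"
  proof (rule sum.reindex_cong[where l = "insert v"])
    show "inj_on (insert v) (Pow B)" using insert.hyps by (auto simp: inj_on_def insert_ident)
    fix C assume "C \<in> Pow B"
    then have "finite C" "v \<notin> C" using insert.hyps finite_subset by auto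
    then show "(-1) ^ card (insert v C) * superset_sum V f (A \<union> insert v C)
        = - ((-1) ^ card C * superset_sum V f (insert v A \<union> C))" by simp
  qed simp
  show ?case
    unfolding e2 e3 sum_negf using e1[symmetric] by (simp only: add_uminus_conv_diff eq_diff_eq)
qed

text \<open>
  If \<open>V\<close> has fewer than \<open>2 * j\<close> points, the complement of a \<open>j\<close>-set \<open>X\<close> has fewer than \<open>j\<close> points. As
  \<open>X\<close> is the only \<open>j\<close>-set that avoids this complement, inclusion and exclusion expresses \<open>f X\<close> by sums that
  vanish.
\<close>

lemma zero_of_superset_sum_zero:
  assumes V: "finite V" and f: "f \<in> homog V j" and big: "card V < 2 * j"
    and ker: "\<And>Z. Z \<subseteq> V \<Longrightarrow> card Z < j \<Longrightarrow> superset_sum V f Z = 0"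
  shows "f X = 0"
proof (rule ccontr)
  assume nz: "f X \<noteq> 0"
  then have X: "X \<subseteq> V" "card X = j" using f by (auto simp: homog_def)
  let ?B = "V - X"
  have fX: "finite X" using V X finite_subset by blast
  have cB: "card ?B < j" using X big V fX by (simp add: card_Diff_subset)
  have "(\<Sum>Y | Y \<subseteq> V \<and> {} \<subseteq> Y \<and> Y \<inter> ?B = {}. f Y) = (\<Sum>Y\<in>{X}. f Y)"
  proof (rule sum.mono_neutral_right)
    show "\<forall>Y\<in>{Y. Y \<subseteq> V \<and> {} \<subseteq> Y \<and> Y \<inter> ?B = {}} - {X}. f Y = 0"
    proof
      fix Y assume Y: "Y \<in> {Y. Y \<subseteq> V \<and> {} \<subseteq> Y \<and> Y \<inter> ?B = {}} - {X}"
      then have "Y \<subset> X" by auto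
      then have "card Y < j" using fX X psubset_card_mono by blast
      then show "f Y = 0" using f by (auto simp: homog_def)
    qed
  qed (use V X in auto)
  moreover have "(\<Sum>Y | Y \<subseteq> V \<and> {} \<subseteq> Y \<and> Y \<inter> ?B = {}. f Y) = (\<Sum>C\<in>Pow ?B. (-1) ^ card C * superset_sum V f ({} \<union> C))"
    by (rule superset_sum_eq_sum_avoiding) (use V in auto)
  moreover have "superset_sum V f ({} \<union> C) = 0" if "C \<in> Pow ?B" for C
  proof -
    have "card C \<le> card ?B" using that V by (intro card_mono) auto
    then show ?thesis using ker[of C] that cB by auto
  qed
  ultimately show False using nz by simp
qed

section \<open>Products of differences and the intersection of the kernels\<close>

text \<open>
  The squarefree polynomial \<open>\<Prod>(X\<^sub>x - X\<^sub>y) \<cdot> \<Prod>\<^sub>c X\<^sub>c\<close>, where \<open>(x, y)\<close> runs through \<open>ps\<close> and \<open>c\<close> through \<open>C\<close>.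
\<close>

fun pairprod :: "('v \<times> 'v) list \<Rightarrow> 'v set \<Rightarrow> 'v set \<Rightarrow> 'r::comm_ring_1" where
  "pairprod [] C = (\<lambda>X. if X = C then 1 else 0)"
| "pairprod ((x, y) # ps) C = (\<lambda>X. pairprod ps (insert x C) X - pairprod ps (insert y C) X)"

fun entries :: "('v \<times> 'v) list \<Rightarrow> 'v list" where
  "entries [] = []"
| "entries ((x, y) # ps) = x # y # entries ps"

lemma length_entries: "length (entries ps) = 2 * length ps"
  by (induction ps rule: entries.induct) auto

lemma pairprod_support:
  assumes "(pairprod ps C :: _ \<Rightarrow> 'r::comm_ring_1) X \<noteq> 0" "distinct (entries ps)" "finite C" "set (entries ps) \<inter> C = {}"
  shows "C \<subseteq> X \<and> X \<subseteq> C \<union> set (entries ps) \<and> card X = card C + length ps"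
  using assms
proof (induction ps arbitrary: C rule: entries.induct)
  case 1
  then show ?case by (auto split: if_splits)
next
  case (2 x y ps)
  then consider "(pairprod ps (insert x C) :: _ \<Rightarrow> 'r) X \<noteq> 0" | "(pairprod ps (insert y C) :: _ \<Rightarrow> 'r) X \<noteq> 0"
    by fastforce
  then show ?case
  proof cases
    case 1
    then show ?thesis using "2.IH"[of "insert x C"] "2.prems" by auto
  next
    case _: 2
    then show ?thesis using "2.IH"[of "insert y C"] "2.prems" by auto
  qed
qed

lemma pairprod_insert:
  assumes "v \<notin> C" "v \<notin> X" "v \<notin> set (entries ps)"
  shows "pairprod ps (insert v C) (insert v X) = pairprod ps C X"
  using assms
proof (induction ps arbitrary: C rule: entries.induct)
  case 1
  then show ?case by (auto simp: insert_ident)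
next
  case (2 x y ps)
  then show ?case using "2.IH"[of "insert x C"] "2.IH"[of "insert y C"]
    by (simp add: insert_commute[of _ v])
qed

lemma pairprod_homog:
  assumes "distinct (entries ps)" "finite C" "set (entries ps) \<inter> C = {}" "set (entries ps) \<union> C \<subseteq> V"
  shows "pairprod ps C \<in> homog V (card C + length ps)"
  unfolding homog_def
proof (intro CollectI allI impI)
  fix X assume X: "\<not> (X \<subseteq> V \<and> card X = card C + length ps)"
  show "pairprod ps C X = 0"
  proof (rule ccontr)
    assume "pairprod ps C X \<noteq> 0"
    from pairprod_support[OF this assms(1-3)] show False using X assms(4) by auto
  qed
qed

lemma superset_sum_indicator:
  assumes "C \<subseteq> V" "finite V"
  shows "superset_sum V (\<lambda>X. if X = C then 1 else 0) Z = (if Z \<subseteq> C then 1 else 0 :: 'r::comm_ring_1)"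
  using assms by (simp add: superset_sum_def sum.delta')

lemma superset_sum_pairprod_reduce:
  assumes "finite V" "set (entries ps) \<union> C \<subseteq> V" "set (entries ps) \<inter> C = {}" "distinct (entries ps)"
  shows "superset_sum V (pairprod ps C) Z = (superset_sum V (pairprod ps {}) (Z - C) :: 'r::comm_ring_1)"
  using assms(2-)
proof (induction ps arbitrary: C Z rule: entries.induct)
  case 1
  then show ?case using assms(1) by (auto simp: superset_sum_indicator)
next
  case (2 x y ps)
  have a: "superset_sum V (pairprod ps (insert w C)) Z = (superset_sum V (pairprod ps {w}) (Z - C) :: 'r)"
    if w: "w \<in> {x, y}" for w
  proof -
    have "superset_sum V (pairprod ps (insert w C)) Z = (superset_sum V (pairprod ps {}) (Z - insert w C) :: 'r)"
      using w "2.prems" by (intro "2.IH") auto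
    moreover have "superset_sum V (pairprod ps {w}) (Z - C) = (superset_sum V (pairprod ps {}) (Z - C - {w}) :: 'r)"
      using w "2.prems" by (intro "2.IH") auto
    moreover have "Z - insert w C = Z - C - {w}" by auto
    ultimately show ?thesis by simp
  qed
  show ?case by (simp add: superset_sum_diff a)
qed

lemma superset_sum_pairprod_outside:
  assumes "finite V" "set (entries ps) \<subseteq> V" "distinct (entries ps)" "\<not> Z \<subseteq> set (entries ps)"
  shows "superset_sum V (pairprod ps {}) Z = 0"
  unfolding superset_sum_def
proof (rule sum.neutral, rule ballI)
  fix Y assume "Y \<in> {Y. Y \<subseteq> V \<and> Z \<subseteq> Y}"
  then show "pairprod ps {} Y = 0" using pairprod_support[of ps "{}" Y] assms by auto
qed

text \<open>
  A set \<open>Z\<close> with fewer points than there are pairs misses some pair \<open>(x, y)\<close>, and exchanging \<open>x\<close> and \<open>y\<close>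
  in the sets containing \<open>Z\<close> changes the sign of their coefficients.
\<close>

lemma superset_sum_pairprod_zero:
  assumes "finite V" "set (entries ps) \<subseteq> V" "distinct (entries ps)" "finite Z" "card Z < length ps"
  shows "superset_sum V (pairprod ps {}) Z = (0 :: 'r::comm_ring_1)"
  using assms(2-)
proof (induction ps arbitrary: Z rule: entries.induct)
  case 1
  then show ?case by simp
next
  case (2 x y ps)
  have r: "superset_sum V (pairprod ps {w}) Z = (superset_sum V (pairprod ps {}) (Z - {w}) :: 'r)" if "w \<in> {x, y}" for w
    by (rule superset_sum_pairprod_reduce) (use that "2.prems" assms(1) in auto)
  have z: "superset_sum V (pairprod ps {}) (Z - {w}) = (0 :: 'r)" if w: "w \<in> {x, y}" and ne: "Z \<inter> {x, y} \<noteq> {}" for w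
  proof (cases "w \<in> Z")
    case True
    then have "card (Z - {w}) < length ps" using "2.prems"
      by (metis Suc_less_eq card.remove length_Cons)
    then show ?thesis using "2.prems" by (intro "2.IH") auto
  next
    case False
    then have "\<not> Z - {w} \<subseteq> set (entries ps)" using w ne "2.prems" by auto
    then show ?thesis using "2.prems" assms(1) by (intro superset_sum_pairprod_outside) auto
  qed
  show ?case
  proof (cases "Z \<inter> {x, y} = {}")
    case True
    then have "Z - {x} = Z" "Z - {y} = Z" by auto
    then show ?thesis using r[of x] r[of y] by (simp add: superset_sum_diff)
  next
    case False
    then show ?thesis using r[of x] r[of y] z[of x] z[of y] by (simp add: superset_sum_diff)
  qed
qed

text \<open>
  This is what allows elements of the kernel to be lifted to larger sets: multiplying by further
  variables leaves the sums over small sets unchanged.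
\<close>

lemma superset_sum_pairprod_extend:
  assumes V: "finite V" and ps: "set (entries ps) \<union> C \<subseteq> V" "set (entries ps) \<inter> C = {}" "distinct (entries ps)"
    and Z: "Z \<subseteq> V" "card Z \<le> length ps"
  shows "superset_sum V (pairprod ps C) Z = (superset_sum V (pairprod ps {}) Z :: 'r::comm_ring_1)"
proof (cases "Z \<inter> C = {}")
  case True
  then have "Z - C = Z" by auto
  then show ?thesis using superset_sum_pairprod_reduce[OF V ps, of Z] by simp
next
  case False
  have fZ: "finite Z" using V Z finite_subset by blast
  have "card (Z - C) < card Z"
    by (rule psubset_card_mono) (use False fZ in auto)
  then have "superset_sum V (pairprod ps {}) (Z - C) = (0 :: 'r)"
    using V ps Z fZ by (intro superset_sum_pairprod_zero) auto
  moreover have "superset_sum V (pairprod ps {}) Z = (0 :: 'r)"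
    using V ps False by (intro superset_sum_pairprod_outside) auto
  ultimately show ?thesis by (simp only: superset_sum_pairprod_reduce[OF V ps, of Z])
qed

text \<open>
  Defined directly and not as the span in a vector space, since designs with integer coefficients are
  needed as well.
\<close>

inductive_set pairspan :: "'v set \<Rightarrow> nat \<Rightarrow> ('v set \<Rightarrow> 'r::comm_ring_1) set" for V j where
  zero: "(\<lambda>X. 0) \<in> pairspan V j"
| gen: "f \<in> pairspan V j \<Longrightarrow> distinct (entries ps) \<Longrightarrow> set (entries ps) \<subseteq> V \<Longrightarrow> length ps = j \<Longrightarrow>
    (\<lambda>X. f X + c * pairprod ps {} X) \<in> pairspan V j"

lemma pairspan_add:
  assumes "f \<in> pairspan V j" "g \<in> pairspan V j"
  shows "(\<lambda>X. f X + g X) \<in> pairspan V j"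
  using assms(2)
proof induction
  case zero
  then show ?case using assms(1) by simp
next
  case (gen g ps c)
  then show ?case using pairspan.gen[OF gen(5) gen(2,3,4), of c] by (simp add: add.assoc)
qed

lemma pairspan_mono: "f \<in> pairspan V j \<Longrightarrow> V \<subseteq> W \<Longrightarrow> f \<in> pairspan W j"
  by (induction rule: pairspan.induct) (auto intro: pairspan.intros)

lemma pairspan_homog:
  fixes f :: "'v set \<Rightarrow> 'r::comm_ring_1"
  assumes "f \<in> pairspan V j"
  shows "f \<in> homog V j"
  using assms
proof induction
  case zero
  show ?case by (simp add: homog_def)
next
  case (gen f ps c)
  have "(pairprod ps {} :: 'v set \<Rightarrow> 'r) \<in> homog V (card ({} :: 'v set) + length ps)"
    by (rule pairprod_homog) (use gen.hyps in auto)
  then have "(\<lambda>X. c * pairprod ps {} X) \<in> homog V j"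
    using gen.hyps by (intro homog_scale) simp
  with gen.IH show ?case by (rule homog_add)
qed

lemma pairspan_superset_sum_zero:
  assumes "f \<in> pairspan V j" "finite V" "finite Z" "card Z < j"
  shows "superset_sum V f Z = 0"
  using assms(1)
proof induction
  case zero
  then show ?case by (simp add: superset_sum_def)
next
  case (gen f ps c)
  then show ?case using assms by (simp add: superset_sum_add superset_sum_scale superset_sum_pairprod_zero)
qed

text \<open>
  The link between \<open>V\<close> and \<open>insert v V\<close> that drives the induction on the ground set.
\<close>

lemma superset_sum_insert_point:
  assumes V: "v \<notin> V" and Z: "v \<notin> Z"
  shows "superset_sum V (\<lambda>X. if v \<in> X then 0 else f (insert v X)) Z = superset_sum (insert v V) f (insert v Z)"
  unfolding superset_sum_def
proof (rule sum.reindex_cong[where l = "\<lambda>Y. Y - {v}"])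
  show "inj_on (\<lambda>Y. Y - {v}) {Y. Y \<subseteq> insert v V \<and> insert v Z \<subseteq> Y}"
    by (rule inj_onI) (metis (no_types, lifting) insert_Diff insert_subset mem_Collect_eq)
  show "{Y. Y \<subseteq> V \<and> Z \<subseteq> Y} = (\<lambda>Y. Y - {v}) ` {Y. Y \<subseteq> insert v V \<and> insert v Z \<subseteq> Y}"
  proof (intro equalityI subsetI)
    fix Y assume "Y \<in> {Y. Y \<subseteq> V \<and> Z \<subseteq> Y}"
    then have "Y = insert v Y - {v}" "insert v Y \<in> {Y. Y \<subseteq> insert v V \<and> insert v Z \<subseteq> Y}"
      using V by auto
    then show "Y \<in> (\<lambda>Y. Y - {v}) ` {Y. Y \<subseteq> insert v V \<and> insert v Z \<subseteq> Y}" by (rule image_eqI)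
  qed (use Z in blast)
  fix Y assume "Y \<in> {Y. Y \<subseteq> insert v V \<and> insert v Z \<subseteq> Y}"
  then have "insert v (Y - {v}) = Y" by blast
  then show "(if v \<in> Y - {v} then 0 else f (insert v (Y - {v}))) = f Y" by simp
qed

text \<open>
  The bound on \<open>i\<close> leaves a point \<open>w\<close> outside the pairs of a given product, and multiplying the product by
  \<open>X\<^sub>v - X\<^sub>w\<close> prescribes its coefficients on the sets containing \<open>v\<close>.
\<close>

lemma pairspan_lift_point:
  fixes g :: "'v set \<Rightarrow> 'r::comm_ring_1"
  assumes "g \<in> pairspan V i" "v \<notin> V" "finite V" "2 * i < card V"
  shows "\<exists>F \<in> pairspan (insert v V) (Suc i). \<forall>X. v \<notin> X \<longrightarrow> F (insert v X) = g X"
  using assms(1)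
proof induction
  case zero
  show ?case by (rule bexI[OF _ pairspan.zero]) simp
next
  case (gen g ps c)
  obtain F where F: "F \<in> pairspan (insert v V) (Suc i)" "\<And>X. v \<notin> X \<Longrightarrow> F (insert v X) = g X"
    using gen.IH by blast
  have "card (set (entries ps)) < card V"
    using gen.hyps assms by (simp add: distinct_card length_entries)
  then have "\<not> V \<subseteq> set (entries ps)" by (meson card_mono not_less List.finite_set)
  then obtain w where w: "w \<in> V" "w \<notin> set (entries ps)" by blast
  have vps: "v \<notin> set (entries ps)" using gen.hyps assms(2) by auto
  have vw: "v \<noteq> w" using w assms(2) by auto
  let ?F = "\<lambda>X. F X + c * pairprod ((v, w) # ps) {} X"
  have "?F \<in> pairspan (insert v V) (Suc i)"
  proof (rule pairspan.gen[OF F(1)])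
    show "distinct (entries ((v, w) # ps))" using gen.hyps w vps vw by simp
    show "set (entries ((v, w) # ps)) \<subseteq> insert v V" using gen.hyps w by auto
    show "length ((v, w) # ps) = Suc i" using gen.hyps by simp
  qed
  then show ?case
  proof (rule bexI[rotated], intro allI impI)
    fix X assume X: "v \<notin> X"
    have "pairprod ps {w} (insert v X) = (0 :: 'r)"
    proof (rule ccontr)
      assume "pairprod ps {w} (insert v X) \<noteq> (0 :: 'r)"
      from pairprod_support[OF this] have "v \<in> {w} \<union> set (entries ps)" using gen.hyps w by auto
      then show False using vw vps by simp
    qed
    moreover have "pairprod ps {v} (insert v X) = (pairprod ps {} X :: 'r)"
      by (rule pairprod_insert) (use X vps in auto)
    ultimately show "?F (insert v X) = g X + c * pairprod ps {} X"
      by (simp only: pairprod.simps F(2)[OF X] diff_zero)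
  qed
qed

lemma pairspan_size_zero:
  assumes f: "f \<in> homog V 0" and V: "finite V"
  shows "f \<in> pairspan V 0"
proof -
  obtain c where c: "c = f {}" by simp
  have "f X = 0" if "X \<noteq> {}" for X
    using homog_eq_zero[OF f, of X] that finite_subset[OF _ V, of X] by (metis card_0_eq)
  then have f_eq: "f = (\<lambda>X. (\<lambda>X. 0) X + c * pairprod [] {} X)"
    using c by (auto simp: fun_eq_iff)
  show ?thesis unfolding f_eq by (rule pairspan.gen[OF pairspan.zero]) auto
qed

text \<open>
  Induction on the ground set. For \<open>V\<close> with a new point \<open>v\<close>, the coefficients of \<open>f\<close> on the sets containing
  \<open>v\<close> again form an element of the kernel, one degree lower, so they agree with those of a combination \<open>F\<close> of
  products one of whose factors involves \<open>v\<close>; and \<open>f - F\<close> does not involve \<open>v\<close>. Only small degrees need this,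
  because for \<open>card V < 2 * j\<close> the kernel is zero.
\<close>

theorem kernel_intersection:
  fixes f :: "'v set \<Rightarrow> 'r::comm_ring_1"
  assumes "finite V" "f \<in> homog V j" "\<And>Z. Z \<subseteq> V \<Longrightarrow> card Z < j \<Longrightarrow> superset_sum V f Z = 0"
  shows "f \<in> pairspan V j"
  using assms
proof (induction V arbitrary: f j rule: finite_induct)
  case empty
  then show ?case
  proof (cases "j = 0")
    case True
    then show ?thesis using pairspan_size_zero[of f "{}"] empty by simp
  next
    case False
    then have "f = (\<lambda>X. 0)" using zero_of_superset_sum_zero[of "{}" f j] empty by auto
    then show ?thesis using pairspan.zero by simp
  qed
next
  case (insert v V)
  have fV: "finite (insert v V)" using insert by simp
  consider "card (insert v V) < 2 * j" | "j = 0" | i where "j = Suc i" "2 * i < card V"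
  proof (cases j)
    case (Suc i)
    have "card (insert v V) = Suc (card V)" using insert.hyps by simp
    then show ?thesis using Suc that(1) that(3)[OF Suc] by linarith
  qed (rule that)
  then show ?case
  proof cases
    case 1
    then have "f = (\<lambda>X. 0)" using zero_of_superset_sum_zero[OF fV insert.prems(1)] insert.prems by auto
    then show ?thesis using pairspan.zero by simp
  next
    case 2
    then show ?thesis using pairspan_size_zero[of f "insert v V"] insert.prems(1) fV by simp
  next
    case 3
    define f1 where "f1 = (\<lambda>X. if v \<in> X then 0 else f (insert v X))"
    have "f1 \<in> pairspan V i"
    proof (rule insert.IH)
      show "f1 \<in> homog V i"
        unfolding homog_def
      proof (intro CollectI allI impI)
        fix X assume X: "\<not> (X \<subseteq> V \<and> card X = i)"
        show "f1 X = 0"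
        proof (rule ccontr)
          assume nz: "f1 X \<noteq> 0"
          then have "v \<notin> X" "f (insert v X) \<noteq> 0" by (auto simp: f1_def split: if_splits)
          then have vX: "v \<notin> X" "insert v X \<subseteq> insert v V" "card (insert v X) = Suc i"
            using homog_eq_zero[OF insert.prems(1), of "insert v X"] 3 by auto
          then have "X \<subseteq> V" by auto
          moreover have "finite X" using \<open>X \<subseteq> V\<close> insert.hyps finite_subset by blast
          ultimately show False using X vX by auto
        qed
      qed
      fix Z assume Z: "Z \<subseteq> V" "card Z < i"
      have "finite Z" using Z insert.hyps finite_subset by blast
      then have "superset_sum (insert v V) f (insert v Z) = 0"
        using Z insert.hyps 3 by (intro insert.prems) (auto simp: card_insert_if)
      then show "superset_sum V f1 Z = 0"
        unfolding f1_def using Z insert.hyps by (subst superset_sum_insert_point) auto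
    qed
    from pairspan_lift_point[OF this insert.hyps(2,1) 3(2)]
    obtain F where F: "F \<in> pairspan (insert v V) j" "\<And>X. v \<notin> X \<Longrightarrow> F (insert v X) = f1 X"
      unfolding 3(1) by blast
    let ?d = "\<lambda>X. f X - F X"
    have dh: "?d \<in> homog (insert v V) j"
      using insert.prems(1) pairspan_homog[OF F(1)] by (rule homog_diff)
    have dv: "?d X = 0" if "v \<in> X" for X
      using F(2)[of "X - {v}"] that by (simp add: f1_def insert_absorb)
    \<comment> \<open>By the choice of \<open>F\<close> the difference is supported on subsets of \<open>V\<close>, where the induction hypothesis applies in the same degree.\<close>
    have "?d \<in> pairspan V j"
    proof (rule insert.IH)
      show "?d \<in> homog V j"
        unfolding homog_def
      proof (intro CollectI allI impI)
        fix X assume X: "\<not> (X \<subseteq> V \<and> card X = j)"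
        show "?d X = 0"
        proof (cases "v \<in> X")
          case False
          then have "\<not> (X \<subseteq> insert v V \<and> card X = j)" using X by auto
          then show ?thesis by (rule homog_eq_zero[OF dh])
        qed (rule dv)
      qed
      fix Z assume Z: "Z \<subseteq> V" "card Z < j"
      have fZ: "finite Z" using Z insert.hyps finite_subset by blast
      have "superset_sum V ?d Z = superset_sum (insert v V) ?d Z"
        unfolding superset_sum_def
      proof (rule sum.mono_neutral_left)
        show "\<forall>Y\<in>{Y. Y \<subseteq> insert v V \<and> Z \<subseteq> Y} - {Y. Y \<subseteq> V \<and> Z \<subseteq> Y}. ?d Y = 0"
          using dv by blast
      qed (use insert.hyps in auto)
      also have "\<dots> = 0"
        using insert.prems(2)[of Z] Z pairspan_superset_sum_zero[OF F(1) fV fZ] by (auto simp: superset_sum_diff)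
      finally show "superset_sum V ?d Z = 0" .
    qed
    then have "?d \<in> pairspan (insert v V) j" by (rule pairspan_mono) auto
    from pairspan_add[OF F(1) this] show ?thesis by simp
  qed
qed

lemma pairspan_lift:
  fixes h :: "'v set \<Rightarrow> 'r::comm_ring_1"
  assumes "h \<in> pairspan V j" "finite V" "j \<le> l" "l + j \<le> card V"
  shows "\<exists>f \<in> homog V l. \<forall>Z. Z \<subseteq> V \<longrightarrow> card Z \<le> j \<longrightarrow> superset_sum V f Z = superset_sum V h Z"
  using assms(1)
proof induction
  case zero
  show ?case by (rule bexI[of _ "\<lambda>X. 0"]) (auto simp: homog_def)
next
  case (gen h ps c)
  then obtain f where f: "f \<in> homog V l" "\<And>Z. Z \<subseteq> V \<Longrightarrow> card Z \<le> j \<Longrightarrow> superset_sum V f Z = superset_sum V h Z"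
    by blast
  have "l - j \<le> card (V - set (entries ps))"
    using gen assms by (simp add: card_Diff_subset distinct_card length_entries)
  then obtain C where C: "C \<subseteq> V - set (entries ps)" "card C = l - j" "finite C"
    using obtain_subset_with_card_n by metis
  let ?f = "\<lambda>X. f X + c * pairprod ps C X"
  have "(pairprod ps C :: _ \<Rightarrow> 'r) \<in> homog V (card C + length ps)"
    using gen C by (intro pairprod_homog) auto
  then have "?f \<in> homog V l"
    using C gen assms f by (intro homog_add homog_scale) auto
  moreover have "superset_sum V ?f Z = superset_sum V (\<lambda>X. h X + c * pairprod ps {} X) Z" if "Z \<subseteq> V" "card Z \<le> j" for Z
  proof -
    have "superset_sum V (pairprod ps C) Z = superset_sum V (pairprod ps {} :: _ \<Rightarrow> 'r) Z"
      using gen C assms that by (intro superset_sum_pairprod_extend) auto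
    then show ?thesis using f(2)[OF that] by (simp add: superset_sum_add superset_sum_scale)
  qed
  ultimately show ?case by (intro bexI[of _ ?f]) simp_all
qed

text \<open>
  Suppose that \<open>f\<close> has the right sums over the supersets of all sets with fewer than \<open>t\<close> points. The errors
  \<open>\<mu> t - superset_sum V f T\<close> at the \<open>t\<close>-sets \<open>T\<close> form an element of the kernel, precisely by the
  compatibility condition for \<open>t\<close> and the smaller sizes; lifting it to \<open>l\<close>-sets gives a correction of \<open>f\<close>
  that does not disturb the smaller sizes.
\<close>

theorem design_exists:
  fixes \<mu> :: "nat \<Rightarrow> 'r::comm_ring_1"
  assumes V: "finite V"
    and compat: "\<And>i j. i < j \<Longrightarrow> j < t \<Longrightarrow>
      of_nat ((card V - i) choose (j - i)) * \<mu> j = of_nat ((l - i) choose (j - i)) * \<mu> i"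
    and size: "\<And>j. j < t \<Longrightarrow> j \<le> l \<and> l + j \<le> card V"
  shows "\<exists>f \<in> homog V l. \<forall>Z. Z \<subseteq> V \<longrightarrow> card Z < t \<longrightarrow> superset_sum V f Z = \<mu> (card Z)"
  using compat size
proof (induction t)
  case 0
  show ?case by (rule bexI[of _ "\<lambda>X. 0"]) (auto simp: homog_def)
next
  case (Suc t)
  have "\<exists>f\<in>homog V l. \<forall>Z\<subseteq>V. card Z < t \<longrightarrow> superset_sum V f Z = \<mu> (card Z)"
    by (rule Suc.IH) (use Suc.prems in auto)
  then obtain f where f: "f \<in> homog V l" "\<And>Z. Z \<subseteq> V \<Longrightarrow> card Z < t \<Longrightarrow> superset_sum V f Z = \<mu> (card Z)"
    by blast
  define h where "h = (\<lambda>T. if T \<subseteq> V \<and> card T = t then \<mu> t - superset_sum V f T else 0)"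
  have hh: "h \<in> homog V t" by (simp add: h_def homog_def)
  have "h \<in> pairspan V t"
  proof (rule kernel_intersection[OF V hh])
    fix Z assume Z: "Z \<subseteq> V" "card Z < t"
    have "superset_sum V h Z = (\<Sum>T | T \<subseteq> V \<and> card T = t \<and> Z \<subseteq> T. h T)"
      by (rule superset_sum_homog[OF V hh])
    also have "\<dots> = (\<Sum>T | T \<subseteq> V \<and> card T = t \<and> Z \<subseteq> T. \<mu> t - superset_sum V f T)"
      by (rule sum.cong) (auto simp: h_def)
    also have "\<dots> = of_nat (card {T. T \<subseteq> V \<and> card T = t \<and> Z \<subseteq> T}) * \<mu> t
        - (\<Sum>T | T \<subseteq> V \<and> card T = t \<and> Z \<subseteq> T. superset_sum V f T)"
      by (simp add: sum_subtractf)
    also have "{T. T \<subseteq> V \<and> card T = t \<and> Z \<subseteq> T} = {T. Z \<subseteq> T \<and> T \<subseteq> V \<and> card T = t}" by auto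
    also have "card \<dots> = (card V - card Z) choose (t - card Z)"
      using V Z by (intro card_intermediate_sets) auto
    also have "of_nat \<dots> * \<mu> t = of_nat ((l - card Z) choose (t - card Z)) * \<mu> (card Z)"
      by (rule Suc.prems(1)) (use Z in auto)
    also have "(\<Sum>T | Z \<subseteq> T \<and> T \<subseteq> V \<and> card T = t. superset_sum V f T)
        = (\<Sum>T | T \<subseteq> V \<and> card T = t \<and> Z \<subseteq> T. superset_sum V f T)"
      by (rule arg_cong[where f = "sum _"]) auto
    also have "\<dots> = of_nat ((l - card Z) choose (t - card Z)) * superset_sum V f Z"
      by (rule sum_superset_sum[OF V f(1) Z(1)]) (use Z in auto)
    finally show "superset_sum V h Z = 0" using f(2)[OF Z] by simp
  qed
  have "t \<le> l" "l + t \<le> card V" using Suc.prems(2)[of t] by auto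
  from pairspan_lift[OF \<open>h \<in> pairspan V t\<close> V this]
  obtain g where g: "g \<in> homog V l" "\<And>Z. Z \<subseteq> V \<Longrightarrow> card Z \<le> t \<Longrightarrow> superset_sum V g Z = superset_sum V h Z"
    by blast
  have "superset_sum V (\<lambda>X. f X + g X) Z = \<mu> (card Z)" if Z: "Z \<subseteq> V" "card Z < Suc t" for Z
  proof (cases "card Z = t")
    case True
    then have "superset_sum V h Z = h Z" by (intro superset_sum_same_size[OF V hh]) (use Z in auto)
    then show ?thesis using g(2)[of Z] Z True by (simp add: superset_sum_add h_def)
  next
    case False
    then have "card Z < t" using Z by simp
    moreover have "finite Z" using Z V finite_subset by blast
    ultimately have "superset_sum V h Z = 0" using pairspan_superset_sum_zero[OF \<open>h \<in> pairspan V t\<close> V] by blast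
    then show ?thesis using g(2)[of Z] Z f(2)[of Z] \<open>card Z < t\<close> by (simp add: superset_sum_add)
  qed
  then show ?case by (intro bexI[OF _ homog_add[OF f(1) g(1)]]) simp
qed

section \<open>Polytabloids as products of differences\<close>

lemma set_entries: "set (entries ps) = fst ` set ps \<union> snd ` set ps"
  by (induction ps rule: entries.induct) auto

definition pair_stab :: "('v \<times> 'v) list \<Rightarrow> ('v \<Rightarrow> 'v) set" where
  "pair_stab ps = {\<pi>. \<pi> permutes set (entries ps) \<and> (\<forall>(x, y)\<in>set ps. \<pi> ` {x, y} = {x, y})}"

lemma pair_stab_fixes:
  assumes "\<pi> \<in> pair_stab ps" "z \<notin> set (entries ps)"
  shows "\<pi> z = z"
  using assms by (auto simp: pair_stab_def permutes_not_in)

lemma transpose_fixes_pairs: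
  assumes "distinct (entries ((x, y) # ps))" "(u, w) \<in> set ps"
  shows "transpose x y ` {u, w} = {u, w}"
proof -
  have "u \<in> set (entries ps)" "w \<in> set (entries ps)" using assms(2) by (force simp: set_entries)+
  then have "u \<noteq> x" "u \<noteq> y" "w \<noteq> x" "w \<noteq> y" using assms(1) by auto
  then show ?thesis by simp
qed

text \<open>
  A permutation that preserves all pairs either fixes \<open>x\<close> and \<open>y\<close> or does so after exchanging them; the two
  cases become the two terms of \<open>X\<^sub>x - X\<^sub>y\<close>.
\<close>

lemma pair_stab_Cons:
  assumes d: "distinct (entries ((x, y) # ps))"
  shows "pair_stab ((x, y) # ps) = pair_stab ps \<union> (\<lambda>\<pi>. transpose x y \<circ> \<pi>) ` pair_stab ps"
proof (intro equalityI subsetI)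
  have fixing: "\<pi> \<in> pair_stab ps" if \<pi>: "\<pi> \<in> pair_stab ((x, y) # ps)" and fx: "\<pi> x = x" for \<pi>
  proof -
    have p: "\<pi> permutes set (entries ((x, y) # ps))" and xy: "\<pi> ` {x, y} = {x, y}"
      and r: "\<forall>(u, w)\<in>set ps. \<pi> ` {u, w} = {u, w}"
      using \<pi> by (auto simp: pair_stab_def)
    have "inj \<pi>" using p by (rule permutes_inj)
    then have "\<pi> y \<noteq> x" using fx d by (auto dest: injD)
    moreover have "\<pi> y \<in> {x, y}" using xy by blast
    ultimately have fy: "\<pi> y = y" by simp
    have "\<pi> permutes set (entries ps)"
      by (rule permutes_superset[OF p]) (use fx fy in auto)
    then show ?thesis using r by (simp add: pair_stab_def)
  qed
  fix \<pi> assume \<pi>: "\<pi> \<in> pair_stab ((x, y) # ps)"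
  then have p: "\<pi> permutes set (entries ((x, y) # ps))" and xy: "\<pi> ` {x, y} = {x, y}"
    and r: "\<And>u w. (u, w) \<in> set ps \<Longrightarrow> \<pi> ` {u, w} = {u, w}"
    unfolding pair_stab_def by (simp_all del: image_insert entries.simps, blast)
  show "\<pi> \<in> pair_stab ps \<union> (\<lambda>\<pi>. transpose x y \<circ> \<pi>) ` pair_stab ps"
  proof (cases "\<pi> x = x")
    case True
    then show ?thesis using fixing \<pi> by blast
  next
    case False
    then have px: "\<pi> x = y" using xy by auto
    let ?\<rho> = "transpose x y \<circ> \<pi>"
    have "?\<rho> permutes set (entries ((x, y) # ps))"
      by (rule permutes_compose[OF p permutes_swap_id]) auto
    moreover have "?\<rho> ` {x, y} = {x, y}"
    proof -
      have "?\<rho> ` {x, y} = transpose x y ` {x, y}" by (simp only: image_comp[symmetric] xy)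
      then show ?thesis by auto
    qed
    moreover have "?\<rho> ` {u, w} = {u, w}" if "(u, w) \<in> set ps" for u w
      by (simp only: image_comp[symmetric] r[OF that] transpose_fixes_pairs[OF d that])
    ultimately have "?\<rho> \<in> pair_stab ((x, y) # ps)" unfolding pair_stab_def by (simp del: image_insert comp_apply entries.simps) blast
    then have "?\<rho> \<in> pair_stab ps" using px by (intro fixing) auto
    moreover have "\<pi> = transpose x y \<circ> ?\<rho>" by (simp add: fun_eq_iff)
    ultimately show ?thesis by blast
  qed
next
  fix \<pi> assume "\<pi> \<in> pair_stab ps \<union> (\<lambda>\<pi>. transpose x y \<circ> \<pi>) ` pair_stab ps"
  then obtain \<rho> where \<rho>: "\<rho> \<in> pair_stab ps" "\<pi> = \<rho> \<or> \<pi> = transpose x y \<circ> \<rho>" by blast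
  have f: "\<rho> x = x" "\<rho> y = y" using \<rho> d by (auto intro!: pair_stab_fixes)
  have p: "\<rho> permutes set (entries ((x, y) # ps))"
    using \<rho>(1) by (auto simp: pair_stab_def intro: permutes_subset)
  have p2: "transpose x y \<circ> \<rho> permutes set (entries ((x, y) # ps))"
    by (rule permutes_compose[OF p permutes_swap_id]) auto
  have r: "\<rho> ` {u, w} = {u, w}" if "(u, w) \<in> set ps" for u w
    using \<rho>(1) that unfolding pair_stab_def by blast
  have r2: "(transpose x y \<circ> \<rho>) ` {u, w} = {u, w}" if "(u, w) \<in> set ps" for u w
    by (simp only: image_comp[symmetric] r[OF that] transpose_fixes_pairs[OF d that])
  have "\<pi> ` {x, y} = {x, y}" using \<rho>(2) f by auto
  moreover have "\<pi> ` {u, w} = {u, w}" if "(u, w) \<in> set ps" for u w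
    using \<rho>(2) r[OF that] r2[OF that] by blast
  moreover have "\<pi> permutes set (entries ((x, y) # ps))" using \<rho>(2) p p2 by blast
  ultimately show "\<pi> \<in> pair_stab ((x, y) # ps)"
    unfolding pair_stab_def by (simp del: image_insert comp_apply entries.simps) blast
qed

lemma finite_pair_stab: "finite (pair_stab ps)"
  by (rule finite_subset[OF _ finite_permutations[of "set (entries ps)"]]) (auto simp: pair_stab_def)

lemma sum_pair_stab:
  fixes X :: "'v set"
  assumes "distinct (entries ps)" "set (entries ps) \<inter> C = {}"
  shows "(\<Sum>\<pi>\<in>pair_stab ps. of_int (sign \<pi>) * (if X = \<pi> ` (fst ` set ps \<union> C) then 1 else 0))
         = (pairprod ps C X :: 'r::comm_ring_1)"
  using assms
proof (induction ps arbitrary: C rule: entries.induct)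
  case 1
  have "pair_stab [] = {id :: 'v \<Rightarrow> 'v}" by (auto simp: pair_stab_def)
  then show ?case by simp
next
  case (2 x y ps)
  let ?\<tau> = "transpose x y"
  let ?R = "fst ` set ps"
  have d: "distinct (entries ((x, y) # ps))" by fact
  have fx: "\<pi> x = x" "\<pi> y = y" if "\<pi> \<in> pair_stab ps" for \<pi>
    using that "2.prems" by (auto intro!: pair_stab_fixes)
  have inj: "inj_on (\<lambda>\<pi>. ?\<tau> \<circ> \<pi>) (pair_stab ps)"
    by (rule inj_onI) (metis comp_assoc id_comp transpose_comp_involutory)
  have disj: "pair_stab ps \<inter> (\<lambda>\<pi>. ?\<tau> \<circ> \<pi>) ` pair_stab ps = {}"
  proof -
    have "\<pi> \<noteq> ?\<tau> \<circ> \<rho>" if "\<pi> \<in> pair_stab ps" "\<rho> \<in> pair_stab ps" for \<pi> \<rho>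
      using fx[OF that(1)] fx[OF that(2)] d by (auto simp: fun_eq_iff intro!: exI[of _ x])
    then show ?thesis by blast
  qed
  have set1: "fst ` set ((x, y) # ps) \<union> C = ?R \<union> insert x C" by auto
  have swap: "(?\<tau> \<circ> \<pi>) ` (?R \<union> insert x C) = \<pi> ` (?R \<union> insert y C)" if \<pi>: "\<pi> \<in> pair_stab ps" for \<pi>
  proof -
    have p: "\<pi> permutes set (entries ps)" using \<pi> by (simp add: pair_stab_def)
    have C: "x \<notin> C" "y \<notin> C" "x \<notin> ?R" "y \<notin> ?R" "x \<noteq> y" using "2.prems" by (auto simp: set_entries)
    have nn: "\<pi> z \<noteq> x" "\<pi> z \<noteq> y" if "z \<in> ?R \<union> C" for z
      using fx[OF \<pi>] permutes_inj[OF p] C that by (metis UnE injD)+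
    then have "(?\<tau> \<circ> \<pi>) ` (?R \<union> C) = \<pi> ` (?R \<union> C)"
      by (intro image_cong) (auto simp: transpose_def)
    moreover have "(?\<tau> \<circ> \<pi>) x = y" "\<pi> y = y" using fx[OF \<pi>] by auto
    ultimately show ?thesis by (simp only: Un_insert_right image_insert)
  qed
  have sgn: "sign (?\<tau> \<circ> \<pi>) = - sign \<pi>" if \<pi>: "\<pi> \<in> pair_stab ps" for \<pi>
  proof -
    have "\<pi> permutes set (entries ps)" using \<pi> by (simp add: pair_stab_def)
    then have "permutation \<pi>" using permutation_permutes by blast
    then have "sign (?\<tau> \<circ> \<pi>) = sign ?\<tau> * sign \<pi>"
      by (intro sign_compose) (auto simp: permutation_swap_id)
    then show ?thesis using d by (simp add: sign_swap_id)
  qed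
  let ?f = "\<lambda>\<pi>. of_int (sign \<pi>) * (if X = \<pi> ` (?R \<union> insert x C) then 1 else 0) :: 'r"
  have "(\<Sum>\<pi>\<in>pair_stab ((x, y) # ps). ?f \<pi>) = (\<Sum>\<pi>\<in>pair_stab ps. ?f \<pi>) + (\<Sum>\<pi>\<in>pair_stab ps. ?f (?\<tau> \<circ> \<pi>))"
    unfolding pair_stab_Cons[OF d]
    by (subst sum.union_disjoint) (auto simp: finite_pair_stab disj sum.reindex[OF inj] simp del: image_insert)
  also have "(\<Sum>\<pi>\<in>pair_stab ps. ?f (?\<tau> \<circ> \<pi>))
      = - (\<Sum>\<pi>\<in>pair_stab ps. of_int (sign \<pi>) * (if X = \<pi> ` (?R \<union> insert y C) then 1 else 0))"
    unfolding sum_negf[symmetric]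
    by (rule sum.cong[OF refl]) (simp only: swap sgn, simp)
  also have "(\<Sum>\<pi>\<in>pair_stab ps. ?f \<pi>) = pairprod ps (insert x C) X"
    using "2.prems" by (intro "2.IH") auto
  also have "(\<Sum>\<pi>\<in>pair_stab ps. of_int (sign \<pi>) * (if X = \<pi> ` (?R \<union> insert y C) then 1 else 0))
      = (pairprod ps (insert y C) X :: 'r)"
    using "2.prems" by (intro "2.IH") auto
  finally show ?case unfolding set1 by simp
qed

text \<open>
  Each pair has the entry of the second row first, as a tabloid is identified with its second row.
\<close>

definition column_pairs :: "nat \<Rightarrow> (nat \<times> nat \<Rightarrow> nat) \<Rightarrow> (nat \<times> nat) list" where
  "column_pairs b t = map (\<lambda>j. (t (2, j), t (1, j))) [1..<Suc b]"

lemma set_entries_column_pairs: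
  "set (entries (column_pairs b t)) = t ` ({1, 2} \<times> {1..b})"
proof -
  have "set (column_pairs b t) = (\<lambda>j. (t (2, j), t (1, j))) ` {1..b}"
    unfolding column_pairs_def set_map by (simp only: set_upt atLeastLessThanSuc_atLeastAtMost)
  then show ?thesis unfolding set_entries by (simp only: image_image fst_conv snd_conv) auto
qed

lemma distinct_entries_column_pairs:
  assumes "tableau a b t" "b \<le> a"
  shows "distinct (entries (column_pairs b t))"
proof -
  have inj: "inj_on t (diagram a b)" using assms by (auto simp: tableau_def bij_betw_def)
  have "{1, 2} \<times> {1..b} \<subseteq> diagram a b" using assms by (auto simp: diagram_def)
  then have "inj_on t ({1, 2} \<times> {1..b})" using inj inj_on_subset by blast
  then have "card (set (entries (column_pairs b t))) = 2 * b"
    unfolding set_entries_column_pairs by (subst card_image) (auto simp: card_cartesian_product)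
  then show ?thesis
    by (intro card_distinct) (simp add: length_entries column_pairs_def)
qed

lemma column_stabilizer_eq:
  assumes t: "tableau a b t" and ab: "b \<le> a"
  shows "column_stabilizer a b t = pair_stab (column_pairs b t)"
proof -
  have bij: "t ` diagram a b = {1..a+b}" and inj: "inj_on t (diagram a b)"
    using t by (auto simp: tableau_def bij_betw_def)
  have c1: "column a b t j = {t (2, j), t (1, j)}" if "j \<in> {1..b}" for j
  proof -
    have "{c \<in> diagram a b. snd c = j} = {(2, j), (1, j)}" using that ab by (auto simp: diagram_def)
    then show ?thesis by (simp add: column_def)
  qed
  have c2: "column a b t j = {t (1, j)}" if "j \<in> {b<..a}" for j
  proof -
    have "{c \<in> diagram a b. snd c = j} = {(1, j)}" using that ab by (auto simp: diagram_def)
    then show ?thesis by (simp add: column_def)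
  qed
  have c3: "column a b t j = {}" if "j \<notin> {1..b}" "j \<notin> {b<..a}" for j
    using that by (auto simp: diagram_def column_def)
  have pairs: "set (column_pairs b t) = (\<lambda>j. (t (2, j), t (1, j))) ` {1..b}"
    unfolding column_pairs_def set_map by (simp only: set_upt atLeastLessThanSuc_atLeastAtMost)
  have sub: "{1, 2} \<times> {1..b} \<subseteq> diagram a b" using ab by (auto simp: diagram_def)
  have esub: "set (entries (column_pairs b t)) \<subseteq> {1..a+b}"
    unfolding set_entries_column_pairs bij[symmetric] using sub by (rule image_mono)
  show ?thesis
  proof (intro equalityI subsetI)
    fix \<pi> assume "\<pi> \<in> column_stabilizer a b t"
    then have p: "\<pi> permutes {1..a+b}" and col: "\<And>j. \<pi> ` column a b t j = column a b t j"
      by (auto simp: column_stabilizer_def)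
    have "\<pi> permutes set (entries (column_pairs b t))"
    proof (rule permutes_superset[OF p])
      fix z assume z: "z \<in> {1..a+b} - set (entries (column_pairs b t))"
      then obtain i j where ij: "(i, j) \<in> diagram a b" "z = t (i, j)" using bij by (metis DiffD1 imageE surj_pair)
      then have "(i, j) \<notin> {1, 2} \<times> {1..b}" using z unfolding set_entries_column_pairs by blast
      then have "i = 1" "j \<in> {b<..a}" using ij(1) by (auto simp: diagram_def)
      then show "\<pi> z = z" using col[of j] c2[of j] ij by auto
    qed
    moreover have "\<pi> ` {t (2, j), t (1, j)} = {t (2, j), t (1, j)}" if "j \<in> {1..b}" for j
      using col[of j] unfolding c1[OF that] .
    ultimately show "\<pi> \<in> pair_stab (column_pairs b t)"
      by (auto simp: pair_stab_def pairs simp del: image_insert)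
  next
    fix \<pi> assume \<pi>: "\<pi> \<in> pair_stab (column_pairs b t)"
    then have "\<pi> permutes {1..a+b}" using esub by (auto simp: pair_stab_def intro: permutes_subset)
    moreover have "\<pi> ` column a b t j = column a b t j" for j
    proof -
      consider "j \<in> {1..b}" | "j \<in> {b<..a}" | "j \<notin> {1..b}" "j \<notin> {b<..a}" by blast
      then show ?thesis
      proof cases
        case 1
        then show ?thesis unfolding c1[OF 1] using \<pi> unfolding pair_stab_def pairs by blast
      next
        case 2
        have "t (1, j) \<notin> set (entries (column_pairs b t))"
        proof
          assume "t (1, j) \<in> set (entries (column_pairs b t))"
          then obtain i' j' where ij: "t (1, j) = t (i', j')" "i' \<in> {1, 2}" "j' \<in> {1..b}"
            unfolding set_entries_column_pairs by auto
          moreover have "(i', j') \<in> diagram a b" using ij sub by blast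
          moreover have "(1, j) \<in> diagram a b" using 2 by (auto simp: diagram_def)
          ultimately have "(1, j) = (i', j')" using inj by (metis inj_onD)
          then show False using ij 2 by auto
        qed
        then show ?thesis unfolding c2[OF 2] using pair_stab_fixes[OF \<pi>] by simp
      next
        case 3
        then show ?thesis by (simp add: c3)
      qed
    qed
    ultimately show "\<pi> \<in> column_stabilizer a b t" by (simp add: column_stabilizer_def)
  qed
qed

lemma sum_apply: "(\<Sum>i\<in>A. F i) X = (\<Sum>i\<in>A. F i X)"
  by (induction A rule: infinite_finite_induct) auto

lemma polytabloid_eq_pairprod:
  fixes a b :: nat
  assumes t: "tableau a b t" and ab: "b \<le> a"
  shows "polytabloid a b t = (pairprod (column_pairs b t) {} :: _ \<Rightarrow> 'k::field)"
proof
  fix X :: "nat set"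
  have row: "second_row b t = fst ` set (column_pairs b t)"
    unfolding second_row_def column_pairs_def set_map set_upt atLeastLessThanSuc_atLeastAtMost
      image_image fst_conv by auto
  have "polytabloid a b t X = (\<Sum>\<pi>\<in>pair_stab (column_pairs b t).
      of_int (sign \<pi>) * (if X = \<pi> ` (fst ` set (column_pairs b t) \<union> {}) then 1 else 0) :: 'k)"
    unfolding polytabloid_def sum_apply column_stabilizer_eq[OF t ab]
  proof (rule sum.cong[OF refl])
    fix \<pi> assume "\<pi> \<in> pair_stab (column_pairs b t)"
    then have "\<pi> permutes set (entries (column_pairs b t))" by (simp add: pair_stab_def)
    then have "act \<pi> (single (second_row b t)) = (single (\<pi> ` second_row b t) :: _ \<Rightarrow> 'k)" by (rule act_single)
    then show "fscale (of_int (sign \<pi>)) (act \<pi> (single (second_row b t))) X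
        = (of_int (sign \<pi>) * (if X = \<pi> ` (fst ` set (column_pairs b t) \<union> {}) then 1 else 0) :: 'k)"
      by (simp add: row fscale_def single_def)
  qed
  also have "\<dots> = pairprod (column_pairs b t) {} X"
    by (rule sum_pair_stab[OF distinct_entries_column_pairs[OF t ab]]) simp
  finally show "polytabloid a b t X = (pairprod (column_pairs b t) {} X :: 'k)" .
qed

text \<open>
  The points outside the given pairs fill the remainder of the first row.
\<close>

lemma pairs_from_tableau:
  assumes d: "distinct (entries ps)" and sub: "set (entries ps) \<subseteq> {1..a+b}" and len: "length ps = b" and ab: "b \<le> a"
  shows "\<exists>t. tableau a b t \<and> column_pairs b t = ps"
proof -
  define rest where "rest = sorted_list_of_set ({1..a+b} - set (entries ps))"
  have srest: "set rest = {1..a+b} - set (entries ps)" by (simp add: rest_def)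
  have lrest: "length rest = a - b"
    using d sub len by (simp add: rest_def card_Diff_subset distinct_card length_entries)
  define t where "t = (\<lambda>(i, j). if i = (2::nat) then fst (ps ! (j - 1)) else if j \<le> b then snd (ps ! (j - 1)) else rest ! (j - b - 1))"
  have cp: "column_pairs b t = ps"
    by (rule nth_equalityI) (auto simp: column_pairs_def len t_def simp del: upt_Suc)
  have "{1..a+b} \<subseteq> t ` diagram a b"
  proof
    fix z assume z: "z \<in> {1..a+b}"
    show "z \<in> t ` diagram a b"
    proof (cases "z \<in> set (entries ps)")
      case True
      then have "z \<in> t ` ({1, 2} \<times> {1..b})" using set_entries_column_pairs[of b t] cp by simp
      then show ?thesis using ab by (auto simp: diagram_def)
    next
      case False
      then obtain k where k: "k < a - b" "rest ! k = z" using z srest lrest by (metis DiffI in_set_conv_nth)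
      then have "t (1, Suc k + b) = z" by (simp add: t_def)
      moreover have "(1, Suc k + b) \<in> diagram a b" using k by (auto simp: diagram_def)
      ultimately show ?thesis by blast
    qed
  qed
  moreover have cd: "card (diagram a b) = a + b" and fd: "finite (diagram a b)"
    unfolding diagram_def by (subst card_Un_disjoint) auto
  ultimately have img: "t ` diagram a b = {1..a+b}"
    by (metis card_atLeastAtMost card_image_le card_seteq diff_Suc_1 finite_imageI)
  then have "inj_on t (diagram a b)" by (intro eq_card_imp_inj_on) (simp_all add: fd cd)
  then show ?thesis using img cp by (auto simp: tableau_def bij_betw_def)
qed

lemma pairspan_subset_specht:
  fixes f :: "nat set \<Rightarrow> 'k::field"
  assumes "f \<in> pairspan {1..a+b} b" "b \<le> a"
  shows "f \<in> specht a b"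
  using assms(1)
proof induction
  case zero
  have "(\<lambda>X. 0) = (0 :: nat set \<Rightarrow> 'k)" by (simp add: fun_eq_iff)
  then show ?case by (simp only: specht_def fs.span_zero)
next
  case (gen f ps c)
  then obtain t where t: "tableau a b t" "column_pairs b t = ps"
    using pairs_from_tableau[of ps a b] assms(2) by blast
  have "polytabloid a b t \<in> (specht a b :: (nat set \<Rightarrow> 'k) set)"
    unfolding specht_def by (rule fs.span_base) (use t in blast)
  then have "pairprod ps {} \<in> (specht a b :: (nat set \<Rightarrow> 'k) set)"
    by (simp only: polytabloid_eq_pairprod[OF t(1) assms(2)] t(2))
  then have "f + fscale c (pairprod ps {}) \<in> specht a b"
    using gen unfolding specht_def by (intro fs.span_add fs.span_scale)
  then show ?case by (simp add: plus_fun_def fscale_def)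
qed

theorem specht_iff_kernel:
  fixes f :: "nat set \<Rightarrow> 'k::field"
  assumes ab: "b \<le> a"
  shows "f \<in> specht a b \<longleftrightarrow>
    f \<in> homog {1..a+b} b \<and> (\<forall>Z. Z \<subseteq> {1..a+b} \<longrightarrow> card Z < b \<longrightarrow> superset_sum {1..a+b} f Z = 0)"
proof -
  let ?V = "{1..a+b}"
  let ?K = "{f :: nat set \<Rightarrow> 'k. f \<in> homog ?V b \<and> (\<forall>Z. Z \<subseteq> ?V \<longrightarrow> card Z < b \<longrightarrow> superset_sum ?V f Z = 0)}"
  have "specht a b \<subseteq> ?K"
    unfolding specht_def
  proof (rule fs.span_minimal)
    show "fs.subspace ?K"
    proof (rule fs.subspaceI)
      show "0 \<in> ?K" by (simp add: homog_def superset_sum_def)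
      show "f + g \<in> ?K" if "f \<in> ?K" "g \<in> ?K" for f g
        using that by (simp add: plus_fun_def homog_add superset_sum_add)
      show "fscale c f \<in> ?K" if "f \<in> ?K" for c f
        using that by (simp add: fscale_def homog_scale superset_sum_scale)
    qed
    show "{polytabloid a b t | t. tableau a b t} \<subseteq> ?K"
    proof
      fix e :: "nat set \<Rightarrow> 'k" assume "e \<in> {polytabloid a b t | t. tableau a b t}"
      then obtain t where t: "tableau a b t" and e: "e = polytabloid a b t" by blast
      let ?ps = "column_pairs b t"
      have d: "distinct (entries ?ps)" by (rule distinct_entries_column_pairs[OF t ab])
      have l: "length ?ps = b" by (simp add: column_pairs_def)
      have "{1, 2} \<times> {1..b} \<subseteq> diagram a b" using ab by (auto simp: diagram_def)
      moreover have "t ` diagram a b = ?V" using t by (simp add: tableau_def bij_betw_def)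
      ultimately have sub: "set (entries ?ps) \<subseteq> ?V"
        unfolding set_entries_column_pairs by blast
      have "pairprod ?ps {} \<in> homog ?V (card ({} :: nat set) + length ?ps)"
        by (rule pairprod_homog) (use d sub in auto)
      moreover have "superset_sum ?V (pairprod ?ps {}) Z = (0 :: 'k)" if "Z \<subseteq> ?V" "card Z < b" for Z
        using that l d sub finite_subset[OF that(1)] by (intro superset_sum_pairprod_zero) auto
      ultimately show "e \<in> ?K" unfolding e polytabloid_eq_pairprod[OF t ab] by (simp add: l)
    qed
  qed
  moreover have "f \<in> specht a b" if "f \<in> ?K"
    using that ab by (intro pairspan_subset_specht kernel_intersection) auto
  ultimately show ?thesis by blast
qed

section \<open>Binomial coefficients modulo a prime\<close>

lemma binomial_prime_power_eq_0:
  assumes p: "prime p" "CHAR('r::comm_ring_1) = p" and k: "0 < k" "k < p ^ i"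
  shows "of_nat (p ^ i choose k) = (0 :: 'r)"
proof -
  have "p dvd (p ^ i choose k)"
  proof (rule ccontr)
    assume "\<not> p dvd (p ^ i choose k)"
    then have "coprime (p ^ i) (p ^ i choose k)"
      using p(1) by (simp add: prime_imp_coprime coprime_power_left_iff)
    moreover have "p ^ i dvd k * (p ^ i choose k)"
      using times_binomial_minus1_eq[OF k(1), of "p ^ i"] by simp
    ultimately have "p ^ i dvd k" by (simp add: coprime_dvd_mult_left_iff)
    then show False using k by (simp add: nat_dvd_not_less)
  qed
  then show ?thesis using p(2) by (simp add: of_nat_eq_0_iff_char_dvd)
qed

text \<open>
  By Vandermonde's identity, as \<open>p ^ i choose k\<close> vanishes for \<open>0 < k < p ^ i\<close>. This and the next
  lemmas are special cases of the theorem of Lucas.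
\<close>

lemma binomial_shift_power:
  assumes p: "prime p" "CHAR('r::comm_ring_1) = p" and K: "K < p ^ i"
  shows "of_nat ((p ^ i + N) choose K) = (of_nat (N choose K) :: 'r)"
proof -
  have "of_nat ((p ^ i + N) choose K) = (\<Sum>k\<le>K. of_nat (p ^ i choose k) * of_nat (N choose (K - k)) :: 'r)"
    unfolding vandermonde[symmetric] by simp
  also have "\<dots> = (\<Sum>k\<in>{0}. of_nat (p ^ i choose k) * of_nat (N choose (K - k)))"
    by (rule sum.mono_neutral_right) (use binomial_prime_power_eq_0[OF p] K in auto)
  finally show ?thesis by simp
qed

lemma binomial_shift:
  assumes p: "prime p" "CHAR('r::comm_ring_1) = p" and K: "K < p ^ i" and D: "p ^ i dvd D"
  shows "of_nat ((D + N) choose K) = (of_nat (N choose K) :: 'r)"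
proof -
  obtain m where m: "D = p ^ i * m" using D by blast
  have "of_nat ((p ^ i * m + N) choose K) = (of_nat (N choose K) :: 'r)"
  proof (induction m)
    case (Suc m)
    then show ?case using binomial_shift_power[OF p K, of "p ^ i * m + N"] by (simp add: add.assoc)
  qed simp
  then show ?thesis by (simp add: m)
qed

lemma binomial_power_eq_div:
  assumes p: "prime p" "CHAR('r::comm_ring_1) = p"
  shows "of_nat (N choose p ^ i) = (of_nat (N div p ^ i) :: 'r)"
proof (induction N rule: less_induct)
  case (less N)
  have q: "p ^ i > 0" using p(1) prime_gt_0_nat by simp
  show ?case
  proof (cases "N < p ^ i")
    case False
    define M where "M = N - p ^ i"
    have N: "N = p ^ i + M" using False by (simp add: M_def)
    have "of_nat (N choose p ^ i) = (\<Sum>k\<le>p ^ i. of_nat (p ^ i choose k) * of_nat (M choose (p ^ i - k)) :: 'r)"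
      unfolding N vandermonde[symmetric] by simp
    also have "\<dots> = (\<Sum>k\<in>{0, p ^ i}. of_nat (p ^ i choose k) * of_nat (M choose (p ^ i - k)))"
      by (rule sum.mono_neutral_right) (use binomial_prime_power_eq_0[OF p] in \<open>auto simp: le_less\<close>)
    also have "\<dots> = of_nat (M choose p ^ i) + 1" using q by simp
    also have "of_nat (M choose p ^ i) = (of_nat (M div p ^ i) :: 'r)"
      by (rule less) (use N q in linarith)
    finally show ?thesis unfolding N using q by (simp add: div_add_self1 add.commute)
  qed (simp add: binomial_eq_0)
qed

lemma binomial_power_minus_1:
  assumes p: "prime p" "CHAR('r::comm_ring_1) = p" and k: "k < p ^ i"
  shows "of_nat ((p ^ i - 1) choose k) = ((-1) ^ k :: 'r)"
  using k
proof (induction k)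
  case (Suc k)
  have "p ^ i = Suc (p ^ i - 1)" using Suc.prems by simp
  then have "p ^ i choose Suc k = ((p ^ i - 1) choose k) + ((p ^ i - 1) choose Suc k)"
    by (metis binomial_Suc_Suc)
  then have "of_nat ((p ^ i - 1) choose k) + of_nat ((p ^ i - 1) choose Suc k) = (0 :: 'r)"
    using binomial_prime_power_eq_0[OF p, of "Suc k" i] Suc.prems by (metis of_nat_add zero_less_Suc)
  then show ?case using Suc by (simp add: add_eq_0_iff)
qed simp

lemma pval_eq_multiplicity:
  assumes p: "prime p" and x: "x > 0"
  shows "pval p x = multiplicity p x"
  unfolding pval_def
proof (rule Least_equality)
  let ?m = "multiplicity p x"
  have "\<not> p dvd x div p ^ ?m"
    by (rule multiplicity_decompose) (use p x in \<open>auto simp: prime_gt_1_nat\<close>)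
  then show "pdigit p x ?m \<noteq> 0" by (simp add: pdigit_def dvd_eq_mod_eq_0)
  fix i assume i: "pdigit p x i \<noteq> 0"
  show "?m \<le> i"
  proof (rule ccontr)
    assume "\<not> ?m \<le> i"
    then have "p ^ Suc i dvd x" by (intro multiplicity_dvd') simp
    then obtain y where "x = p ^ Suc i * y" by blast
    then have "x = p ^ i * (p * y)" by simp
    then show False using i p by (simp add: pdigit_def prime_gt_0_nat)
  qed
qed

lemma plen_bounds:
  assumes p: "p \<ge> 2" and x: "x > 0"
  shows "p ^ plen p x \<le> x" "x < p ^ Suc (plen p x)"
proof -
  obtain l where l: "p ^ l \<le> x" "x < p ^ (l + 1)"
    using ex_power_ivl1[of p x] p x by auto
  have "plen p x = l"
    unfolding plen_def
  proof (rule Greatest_equality)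
    have "x div p ^ l \<noteq> 0" using l p by (simp add: div_eq_0_iff)
    moreover have "x div p ^ l < p" using l p by (simp add: less_mult_imp_div_less)
    ultimately show "pdigit p x l \<noteq> 0" by (simp add: pdigit_def)
    fix i assume i: "pdigit p x i \<noteq> 0"
    then have "p ^ i \<le> x" by (metis div_less mod_0 not_le pdigit_def)
    then have "p ^ i < p ^ (l + 1)" using l by simp
    then have "i < l + 1" by (rule power_less_imp_less_exp[rotated]) (use p in simp)
    then show "i \<le> l" by simp
  qed
  then show "p ^ plen p x \<le> x" "x < p ^ Suc (plen p x)" using l by simp_all
qed

section \<open>The functions that satisfy the counting conditions\<close>

text \<open>
  The index is the codimension \<open>s = b - card Z\<close>, because in it the equations do not involve \<open>b\<close>, except for
  its range. They also make sense for \<open>t = 0\<close>, where they read \<open>g s = C(a + s, s) g 0\<close>; the question is thus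
  which \<open>g\<close> do not extend to \<open>0\<close>.
\<close>

definition admissible :: "nat \<Rightarrow> nat \<Rightarrow> (nat \<Rightarrow> 'r::comm_ring_1) \<Rightarrow> bool" where
  "admissible a b g \<longleftrightarrow> (\<forall>s t. 1 \<le> t \<and> t < s \<and> s \<le> b \<longrightarrow>
     of_nat (s choose t) * g s = of_nat ((a + s) choose (s - t)) * g t)"

lemma admissible_diff_scale:
  assumes "admissible a b g" "admissible a b h"
  shows "admissible a b (\<lambda>s. g s - c * h s)"
  using assms unfolding admissible_def right_diff_distrib
  by (metis (no_types, lifting) mult.left_commute)

text \<open>
  The counting function of the sum of all \<open>b\<close>-sets, see \<open>has_counts_all_sets\<close> below.
\<close>

abbreviation full_count :: "nat \<Rightarrow> nat \<Rightarrow> 'r::comm_ring_1" where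
  "full_count a s \<equiv> of_nat ((a + s) choose s)"

lemma binomial_admissible_identity:
  assumes "t \<le> s"
  shows "(s choose t) * ((a + s) choose s) = ((a + s) choose (s - t)) * ((a + t) choose t)"
proof -
  have "((a + s) choose s) * (s choose (s - t)) = ((a + s) choose (s - t)) * ((a + s - (s - t)) choose (s - (s - t)))"
    by (rule choose_mult) auto
  then show ?thesis using assms binomial_symmetric[OF assms] by (simp add: mult.commute)
qed

lemma admissible_full_count: "admissible a b (full_count a)"
  unfolding admissible_def
  by (metis binomial_admissible_identity less_imp_le of_nat_mult)

context
  fixes p a b :: nat
  assumes p: "prime p" and char: "CHAR('k::field) = p"
begin

lemma full_count_power: "full_count a (p ^ i) = (of_nat (a div p ^ i + 1) :: 'k)"
proof -
  have "p ^ i > 0" using p prime_gt_0_nat by simp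
  then show ?thesis by (simp add: binomial_power_eq_div[OF p char] div_add_self2 add.commute)
qed

text \<open>
  If \<open>p ^ i\<close> is the exact power of \<open>p\<close> dividing \<open>s\<close>, then \<open>s choose p ^ i\<close> is invertible modulo \<open>p\<close>, so the
  equation for \<open>s\<close> and \<open>p ^ i\<close> expresses \<open>g s\<close> by \<open>g (p ^ i)\<close>.
\<close>

lemma admissible_eq_0:
  fixes g :: "nat \<Rightarrow> 'k"
  assumes g: "admissible a b g" and z: "\<And>i. p ^ i \<le> b \<Longrightarrow> g (p ^ i) = 0"
    and s: "1 \<le> s" "s \<le> b"
  shows "g s = 0"
proof -
  let ?i = "multiplicity p s"
  have dvd: "p ^ ?i dvd s" by (rule multiplicity_dvd)
  have le: "p ^ ?i \<le> s" using dvd s by (intro dvd_imp_le) auto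
  have pos: "1 \<le> p ^ ?i" using prime_gt_0_nat[OF p] by (simp add: Suc_le_eq)
  show ?thesis
  proof (cases "p ^ ?i = s")
    case True
    then show ?thesis using z[of ?i] s by simp
  next
    case False
    then have "of_nat (s choose p ^ ?i) * g s = of_nat ((a + s) choose (s - p ^ ?i)) * g (p ^ ?i)"
      using g le pos s unfolding admissible_def by auto
    also have "\<dots> = 0" using z[of ?i] le s by simp
    finally have "of_nat (s div p ^ ?i) * g s = 0" by (simp add: binomial_power_eq_div[OF p char])
    moreover have "\<not> p dvd s div p ^ ?i"
      by (rule multiplicity_decompose) (use p s in \<open>auto simp: prime_gt_1_nat\<close>)
    then have "of_nat (s div p ^ ?i) \<noteq> (0 :: 'k)" using char by (simp add: of_nat_eq_0_iff_char_dvd)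
    ultimately show ?thesis by simp
  qed
qed

text \<open>
  In the equation for \<open>s = p ^ (i + 1)\<close> and \<open>t = p ^ i\<close> the left coefficient is zero, and the right one is a
  sign, since \<open>a\<close> ends in at least \<open>i + 1\<close> digits \<open>p - 1\<close>.
\<close>

lemma admissible_low_power:
  fixes g :: "nat \<Rightarrow> 'k"
  assumes g: "admissible a b g" and dvd: "p ^ Suc i dvd a + 1" and le: "p ^ Suc i \<le> b"
  shows "g (p ^ i) = 0"
proof -
  let ?q = "p ^ Suc i"
  have p2: "p \<ge> 2" using p by (rule prime_ge_2_nat)
  have lt: "p ^ i < ?q" using p2 by simp
  have pos: "1 \<le> p ^ i" using p2 by simp
  have qle: "?q \<le> a + 1" using dvd by (intro dvd_imp_le) auto
  have "of_nat (?q choose p ^ i) * g ?q = of_nat ((a + ?q) choose (?q - p ^ i)) * g (p ^ i)"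
    using g lt pos le unfolding admissible_def by blast
  moreover have "of_nat (?q choose p ^ i) = (0 :: 'k)"
    by (rule binomial_prime_power_eq_0[OF p char]) (use lt pos in auto)
  moreover have "of_nat ((a + ?q) choose (?q - p ^ i)) = ((-1) ^ (?q - p ^ i) :: 'k)"
  proof -
    have "a + ?q = (a + 1) + (?q - 1)" using lt by simp
    then have "of_nat ((a + ?q) choose (?q - p ^ i)) = (of_nat ((?q - 1) choose (?q - p ^ i)) :: 'k)"
      by (metis binomial_shift[OF p char _ dvd] lt pos diff_less less_le_trans zero_less_one less_trans)
    then show ?thesis using binomial_power_minus_1[OF p char, of "?q - p ^ i" "Suc i"] lt pos by simp
  qed
  ultimately show ?thesis by simp
qed

text \<open>
  Compare the two equations for \<open>s = p ^ v + p ^ j\<close> with \<open>t = p ^ v\<close> and \<open>t = p ^ j\<close>: their left sides agree by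
  the symmetry of the binomial coefficients. The coefficients on the right are the digits of \<open>a + s\<close> at
  \<open>j\<close> and \<open>v\<close>; by the choice of \<open>v\<close> no carry reaches the digit at \<open>j\<close> when \<open>p ^ v\<close> is added to \<open>a\<close>.
\<close>

lemma admissible_high_power:
  fixes g :: "nat \<Rightarrow> 'k"
  assumes g: "admissible a b g" and v: "v = multiplicity p (a + 1)" and j: "v < j" and le: "p ^ v + p ^ j \<le> b"
  shows "full_count a (p ^ j) * g (p ^ v) = full_count a (p ^ v) * g (p ^ j)"
proof -
  have p2: "p \<ge> 2" using p by (rule prime_ge_2_nat)
  let ?s = "p ^ v + p ^ j"
  have pos: "1 \<le> p ^ v" "1 \<le> p ^ j" using p2 by simp_all
  have "of_nat (?s choose p ^ v) * g ?s = of_nat ((a + ?s) choose (?s - p ^ v)) * g (p ^ v)"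
    using g pos le unfolding admissible_def by (metis add.commute le_add2 le_neq_implies_less not_one_le_zero add_cancel_right_left)
  moreover have "of_nat (?s choose p ^ j) * g ?s = of_nat ((a + ?s) choose (?s - p ^ j)) * g (p ^ j)"
    using g pos le unfolding admissible_def by (metis add.commute le_add2 le_neq_implies_less not_one_le_zero add_cancel_right_left)
  moreover have "(?s choose p ^ v) = (?s choose p ^ j)"
    using binomial_symmetric[of "p ^ v" ?s] by simp
  ultimately have eq: "of_nat ((a + ?s) choose p ^ j) * g (p ^ v) = of_nat ((a + ?s) choose p ^ v) * g (p ^ j)"
    by simp
  \<comment> \<open>The remaining binomial coefficients are floors of \<open>(a + s) / p ^ j\<close> and \<open>(a + s) / p ^ v\<close> modulo \<open>p\<close>.\<close>
  have "(a + ?s) div p ^ j = (a + p ^ v) div p ^ j + 1"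
    using div_add_self2[of "p ^ j" "a + p ^ v"] p2 by (simp add: add.assoc)
  also have "(a + p ^ v) div p ^ j = a div p ^ j"
  proof (rule ccontr)
    assume "(a + p ^ v) div p ^ j \<noteq> a div p ^ j"
    then have lt: "a div p ^ j < (a + p ^ v) div p ^ j" by (simp add: div_le_mono le_neq_implies_less)
    \<comment> \<open>If the floor jumped, a multiple of \<open>p ^ j\<close> would lie in \<open>{a + 1..a + p ^ v}\<close>, where \<open>a + 1\<close> is the only multiple of \<open>p ^ v\<close>.\<close>
    define M where "M = (a + p ^ v) div p ^ j * p ^ j"
    have M1: "M \<le> a + p ^ v" by (simp add: M_def)
    have "a < (a div p ^ j + 1) * p ^ j" using pos by (metis div_less_iff_less_mult less_add_one zero_less_one less_le_trans)
    also have "\<dots> \<le> M" unfolding M_def by (rule mult_right_mono) (use lt in auto)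
    finally have M2: "a + 1 \<le> M" by simp
    have "p ^ v dvd M" unfolding M_def using j by (simp add: le_imp_power_dvd)
    moreover have "p ^ v dvd a + 1" unfolding v by (rule multiplicity_dvd)
    ultimately have "p ^ v dvd M - (a + 1)" by (rule dvd_diff_nat)
    moreover have "M - (a + 1) < p ^ v" using M1 M2 pos by simp
    ultimately have "M = a + 1" using M2 by (metis dvd_imp_le le_antisym diff_is_0_eq not_le zero_less_diff)
    then have "p ^ Suc v dvd a + 1" unfolding M_def[symmetric] using j
      by (metis M_def Suc_leI dvd_triv_right dvd_trans le_imp_power_dvd)
    then have "Suc v \<le> multiplicity p (a + 1)"
      by (intro multiplicity_geI) (use p2 in auto)
    then show False using v by simp
  qed
  finally have 1: "of_nat ((a + ?s) choose p ^ j) = (full_count a (p ^ j) :: 'k)"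
    unfolding full_count_power unfolding binomial_power_eq_div[OF p char] by simp
  have "(a + ?s) div p ^ v = (a div p ^ v + 1) + p ^ (j - v)"
  proof -
    have e: "p ^ j = p ^ (j - v) * p ^ v" using j by (simp flip: power_add)
    have "a + ?s = a + (1 + p ^ (j - v)) * p ^ v" unfolding e by (simp add: algebra_simps)
    then have "(a + ?s) div p ^ v = (1 + p ^ (j - v)) + a div p ^ v"
      using div_mult_self1[of "p ^ v" a "1 + p ^ (j - v)"] p2 by (simp only:) simp
    then show ?thesis by simp
  qed
  moreover have "of_nat (p ^ (j - v)) = (0 :: 'k)"
    using j char by (auto simp: of_nat_eq_0_iff_char_dvd simp del: of_nat_power)
  ultimately have "of_nat ((a + ?s) choose p ^ v) = (full_count a (p ^ v) :: 'k)"
    unfolding full_count_power unfolding binomial_power_eq_div[OF p char]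
    by (simp only: of_nat_add add_0_right)
  then show ?thesis using eq 1 by simp
qed

lemma full_count_below:
  assumes "p ^ Suc i dvd a + 1"
  shows "full_count a (p ^ i) = (0 :: 'k)"
proof -
  have "p ^ i dvd a + 1" using assms by (rule dvd_trans[rotated]) simp
  then have "a div p ^ i + 1 = (a + 1) div p ^ i" by (simp add: div_Suc dvd_eq_mod_eq_0)
  moreover obtain y where "a + 1 = p ^ Suc i * y" using assms by blast
  then have "(a + 1) div p ^ i = p * y" using prime_gt_0_nat[OF p] by (simp add: mult.assoc mult.commute[of p "p ^ i"])
  ultimately show ?thesis unfolding full_count_power using char by (metis dvd_triv_left of_nat_eq_0_iff_char_dvd)
qed

lemma full_count_at:
  assumes v: "v = multiplicity p (a + 1)"
  shows "full_count a (p ^ v) \<noteq> (0 :: 'k)"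
proof
  assume "full_count a (p ^ v) = (0 :: 'k)"
  then have "p dvd a div p ^ v + 1" unfolding full_count_power using char of_nat_eq_0_iff_char_dvd by metis
  moreover have "a div p ^ v + 1 = (a + 1) div p ^ v"
    using multiplicity_dvd[of p "a + 1"] by (simp add: v div_Suc dvd_eq_mod_eq_0)
  moreover have "\<not> p dvd (a + 1) div p ^ v"
    unfolding v by (rule multiplicity_decompose) (use p in \<open>auto simp: prime_gt_1_nat\<close>)
  ultimately show False by simp
qed

text \<open>
  The bounds \<open>low\<close> and \<open>high\<close> say that the numbers at which \<open>p ^ i\<close> is compared with \<open>p ^ v\<close> are still at most
  \<open>b\<close>. For \<open>p ^ i \<le> b\<close> they can only fail for the largest power of \<open>p\<close> that is at most \<open>b\<close>, and this is the source of the James and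
  pointed partitions.
\<close>

lemma admissible_power:
  fixes g :: "nat \<Rightarrow> 'k"
  assumes g: "admissible a b g" and v: "v = multiplicity p (a + 1)"
    and low: "i < v \<Longrightarrow> p ^ Suc i \<le> b" and high: "v < i \<Longrightarrow> p ^ v + p ^ i \<le> b"
  shows "g (p ^ i) = g (p ^ v) / full_count a (p ^ v) * full_count a (p ^ i)"
proof -
  have nz: "full_count a (p ^ v) \<noteq> (0 :: 'k)" by (rule full_count_at[OF v])
  consider "i < v" | "i = v" | "v < i" by linarith
  then show ?thesis
  proof cases
    case 1
    then have "p ^ Suc i dvd a + 1" unfolding v by (intro multiplicity_dvd') simp
    then show ?thesis using admissible_low_power[OF g] full_count_below low[OF 1] by simp
  next
    case 2
    then show ?thesis using nz by simp
  next
    case 3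
    then show ?thesis using admissible_high_power[OF g v 3 high[OF 3]] nz
      by (simp add: field_simps)
  qed
qed

lemma admissible_below_top:
  fixes g :: "nat \<Rightarrow> 'k"
  assumes b: "b > 0" and g: "admissible a b g" and i: "i < plen p b"
    and v: "v = multiplicity p (a + 1)"
  shows "g (p ^ i) = g (p ^ v) / full_count a (p ^ v) * full_count a (p ^ i)"
proof (rule admissible_power[OF g v])
  have p2: "p \<ge> 2" using p by (rule prime_ge_2_nat)
  have "p ^ Suc i \<le> p ^ plen p b" by (rule power_increasing) (use i p2 in auto)
  then show le: "p ^ Suc i \<le> b" using plen_bounds(1)[OF p2 b] by simp
  assume "v < i"
  then have "p ^ v \<le> p ^ i" by (intro power_increasing) (use p2 in auto)
  then have "p ^ v + p ^ i \<le> 2 * p ^ i" by simp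
  also have "\<dots> \<le> p ^ Suc i" using p2 by simp
  finally show "p ^ v + p ^ i \<le> b" using le by simp
qed

lemma power_le_imp_le_plen:
  assumes "b > 0" "p ^ i \<le> b"
  shows "i \<le> plen p b"
proof -
  have p2: "p \<ge> 2" using p by (rule prime_ge_2_nat)
  have "p ^ i < p ^ Suc (plen p b)" using assms plen_bounds(2)[OF p2 assms(1)] by simp
  then have "i < Suc (plen p b)" by (rule power_less_imp_less_exp[rotated]) (use p2 in simp)
  then show ?thesis by simp
qed

text \<open>
  With \<open>l = plen p b\<close> and \<open>v = pval p (a + 1)\<close>, the value at \<open>p ^ l\<close> fails to be tied to the others only for
  \<open>l < v\<close>, which is the James condition, or for \<open>v < l\<close> and \<open>b < p ^ v + p ^ l\<close>, which is the pointed one.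
\<close>

theorem admissible_trivial_or_special:
  fixes g :: "nat \<Rightarrow> 'k"
  assumes b: "b > 0" and g: "admissible a b g" and nJ: "\<not> James p a b" and nP: "\<not> pointed p a b"
  shows "\<exists>c. \<forall>s. 1 \<le> s \<longrightarrow> s \<le> b \<longrightarrow> g s = c * full_count a s"
proof -
  define v where "v = multiplicity p (a + 1)"
  let ?l = "plen p b"
  have p2: "p \<ge> 2" using p by (rule prime_ge_2_nat)
  have pv: "pval p (a + 1) = v" unfolding v_def by (rule pval_eq_multiplicity[OF p]) simp
  have vl: "v \<le> ?l" using nJ unfolding James_def pv by simp
  have top: "p ^ v + p ^ ?l \<le> b" if "v < ?l"
  proof (rule ccontr)
    assume "\<not> p ^ v + p ^ ?l \<le> b"
    then have "pointed_decomp p a b ?l (b - p ^ ?l)"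
      using plen_bounds(1)[OF p2 b] that p2 unfolding pointed_decomp_def pv by auto
    then show False using nP by (auto simp: pointed_def)
  qed
  let ?c = "g (p ^ v) / full_count a (p ^ v)"
  have "g s - ?c * full_count a s = 0" if s: "1 \<le> s" "s \<le> b" for s
  proof (rule admissible_eq_0[OF admissible_diff_scale[OF g admissible_full_count] _ s])
    fix i assume "p ^ i \<le> b"
    then have "i \<le> ?l" by (rule power_le_imp_le_plen[OF b])
    then consider "i < ?l" | "i = ?l" by linarith
    then have "g (p ^ i) = ?c * full_count a (p ^ i)"
    proof cases
      case 1
      then show ?thesis by (rule admissible_below_top[OF b g _ v_def])
    next
      case 2
      then show ?thesis using vl top by (intro admissible_power[OF g v_def]) auto
    qed
    then show "g (p ^ i) - ?c * full_count a (p ^ i) = 0" by simp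
  qed
  then show ?thesis by (intro exI[of _ ?c]) simp
qed

text \<open>
  After subtracting multiples of \<open>full_count a\<close>, both functions vanish at all powers of \<open>p\<close> except possibly
  the largest one.
\<close>

theorem admissible_codim_1:
  fixes g h :: "nat \<Rightarrow> 'k"
  assumes b: "b > 0" and g: "admissible a b g" and h: "admissible a b h"
    and nt: "\<not> (\<exists>c. \<forall>s. 1 \<le> s \<longrightarrow> s \<le> b \<longrightarrow> h s = c * full_count a s)"
  shows "\<exists>c d. \<forall>s. 1 \<le> s \<longrightarrow> s \<le> b \<longrightarrow> g s = c * h s + d * full_count a s"
proof -
  define v where "v = multiplicity p (a + 1)"
  let ?l = "plen p b"
  define cg where "cg = g (p ^ v) / full_count a (p ^ v)"
  define ch where "ch = h (p ^ v) / full_count a (p ^ v)"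
  define g' where "g' = (\<lambda>s. g s - cg * full_count a s)"
  define h' where "h' = (\<lambda>s. h s - ch * full_count a s)"
  have ag: "admissible a b g'" and ah: "admissible a b h'"
    unfolding g'_def h'_def by (intro admissible_diff_scale g h admissible_full_count)+
  have g0: "g' (p ^ i) = 0" and h0: "h' (p ^ i) = 0" if "i < ?l" for i
    using admissible_below_top[OF b g that v_def] admissible_below_top[OF b h that v_def]
    by (simp_all add: g'_def h'_def cg_def ch_def)
  have hl: "h' (p ^ ?l) \<noteq> 0"
  proof
    assume z: "h' (p ^ ?l) = 0"
    have "h' s = 0" if "1 \<le> s" "s \<le> b" for s
    proof (rule admissible_eq_0[OF ah _ that])
      fix i assume "p ^ i \<le> b"
      then have "i \<le> ?l" by (rule power_le_imp_le_plen[OF b])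
      then show "h' (p ^ i) = 0" using h0 z by (cases "i = ?l") auto
    qed
    then show False using nt by (auto simp: h'_def)
  qed
  define r where "r = g' (p ^ ?l) / h' (p ^ ?l)"
  have lin: "x = r * y + (cg - r * ch) * z" if "x - cg * z - r * (y - ch * z) = 0" for x y z :: 'k
    using that by (simp add: algebra_simps)
  have "g' s - r * h' s = 0" if "1 \<le> s" "s \<le> b" for s
  proof (rule admissible_eq_0[OF admissible_diff_scale[OF ag ah] _ that])
    fix i assume "p ^ i \<le> b"
    then have "i \<le> ?l" by (rule power_le_imp_le_plen[OF b])
    then show "g' (p ^ i) - r * h' (p ^ i) = 0" using g0 h0 hl by (cases "i = ?l") (auto simp: r_def)
  qed
  then have "g s = r * h s + (cg - r * ch) * full_count a s" if "1 \<le> s" "s \<le> b" for s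
    using that lin unfolding g'_def h'_def by blast
  then show ?thesis by blast
qed

lemma full_count_eq_0_of_James:
  assumes "James p a b" and s: "1 \<le> s" "s \<le> b"
  shows "full_count a s = (0 :: 'k)"
proof (rule admissible_eq_0[OF admissible_full_count _ s])
  have pv: "pval p (a + 1) = multiplicity p (a + 1)" by (rule pval_eq_multiplicity[OF p]) simp
  fix i assume "p ^ i \<le> b"
  then have "i \<le> plen p b" by (rule power_le_imp_le_plen[rotated]) (use s in simp)
  then have "p ^ Suc i dvd a + 1" using assms unfolding James_def pv by (intro multiplicity_dvd') simp
  then show "full_count a (p ^ i) = (0 :: 'k)" by (rule full_count_below)
qed

end

section \<open>Trivial extensions and their counting functions\<close>

lemma exists_permutes_image:
  assumes V: "finite V" and Z: "Z \<subseteq> V" "Z' \<subseteq> V" "card Z = card Z'"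
  shows "\<exists>\<sigma>. \<sigma> permutes V \<and> \<sigma> ` Z = Z'"
proof -
  have fZ: "finite Z" "finite Z'" using V Z finite_subset by blast+
  obtain f where f: "bij_betw f Z Z'" using fZ Z(3) finite_same_card_bij by blast
  have "card (V - Z) = card (V - Z')" using fZ Z by (simp add: card_Diff_subset)
  then obtain g where g: "bij_betw g (V - Z) (V - Z')"
    using finite_same_card_bij[of "V - Z" "V - Z'"] V by blast
  define \<sigma> where "\<sigma> = (\<lambda>x. if x \<in> Z then f x else if x \<in> V then g x else x)"
  have s1: "bij_betw \<sigma> Z Z'" using f by (rule bij_betw_cong[THEN iffD1, rotated]) (simp add: \<sigma>_def)
  have s2: "bij_betw \<sigma> (V - Z) (V - Z')"
    using g by (rule bij_betw_cong[THEN iffD1, rotated]) (simp add: \<sigma>_def)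
  have "bij_betw \<sigma> (Z \<union> (V - Z)) (Z' \<union> (V - Z'))"
    by (rule bij_betw_combine[OF s1 s2]) blast
  moreover have "Z \<union> (V - Z) = V" "Z' \<union> (V - Z') = V" using Z by auto
  ultimately have "bij_betw \<sigma> V V" by simp
  then have "\<sigma> permutes V" by (rule bij_imp_permutes) (use Z in \<open>auto simp: \<sigma>_def\<close>)
  moreover have "\<sigma> ` Z = Z'" using s1 by (rule bij_betw_imp_surj_on)
  ultimately show ?thesis by blast
qed

lemma superset_sum_act:
  fixes f :: "nat set \<Rightarrow> 'k::field"
  assumes \<sigma>: "\<sigma> permutes V"
  shows "superset_sum V (act \<sigma> f) Z = superset_sum V f (inv \<sigma> ` Z)"
  unfolding superset_sum_def act_def
proof (rule sum.reindex_bij_witness[where i = "image \<sigma>" and j = "image (inv \<sigma>)"])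
  have i: "inv \<sigma> permutes V" using \<sigma> by (rule permutes_inv)
  have a: "\<sigma> ` inv \<sigma> ` Y = Y" "inv \<sigma> ` \<sigma> ` Y = Y" for Y
    using permutes_surj[OF \<sigma>] permutes_inj[OF \<sigma>] by (simp_all add: image_f_inv_f)
  have b: "\<sigma> ` Y \<subseteq> V \<longleftrightarrow> Y \<subseteq> V" "inv \<sigma> ` Y \<subseteq> V \<longleftrightarrow> Y \<subseteq> V" for Y
    using permutes_in_image[OF \<sigma>] permutes_in_image[OF i] by auto
  show "\<sigma> ` inv \<sigma> ` Y = Y" "inv \<sigma> ` \<sigma> ` Y = Y" for Y by (fact a)+
  show "inv \<sigma> ` Y \<in> {Y. Y \<subseteq> V \<and> inv \<sigma> ` Z \<subseteq> Y}" if "Y \<in> {Y. Y \<subseteq> V \<and> Z \<subseteq> Y}" for Y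
    using that b by auto
  show "\<sigma> ` Y \<in> {Y. Y \<subseteq> V \<and> Z \<subseteq> Y}" if Y: "Y \<in> {Y. Y \<subseteq> V \<and> inv \<sigma> ` Z \<subseteq> Y}" for Y
  proof -
    have "\<sigma> ` inv \<sigma> ` Z \<subseteq> \<sigma> ` Y" using Y by (intro image_mono) simp
    then show ?thesis using Y b(1)[of Y] a(1)[of Z] by simp
  qed
qed simp

lemma act_homog:
  fixes f :: "nat set \<Rightarrow> 'k::field"
  assumes \<sigma>: "\<sigma> permutes V" and f: "f \<in> homog V l"
  shows "act \<sigma> f \<in> homog V l"
  unfolding homog_def
proof (intro CollectI allI impI)
  have i: "inv \<sigma> permutes V" using \<sigma> by (rule permutes_inv)
  fix X assume "\<not> (X \<subseteq> V \<and> card X = l)"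
  moreover have "inv \<sigma> ` X \<subseteq> V \<longleftrightarrow> X \<subseteq> V" using permutes_in_image[OF i] by auto
  moreover have "card (inv \<sigma> ` X) = card X"
    by (rule card_image) (use permutes_inj_on[OF i] in blast)
  ultimately show "act \<sigma> f X = 0" using homog_eq_zero[OF f, of "inv \<sigma> ` X"] by (simp add: act_def)
qed

lemma perm_module_eq_homog: "perm_module a b = homog {1..a+b} b"
  by (auto simp: perm_module_def homog_def subsets_of_size_def)

lemma act_diff: "act \<sigma> (f - g) = act \<sigma> f - act \<sigma> g"
  by (simp add: act_def fun_eq_iff)

lemma act_fscale: "act \<sigma> (fscale c f) = fscale c (act \<sigma> f)"
  by (simp add: act_def fscale_def fun_eq_iff)

lemma superset_sum_plus: "superset_sum V (f + g) Z = superset_sum V f Z + superset_sum V g Z"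
  by (simp add: plus_fun_def superset_sum_add)

lemma superset_sum_minus: "superset_sum V (f - g) Z = superset_sum V f Z - superset_sum V g Z"
  by (simp add: fun_diff_def superset_sum_diff)

lemma superset_sum_fscale: "superset_sum V (fscale c f) Z = c * superset_sum V f Z"
  by (simp add: fscale_def superset_sum_scale)

lemma subspace_specht: "fs.subspace (specht a b)"
  unfolding specht_def by (rule fs.subspace_span)

lemma adjoin_iff: "y \<in> adjoin a b x \<longleftrightarrow> (\<exists>c. y - fscale c x \<in> specht a b)"
  unfolding adjoin_def fs.span_breakdown_eq
  by (simp add: specht_def fs.span_span)

lemma subspace_adjoin: "fs.subspace (adjoin a b x)"
  unfolding adjoin_def by (rule fs.subspace_span)

text \<open>
  Like \<open>admissible\<close>, this is indexed by the codimension \<open>b - card Z\<close>; only the values of \<open>g\<close> on \<open>{1..b}\<close>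
  matter.
\<close>

definition has_counts :: "nat \<Rightarrow> nat \<Rightarrow> (nat set \<Rightarrow> 'r::comm_ring_1) \<Rightarrow> (nat \<Rightarrow> 'r) \<Rightarrow> bool" where
  "has_counts a b f g \<longleftrightarrow> f \<in> homog {1..a+b} b \<and>
     (\<forall>Z. Z \<subseteq> {1..a+b} \<longrightarrow> card Z < b \<longrightarrow> superset_sum {1..a+b} f Z = g (b - card Z))"

lemma has_countsD: "has_counts a b f g \<Longrightarrow> Z \<subseteq> {1..a+b} \<Longrightarrow> card Z < b \<Longrightarrow> superset_sum {1..a+b} f Z = g (b - card Z)"
  by (simp add: has_counts_def)

lemma has_counts_initial:
  assumes "has_counts a b f g" "1 \<le> s" "s \<le> b"
  shows "superset_sum {1..a+b} f {1..b-s} = g s"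
proof -
  have "{1..b-s} \<subseteq> {1..a+b}" "card {1..b-s} < b" using assms(2,3) by auto
  from has_countsD[OF assms(1) this] show ?thesis using assms(3) by simp
qed

text \<open>
  Count, weighted by \<open>f\<close>, the \<open>(b - t)\<close>-sets between a \<open>(b - s)\<close>-set and the \<open>b\<close>-sets.
\<close>

lemma has_counts_admissible:
  assumes f: "has_counts a b f g"
  shows "admissible a b g"
  unfolding admissible_def
proof (intro allI impI, elim conjE)
  fix s t assume st: "1 \<le> t" "t < s" "s \<le> b"
  let ?V = "{1..a+b}" and ?Z = "{1..b-s}"
  have Z: "?Z \<subseteq> ?V" "card ?Z = b - s" by auto
  have h: "f \<in> homog ?V b" using f by (simp add: has_counts_def)
  have "of_nat ((b - card ?Z) choose (b - t - card ?Z)) * superset_sum ?V f ?Z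
      = (\<Sum>T | T \<subseteq> ?V \<and> card T = b - t \<and> ?Z \<subseteq> T. superset_sum ?V f T)"
    by (rule sum_superset_sum[symmetric]) (use h Z st in auto)
  also have "\<dots> = (\<Sum>T | T \<subseteq> ?V \<and> card T = b - t \<and> ?Z \<subseteq> T. g t)"
    using has_countsD[OF f] st by (intro sum.cong) auto
  also have "\<dots> = of_nat (card {T. T \<subseteq> ?V \<and> card T = b - t \<and> ?Z \<subseteq> T}) * g t" by simp
  also have "{T. T \<subseteq> ?V \<and> card T = b - t \<and> ?Z \<subseteq> T} = {T. ?Z \<subseteq> T \<and> T \<subseteq> ?V \<and> card T = b - t}" by auto
  also have "card \<dots> = (card ?V - card ?Z) choose (b - t - card ?Z)"
    by (rule card_intermediate_sets) (use Z st in auto)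
  also have "card ?V - card ?Z = a + s" using st by simp
  also have "b - t - card ?Z = s - t" using st by simp
  finally have "of_nat (s choose (s - t)) * g s = of_nat ((a + s) choose (s - t)) * g t"
    using st has_counts_initial[OF f, of s] by simp
  then show "of_nat (s choose t) * g s = of_nat ((a + s) choose (s - t)) * g t"
    using binomial_symmetric[of t s] st by simp
qed

definition all_sets :: "nat \<Rightarrow> nat \<Rightarrow> nat set \<Rightarrow> 'r::comm_ring_1" where
  "all_sets a b X = (if X \<subseteq> {1..a+b} \<and> card X = b then 1 else 0)"

lemma has_counts_all_sets: "has_counts a b (all_sets a b) (full_count a :: nat \<Rightarrow> 'r::comm_ring_1)"
  unfolding has_counts_def
proof (intro conjI allI impI)
  let ?V = "{1..a+b}"
  show h: "(all_sets a b :: _ \<Rightarrow> 'r) \<in> homog ?V b" by (auto simp: homog_def all_sets_def)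
  fix Z assume Z: "Z \<subseteq> ?V" "card Z < b"
  have "superset_sum ?V (all_sets a b) Z = (\<Sum>Y | Y \<subseteq> ?V \<and> card Y = b \<and> Z \<subseteq> Y. all_sets a b Y :: 'r)"
    by (rule superset_sum_homog[OF _ h]) simp
  also have "\<dots> = (\<Sum>Y | Y \<subseteq> ?V \<and> card Y = b \<and> Z \<subseteq> Y. 1)"
    by (rule sum.cong) (auto simp: all_sets_def)
  also have "\<dots> = of_nat (card {T. T \<subseteq> ?V \<and> card T = b \<and> Z \<subseteq> T})" by simp
  also have "{T. T \<subseteq> ?V \<and> card T = b \<and> Z \<subseteq> T} = {T. Z \<subseteq> T \<and> T \<subseteq> ?V \<and> card T = b}" by auto
  also have "card \<dots> = (card ?V - card Z) choose (b - card Z)"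
    by (rule card_intermediate_sets) (use Z in auto)
  finally show "superset_sum ?V (all_sets a b) Z = (full_count a (b - card Z) :: 'r)" using Z by simp
qed

lemma has_counts_diff:
  fixes f f' :: "nat set \<Rightarrow> 'k::field"
  assumes "has_counts a b f g" "has_counts a b f' g'"
  shows "has_counts a b (f - fscale c f') (\<lambda>s. g s - c * g' s)"
  unfolding has_counts_def superset_sum_minus superset_sum_fscale
proof (intro conjI allI impI)
  show "f - fscale c f' \<in> homog {1..a+b} b"
    unfolding fun_diff_def fscale_def
    using assms by (intro homog_diff homog_scale) (simp_all add: has_counts_def)
  fix Z :: "nat set" assume Z: "Z \<subseteq> {1..a+b}" "card Z < b"
  show "superset_sum {1..a+b} f Z - c * superset_sum {1..a+b} f' Z = g (b - card Z) - c * g' (b - card Z)"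
    by (simp only: has_countsD[OF assms(1) Z] has_countsD[OF assms(2) Z])
qed

lemma act_all_sets:
  assumes "\<sigma> permutes {1..a+b}"
  shows "act \<sigma> (all_sets a b) = (all_sets a b :: _ \<Rightarrow> 'k::field)"
proof
  fix X
  have i: "inv \<sigma> permutes {1..a+b}" using assms by (rule permutes_inv)
  have "inv \<sigma> ` X \<subseteq> {1..a+b} \<longleftrightarrow> X \<subseteq> {1..a+b}" using permutes_in_image[OF i] by auto
  moreover have "card (inv \<sigma> ` X) = card X" by (rule card_image) (use permutes_inj_on[OF i] in blast)
  ultimately show "act \<sigma> (all_sets a b) X = (all_sets a b X :: 'k)" by (simp add: act_def all_sets_def)
qed

context
  fixes a b :: nat
  assumes ab: "b \<le> a"
begin

lemma specht_iff_counts_0: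
  fixes f :: "nat set \<Rightarrow> 'k::field"
  assumes "has_counts a b f g"
  shows "f \<in> specht a b \<longleftrightarrow> (\<forall>s. 1 \<le> s \<longrightarrow> s \<le> b \<longrightarrow> g s = 0)"
proof
  assume "f \<in> specht a b"
  then have z: "superset_sum {1..a+b} f Z = 0" if "Z \<subseteq> {1..a+b}" "card Z < b" for Z
    using that unfolding specht_iff_kernel[OF ab] by blast
  have "g s = 0" if s: "1 \<le> s" "s \<le> b" for s
  proof -
    have "{1..b-s} \<subseteq> {1..a+b}" "card {1..b-s} < b" using s by auto
    from z[OF this] show ?thesis using has_counts_initial[OF assms s] by simp
  qed
  then show "\<forall>s. 1 \<le> s \<longrightarrow> s \<le> b \<longrightarrow> g s = 0" by blast
next
  assume "\<forall>s. 1 \<le> s \<longrightarrow> s \<le> b \<longrightarrow> g s = 0"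
  then show "f \<in> specht a b"
    using assms unfolding specht_iff_kernel[OF ab] has_counts_def
    by (metis diff_le_self less_imp_le_nat zero_less_diff Suc_leI One_nat_def)
qed

lemma act_specht:
  fixes f :: "nat set \<Rightarrow> 'k::field"
  assumes \<sigma>: "\<sigma> permutes {1..a+b}" and f: "f \<in> specht a b"
  shows "act \<sigma> f \<in> specht a b"
  unfolding specht_iff_kernel[OF ab]
proof (intro conjI allI impI)
  have i: "inv \<sigma> permutes {1..a+b}" using \<sigma> by (rule permutes_inv)
  show "act \<sigma> f \<in> homog {1..a+b} b" using act_homog[OF \<sigma>] f specht_iff_kernel[OF ab] by blast
  fix Z :: "nat set" assume Z: "Z \<subseteq> {1..a+b}" "card Z < b"
  have "inv \<sigma> ` Z \<subseteq> {1..a+b}" using permutes_in_image[OF i] Z by auto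
  moreover have "card (inv \<sigma> ` Z) = card Z" by (rule card_image) (use permutes_inj_on[OF i] in blast)
  ultimately show "superset_sum {1..a+b} (act \<sigma> f) Z = 0"
    using f Z unfolding specht_iff_kernel[OF ab] superset_sum_act[OF \<sigma>] by simp
qed

lemma act_minus_self_specht:
  fixes x :: "nat set \<Rightarrow> 'k::field"
  assumes x: "has_counts a b x g" and \<sigma>: "\<sigma> permutes {1..a+b}"
  shows "act \<sigma> x - x \<in> specht a b"
  unfolding specht_iff_kernel[OF ab]
proof (intro conjI allI impI)
  have i: "inv \<sigma> permutes {1..a+b}" using \<sigma> by (rule permutes_inv)
  have h: "x \<in> homog {1..a+b} b" using x by (simp add: has_counts_def)
  show "act \<sigma> x - x \<in> homog {1..a+b} b"
    unfolding fun_diff_def by (intro homog_diff act_homog[OF \<sigma>] h)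
  fix Z :: "nat set" assume Z: "Z \<subseteq> {1..a+b}" "card Z < b"
  have "inv \<sigma> ` Z \<subseteq> {1..a+b}" using permutes_in_image[OF i] Z by auto
  moreover have "card (inv \<sigma> ` Z) = card Z" by (rule card_image) (use permutes_inj_on[OF i] in blast)
  ultimately show "superset_sum {1..a+b} (act \<sigma> x - x) Z = 0"
    unfolding superset_sum_minus superset_sum_act[OF \<sigma>] using has_countsD[OF x] Z by simp
qed

lemma trivial_extension_of_counts:
  fixes x :: "nat set \<Rightarrow> 'k::field"
  assumes x: "has_counts a b x g" and nx: "x \<notin> specht a b"
  shows "trivial_extension a b x"
proof -
  have key: "act \<sigma> y - y \<in> specht a b" if \<sigma>: "\<sigma> permutes {1..a+b}" and y: "y \<in> adjoin a b x" for \<sigma> y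
  proof -
    obtain c where c: "y - fscale c x \<in> specht a b" using y unfolding adjoin_iff by blast
    have eq: "act \<sigma> y - y = (act \<sigma> (y - fscale c x) - (y - fscale c x)) + fscale c (act \<sigma> x - x)"
      by (simp add: act_def fscale_def fun_eq_iff algebra_simps)
    have "(act \<sigma> (y - fscale c x) - (y - fscale c x)) + fscale c (act \<sigma> x - x) \<in> specht a b"
      by (intro fs.subspace_add[OF subspace_specht] fs.subspace_diff[OF subspace_specht]
          fs.subspace_scale[OF subspace_specht] act_specht[OF \<sigma>] act_minus_self_specht[OF x \<sigma>] c)
    then show ?thesis by (subst eq)
  qed
  have "act \<sigma> y \<in> adjoin a b x" if \<sigma>: "\<sigma> permutes {1..a+b}" and y: "y \<in> adjoin a b x" for \<sigma> y
  proof -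
    have "act \<sigma> y - y \<in> adjoin a b x"
      unfolding adjoin_def by (rule fs.span_base) (simp add: key[OF \<sigma> y])
    from fs.subspace_add[OF subspace_adjoin this y] show ?thesis by simp
  qed
  then show ?thesis unfolding trivial_extension_def submodule_def
    by (intro conjI allI impI ballI subspace_adjoin nx key)
qed

text \<open>
  If \<open>\<sigma>\<close> maps \<open>Z'\<close> to \<open>Z\<close>, then \<open>act \<sigma> x - x\<close> lies in the Specht module, so the sums of \<open>x\<close> over the supersets
  of \<open>Z\<close> and of \<open>Z'\<close> agree.
\<close>

lemma counts_of_trivial_extension:
  fixes x :: "nat set \<Rightarrow> 'k::field"
  assumes x: "x \<in> perm_module a b" and e: "trivial_extension a b x"
  shows "\<exists>g. has_counts a b x g"
proof -
  let ?V = "{1..a+b}"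
  define g where "g = (\<lambda>s. superset_sum ?V x {1..b-s})"
  have g: "superset_sum ?V x Z = g (b - card Z)" if Z: "Z \<subseteq> ?V" "card Z < b" for Z
  proof -
    let ?I = "{1..b - (b - card Z)}"
    have "\<exists>\<sigma>. \<sigma> permutes ?V \<and> \<sigma> ` ?I = Z"
      by (rule exists_permutes_image) (use Z in auto)
    then obtain \<sigma> where \<sigma>: "\<sigma> permutes ?V" "\<sigma> ` ?I = Z" by (elim exE conjE)
    have inv: "inv \<sigma> ` Z = ?I"
      using image_inv_f_f[OF permutes_inj[OF \<sigma>(1)], of ?I] by (simp only: \<sigma>(2))
    have "x \<in> adjoin a b x" unfolding adjoin_def by (rule fs.span_base) simp
    then have "act \<sigma> x - x \<in> specht a b"
      using e[unfolded trivial_extension_def, THEN conjunct2, THEN conjunct2] \<sigma>(1) by blast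
    then have "superset_sum ?V (act \<sigma> x - x) Z = 0" using specht_iff_kernel[OF ab] Z by blast
    then have "superset_sum ?V x ?I - superset_sum ?V x Z = 0"
      unfolding superset_sum_minus superset_sum_act[OF \<sigma>(1)] inv .
    then show ?thesis unfolding g_def by simp
  qed
  have "x \<in> homog ?V b" using x by (simp only: perm_module_eq_homog)
  then have "has_counts a b x g" unfolding has_counts_def using g by (intro conjI allI impI)
  then show ?thesis by (intro exI[of _ g])
qed

text \<open>
  The element \<open>x\<close> is then congruent to a multiple of the sum of all \<open>b\<close>-sets, which is fixed by the group and
  so spans a complement.
\<close>

lemma split_of_full_counts:
  fixes x :: "nat set \<Rightarrow> 'k::field"
  assumes x: "has_counts a b x g" and nx: "x \<notin> specht a b"
    and g: "\<And>s. 1 \<le> s \<Longrightarrow> s \<le> b \<Longrightarrow> g s = c * full_count a s"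
  shows "split_extension a b x"
proof -
  let ?E = "all_sets a b :: nat set \<Rightarrow> 'k"
  let ?T = "range (\<lambda>r. fscale r ?E)"
  have d: "x - fscale c ?E \<in> specht a b"
    using specht_iff_counts_0[OF has_counts_diff[OF x has_counts_all_sets]] g by simp
  have nE: "?E \<notin> specht a b"
  proof
    assume "?E \<in> specht a b"
    then have "(x - fscale c ?E) + fscale c ?E \<in> specht a b"
      using d by (intro fs.subspace_add[OF subspace_specht] fs.subspace_scale[OF subspace_specht])
    then show False using nx by simp
  qed
  have c: "c \<noteq> 0"
  proof
    assume "c = 0"
    then show False using d nx by (simp only: fs.scale_zero_left diff_zero)
  qed
  have sub: "fs.subspace ?T"
  proof (rule fs.subspaceI)
    show "0 \<in> ?T" by (rule image_eqI[of _ _ 0]) (simp_all only: fs.scale_zero_left UNIV_I)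
    show "f + g \<in> ?T" if f: "f \<in> ?T" and g: "g \<in> ?T" for f g
    proof -
      obtain r where "f = fscale r ?E" using f by blast
      moreover obtain r' where "g = fscale r' ?E" using g by blast
      ultimately have "f + g = fscale (r + r') ?E" by (simp only: fs.scale_left_distrib)
      then show ?thesis by (rule image_eqI) simp
    qed
    show "fscale r f \<in> ?T" if f: "f \<in> ?T" for r f
    proof -
      obtain r' where "f = fscale r' ?E" using f by blast
      then have "fscale r f = fscale (r * r') ?E" by (simp only: fs.scale_scale)
      then show ?thesis by (rule image_eqI) simp
    qed
  qed
  have act: "act \<sigma> f \<in> ?T" if "\<sigma> permutes {1..a+b}" "f \<in> ?T" for \<sigma> f
  proof -
    obtain r where "f = fscale r ?E" using \<open>f \<in> ?T\<close> by blast
    then have "act \<sigma> f = fscale r ?E" by (simp only: act_fscale act_all_sets[OF that(1)])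
    then show ?thesis by (rule image_eqI) simp
  qed
  have int: "specht a b \<inter> ?T = {0}"
  proof (intro equalityI subsetI)
    fix f assume "f \<in> specht a b \<inter> ?T"
    then obtain r where r: "f = fscale r ?E" "fscale r ?E \<in> specht a b" by blast
    have "r = 0"
    proof (rule ccontr)
      assume "r \<noteq> 0"
      then have "fscale (inverse r) (fscale r ?E) = ?E" by (simp add: fs.scale_scale)
      then show False using fs.subspace_scale[OF subspace_specht r(2), of "inverse r"] nE by simp
    qed
    then show "f \<in> {0}" using r(1) by (simp only: fs.scale_zero_left singleton_iff)
  next
    fix f :: "nat set \<Rightarrow> 'k" assume "f \<in> {0}"
    then show "f \<in> specht a b \<inter> ?T"
      using fs.subspace_0[OF subspace_specht] fs.subspace_0[OF sub] by blast
  qed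
  have "adjoin a b x = {s + t | s t. s \<in> specht a b \<and> t \<in> ?T}"
  proof (intro equalityI subsetI)
    fix y assume "y \<in> adjoin a b x"
    then obtain r where r: "y - fscale r x \<in> specht a b" unfolding adjoin_iff by blast
    have eq: "y = ((y - fscale r x) + fscale r (x - fscale c ?E)) + fscale (r * c) ?E"
      by (simp add: fscale_def fun_eq_iff algebra_simps)
    have "(y - fscale r x) + fscale r (x - fscale c ?E) \<in> specht a b"
      by (intro fs.subspace_add[OF subspace_specht] fs.subspace_scale[OF subspace_specht] r d)
    moreover have "fscale (r * c) ?E \<in> ?T" by (rule rangeI)
    ultimately show "y \<in> {s + t | s t. s \<in> specht a b \<and> t \<in> ?T}"
      by (intro CollectI exI conjI) (rule eq)
  next
    fix y assume "y \<in> {s + t | s t. s \<in> specht a b \<and> t \<in> ?T}"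
    then obtain s t where s: "s \<in> specht a b" "y = s + t" and "t \<in> ?T" by blast
    then obtain r where r: "t = fscale r ?E" by blast
    have "y - fscale (r / c) x = s - fscale (r / c) (x - fscale c ?E)"
      unfolding s(2) r using c by (simp add: fscale_def fun_eq_iff algebra_simps)
    moreover have "s - fscale (r / c) (x - fscale c ?E) \<in> specht a b"
      by (intro fs.subspace_diff[OF subspace_specht] fs.subspace_scale[OF subspace_specht] s d)
    ultimately show "y \<in> adjoin a b x" unfolding adjoin_iff by metis
  qed
  moreover have "submodule (a + b) ?T" unfolding submodule_def using sub act by blast
  ultimately show ?thesis using int unfolding split_extension_def by (intro exI[of _ ?T] conjI)
qed

text \<open>
  The sum \<open>E\<close> of all \<open>b\<close>-sets is fixed by the group and may be added to \<open>x\<close> at no cost: if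
  \<open>x - c u - d E\<close> lies in the Specht module, then \<open>y \<mapsto> y - \<rho>(y) d E\<close> is an isomorphism, where \<open>\<rho>(y)\<close>
  is the coefficient of \<open>x\<close> in \<open>y\<close>. That \<open>x\<close> is non-split makes \<open>c\<close> non-zero and the map injective.
\<close>

theorem equivalent_of_counts:
  fixes x u :: "nat set \<Rightarrow> 'k::field"
  assumes x: "has_counts a b x g" and tx: "trivial_extension a b x" and ns: "\<not> split_extension a b x"
    and u: "has_counts a b u h"
    and gh: "\<And>s. 1 \<le> s \<Longrightarrow> s \<le> b \<Longrightarrow> g s = c * h s + d * full_count a s"
  shows "equivalent_extensions a b x u"
proof -
  let ?V = "{1..a+b}" and ?S = "specht a b :: (nat set \<Rightarrow> 'k) set"
  let ?E = "all_sets a b :: nat set \<Rightarrow> 'k"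
  note S = fs.subspace_add[OF subspace_specht] fs.subspace_scale[OF subspace_specht] fs.subspace_diff[OF subspace_specht]
  have nx: "x \<notin> ?S" using tx by (simp add: trivial_extension_def)
  have nE: "x - fscale e ?E \<notin> ?S" for e
  proof
    assume "x - fscale e ?E \<in> ?S"
    then have "g s = e * full_count a s" if "1 \<le> s" "s \<le> b" for s
      using specht_iff_counts_0[OF has_counts_diff[OF x has_counts_all_sets]] that by simp
    then show False using split_of_full_counts[OF x nx] ns by blast
  qed
  have rel: "x - fscale c u - fscale d ?E \<in> ?S"
    using specht_iff_counts_0[OF has_counts_diff[OF has_counts_diff[OF x u] has_counts_all_sets]] gh by simp
  have c: "c \<noteq> 0"
  proof
    assume "c = 0"
    then show False using rel nE[of d] by (simp only: fs.scale_zero_left diff_zero)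
  qed
  have nu: "u \<notin> ?S"
  proof
    assume "u \<in> ?S"
    then have "(x - fscale c u - fscale d ?E) + fscale c u \<in> ?S" by (intro S rel)
    moreover have "(x - fscale c u - fscale d ?E) + fscale c u = x - fscale d ?E" by simp
    ultimately show False using nE by metis
  qed
  have tu: "trivial_extension a b u" by (rule trivial_extension_of_counts[OF u nu])
  \<comment> \<open>The sum at a set of codimension \<open>s0\<close> is a linear functional that vanishes on the Specht module but not at \<open>x\<close>, so a multiple of it reads off the coefficient of \<open>x\<close>.\<close>
  obtain s0 where s0: "1 \<le> s0" "s0 \<le> b" "g s0 \<noteq> 0"
    using specht_iff_counts_0[OF x] nx by blast
  let ?I = "{1..b-s0}"
  have I: "?I \<subseteq> ?V" "card ?I < b" using s0 by auto
  define \<rho> where "\<rho> = (\<lambda>y. superset_sum ?V y ?I / g s0)"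
  define \<phi> where "\<phi> = (\<lambda>y. y - fscale (\<rho> y * d) ?E)"
  have \<rho>_add: "\<rho> (y + z) = \<rho> y + \<rho> z" and \<rho>_diff: "\<rho> (y - z) = \<rho> y - \<rho> z"
    and \<rho>_scale: "\<rho> (fscale r y) = r * \<rho> y" for y z r
    by (simp_all add: \<rho>_def superset_sum_plus superset_sum_minus superset_sum_fscale add_divide_distrib diff_divide_distrib)
  have \<rho>_S: "\<rho> y = 0" if "y \<in> ?S" for y
    using that I unfolding \<rho>_def specht_iff_kernel[OF ab] by simp
  have \<rho>_x: "\<rho> x = 1" using has_counts_initial[OF x s0(1,2)] s0 by (simp add: \<rho>_def)
  have \<rho>_adj: "\<rho> y = r" if "y - fscale r x \<in> ?S" for y r
    using \<rho>_S[OF that] by (simp add: \<rho>_diff \<rho>_scale \<rho>_x)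
  have adj: "y - fscale (\<rho> y) x \<in> ?S" if "y \<in> adjoin a b x" for y
    using that \<rho>_adj unfolding adjoin_iff by metis
  have \<rho>_act: "\<rho> (act \<sigma> y) = \<rho> y" if "\<sigma> permutes ?V" "y \<in> adjoin a b x" for \<sigma> y
  proof -
    have "act \<sigma> y - y \<in> ?S" using tx that unfolding trivial_extension_def by blast
    from \<rho>_S[OF this] show ?thesis by (simp add: \<rho>_diff)
  qed
  have into: "\<phi> y \<in> adjoin a b u" if y: "y \<in> adjoin a b x" for y
  proof -
    have "\<phi> y - fscale (\<rho> y * c) u = (y - fscale (\<rho> y) x) + fscale (\<rho> y) (x - fscale c u - fscale d ?E)"
      by (simp add: \<phi>_def fscale_def fun_eq_iff algebra_simps)
    moreover have "(y - fscale (\<rho> y) x) + fscale (\<rho> y) (x - fscale c u - fscale d ?E) \<in> ?S"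
      by (intro S adj[OF y] rel)
    ultimately show ?thesis unfolding adjoin_iff by metis
  qed
  have "inj_on \<phi> (adjoin a b x)"
  proof (rule inj_onI)
    fix y z assume y: "y \<in> adjoin a b x" and z: "z \<in> adjoin a b x" and eq: "\<phi> y = \<phi> z"
    have yz: "y - z = fscale (\<rho> (y - z) * d) ?E"
    proof
      fix X
      have "y X - \<rho> y * d * ?E X = z X - \<rho> z * d * ?E X"
        using fun_cong[OF eq, of X] by (simp add: \<phi>_def fscale_def)
      then show "(y - z) X = fscale (\<rho> (y - z) * d) ?E X"
        by (simp add: \<rho>_diff fscale_def algebra_simps)
    qed
    have "\<rho> (y - z) = 0"
    proof (rule ccontr)
      let ?r = "\<rho> (y - z)"
      assume r: "?r \<noteq> 0"
      have "(y - z) - fscale ?r x \<in> ?S"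
        by (intro adj fs.subspace_diff[OF subspace_adjoin] y z)
      then have "fscale (?r * d) ?E - fscale ?r x \<in> ?S" using yz by simp
      then have "fscale (- inverse ?r) (fscale (?r * d) ?E - fscale ?r x) \<in> ?S"
        by (rule fs.subspace_scale[OF subspace_specht])
      moreover have "fscale (- inverse ?r) (fscale (?r * d) ?E - fscale ?r x) = x - fscale d ?E"
        using r by (simp add: fscale_def fun_eq_iff right_diff_distrib mult.assoc[symmetric])
      ultimately show False using nE by metis
    qed
    then have "y - z = 0" using yz by (simp add: fscale_def fun_eq_iff)
    then show "y = z" by simp
  qed
  moreover have "\<phi> ` adjoin a b x = adjoin a b u"
  proof (intro equalityI subsetI)
    fix w assume "w \<in> adjoin a b u"
    then obtain r where r: "w - fscale r u \<in> ?S" unfolding adjoin_iff by blast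
    \<comment> \<open>The preimage must have coefficient \<open>r / c\<close> at \<open>x\<close>, which fixes the multiple of \<open>E\<close> to add.\<close>
    define y where "y = w + fscale (r / c * d) ?E"
    have "y - fscale (r / c) x = (w - fscale r u) - fscale (r / c) (x - fscale c u - fscale d ?E)"
      using c by (simp add: y_def fscale_def fun_eq_iff algebra_simps)
    moreover have "(w - fscale r u) - fscale (r / c) (x - fscale c u - fscale d ?E) \<in> ?S"
      by (intro S r rel)
    ultimately have m: "y - fscale (r / c) x \<in> ?S" by simp
    have "\<phi> y = w" unfolding \<phi>_def \<rho>_adj[OF m] by (simp add: y_def)
    moreover have "y \<in> adjoin a b x" using m unfolding adjoin_iff by blast
    ultimately show "w \<in> \<phi> ` adjoin a b x" by blast
  qed (use into in blast)
  ultimately have bij: "bij_betw \<phi> (adjoin a b x) (adjoin a b u)" by (simp add: bij_betw_def)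
  have "module_iso (a + b) (adjoin a b x) (adjoin a b u) \<phi>"
    unfolding module_iso_def
  proof (intro conjI ballI allI impI bij)
    show "\<phi> (y + z) = \<phi> y + \<phi> z" for y z
      by (simp add: \<phi>_def \<rho>_add fscale_def fun_eq_iff algebra_simps)
    show "\<phi> (fscale r y) = fscale r (\<phi> y)" for r y
      unfolding \<phi>_def \<rho>_scale by (simp add: fscale_def fun_eq_iff algebra_simps)
    show "\<phi> (act \<sigma> y) = act \<sigma> (\<phi> y)" if "\<sigma> permutes ?V" "y \<in> adjoin a b x" for \<sigma> y
      unfolding \<phi>_def \<rho>_act[OF that] act_diff act_fscale act_all_sets[OF that(1)] ..
  qed
  moreover have "\<phi> s = s" if "s \<in> ?S" for s
    by (simp add: \<phi>_def \<rho>_S[OF that])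
  ultimately show ?thesis using tx tu unfolding equivalent_extensions_def by blast
qed

end

section \<open>The element attached to a pointed partition\<close>

lemma superset_sum_sum: "superset_sum V (\<lambda>X. \<Sum>i\<in>I. f i X) Z = (\<Sum>i\<in>I. superset_sum V (f i) Z)"
  unfolding superset_sum_def by (rule sum.swap)

lemma card_subsets_with_trace:
  assumes U: "finite U" "P \<subseteq> U" and i: "i \<le> e"
  shows "card {Y. Y \<subseteq> U \<and> card Y = e \<and> card (P \<inter> Y) = i} = (card P choose i) * ((card U - card P) choose (e - i))"
proof -
  have fP: "finite P" "finite (U - P)" using U finite_subset by auto
  let ?A = "{A. A \<subseteq> P \<and> card A = i}" and ?B = "{B. B \<subseteq> U - P \<and> card B = e - i}"
  let ?Y = "{Y. Y \<subseteq> U \<and> card Y = e \<and> card (P \<inter> Y) = i}"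
  have "bij_betw (\<lambda>(A, B). A \<union> B) (?A \<times> ?B) ?Y"
  proof (rule bij_betwI[where g = "\<lambda>Y. (P \<inter> Y, Y - P)"])
    show "(\<lambda>(A, B). A \<union> B) \<in> ?A \<times> ?B \<rightarrow> ?Y"
    proof
      fix z assume "z \<in> ?A \<times> ?B"
      then obtain A B where z: "z = (A, B)" and A: "A \<subseteq> P" "card A = i" and B: "B \<subseteq> U - P" "card B = e - i" by blast
      have "finite A" "finite B" using A(1) B(1) fP finite_subset by blast+
      moreover have "A \<inter> B = {}" using A(1) B(1) by blast
      ultimately have "card (A \<union> B) = e" using A B i by (simp add: card_Un_disjoint)
      moreover have "P \<inter> (A \<union> B) = A" using A(1) B(1) by blast
      moreover have "A \<union> B \<subseteq> U" using A(1) B(1) U by blast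
      ultimately show "(case z of (A, B) \<Rightarrow> A \<union> B) \<in> ?Y" using A z by simp
    qed
    show "(\<lambda>Y. (P \<inter> Y, Y - P)) \<in> ?Y \<rightarrow> ?A \<times> ?B"
    proof
      fix Y assume "Y \<in> ?Y"
      then have Y: "Y \<subseteq> U" "card Y = e" "card (P \<inter> Y) = i" by auto
      have fY: "finite Y" using Y U finite_subset by blast
      have "card (Y - P) = card Y - card (P \<inter> Y)"
        using card_Diff_subset_Int[of Y P] fY by (simp add: Int_commute)
      then show "(P \<inter> Y, Y - P) \<in> ?A \<times> ?B" using Y by auto
    qed
    show "(\<lambda>Y. (P \<inter> Y, Y - P)) ((\<lambda>(A, B). A \<union> B) z) = z" if "z \<in> ?A \<times> ?B" for z
      using that by auto
    show "(\<lambda>(A, B). A \<union> B) (P \<inter> Y, Y - P) = Y" if "Y \<in> ?Y" for Y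
      by auto
  qed
  then have "card (?A \<times> ?B) = card ?Y" by (rule bij_betw_same_card)
  moreover have "card ?A = card P choose i" by (rule n_subsets[OF fP(1)])
  moreover have "card ?B = (card U - card P) choose (e - i)"
    using n_subsets[OF fP(2)] card_Diff_subset[OF fP(1) U(2)] by simp
  ultimately show ?thesis by (simp only: card_cartesian_product)
qed

lemma card_below_nth:
  assumes "sorted_wrt (<) xs" "k < length xs"
  shows "card {y \<in> set xs. y < (xs ! k :: 'a::linorder)} = k"
proof -
  have mono: "i < j \<Longrightarrow> j < length xs \<Longrightarrow> xs ! i < xs ! j" for i j
    using assms(1) by (simp add: sorted_wrt_iff_nth_less)
  have "{y \<in> set xs. y < xs ! k} = (\<lambda>i. xs ! i) ` {..<k}"
  proof (intro equalityI subsetI)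
    fix y assume "y \<in> {y \<in> set xs. y < xs ! k}"
    then obtain i where i: "i < length xs" "y = xs ! i" "xs ! i < xs ! k" by (auto simp: in_set_conv_nth)
    have "i < k"
    proof (rule ccontr)
      assume "\<not> i < k"
      then consider "k < i" | "i = k" by linarith
      then show False using mono[of k i] i by cases auto
    qed
    then show "y \<in> (\<lambda>i. xs ! i) ` {..<k}" using i by blast
  next
    fix y assume "y \<in> (\<lambda>i. xs ! i) ` {..<k}"
    then obtain i where "i < k" "y = xs ! i" by blast
    then show "y \<in> {y \<in> set xs. y < xs ! k}" using mono[of i k] assms(2) by simp
  qed
  moreover have "inj_on (\<lambda>i. xs ! i) {..<k}"
  proof (rule inj_onI)
    fix i j assume ij: "i \<in> {..<k}" "j \<in> {..<k}" "xs ! i = xs ! j"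
    show "i = j"
    proof (rule linorder_cases[of i j])
      assume "i < j" then show ?thesis using mono[of i j] ij assms(2) by simp
    next
      assume "j < i" then show ?thesis using mono[of j i] ij assms(2) by simp
    qed
  qed
  ultimately show ?thesis by (simp add: card_image)
qed

lemma bij_betw_image_subsets:
  assumes "inj_on f A"
  shows "bij_betw (image f) {X. X \<subseteq> A \<and> card X = r} {Q. Q \<subseteq> f ` A \<and> card Q = r}"
  unfolding bij_betw_def
proof (intro conjI equalityI subsetI)
  show "inj_on (image f) {X. X \<subseteq> A \<and> card X = r}"
    by (rule inj_on_subset[OF inj_on_image_Pow[OF assms]]) auto
  fix Q assume "Q \<in> {Q. Q \<subseteq> f ` A \<and> card Q = r}"
  then obtain X where X: "X \<subseteq> A" "Q = f ` X" "card Q = r" by (auto simp: subset_image_iff)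
  then have "card X = r" using card_image[OF inj_on_subset[OF assms X(1)]] by simp
  then show "Q \<in> image f ` {X. X \<subseteq> A \<and> card X = r}" using X by blast
next
  fix Q assume "Q \<in> image f ` {X. X \<subseteq> A \<and> card X = r}"
  then obtain X where X: "X \<subseteq> A" "Q = f ` X" "card X = r" by blast
  then have "card Q = r" using card_image[OF inj_on_subset[OF assms X(1)]] by simp
  then show "Q \<in> {Q. Q \<subseteq> f ` A \<and> card Q = r}" using X by blast
qed

text \<open>
  The set on which the relabelled \<open>u\<^sub>0\<close> lives: the points outside \<open>Y\<close> that have at least \<open>m\<close> predecessors
  outside \<open>Y\<close>. This form no longer mentions the relabelling.
\<close>

definition late_points :: "nat \<Rightarrow> nat \<Rightarrow> nat set \<Rightarrow> nat set" where
  "late_points n m Y = {z \<in> {1..n} - Y. m \<le> card {y \<in> {1..n} - Y. y < z}}"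

lemma relabel_image:
  assumes Y: "card ({1..n} - Y) = N"
  shows "relabel n Y ` {m<..N} = late_points n m Y" and "inj_on (relabel n Y) {m<..N}"
proof -
  let ?xs = "sorted_list_of_set ({1..n} - Y)"
  have len: "length ?xs = N" using Y by simp
  have set: "set ?xs = {1..n} - Y" by simp
  have ss: "sorted_wrt (<) ?xs" by (simp add: strict_sorted_iff)
  have pos: "card {y \<in> {1..n} - Y. y < ?xs ! k} = k" if "k < N" for k
  proof -
    have "card {y \<in> set ?xs. y < ?xs ! k} = k" by (rule card_below_nth[OF ss]) (simp only: len that)
    then show ?thesis unfolding set .
  qed
  show "relabel n Y ` {m<..N} = late_points n m Y"
  proof (intro equalityI subsetI)
    fix z assume "z \<in> relabel n Y ` {m<..N}"
    then obtain i where "i \<in> {m<..N}" "z = relabel n Y i" by blast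
    then have i: "m < i" "i \<le> N" "z = ?xs ! (i - 1)" by (simp_all add: relabel_def)
    then have "i - 1 < N" "m \<le> i - 1" by linarith+
    moreover have "z \<in> set ?xs" unfolding i(3) by (rule nth_mem) (simp only: len \<open>i - 1 < N\<close>)
    ultimately show "z \<in> late_points n m Y"
      unfolding late_points_def set i(3) by (simp only: mem_Collect_eq pos)
  next
    fix z assume z: "z \<in> late_points n m Y"
    then have "z \<in> set ?xs" unfolding set by (simp add: late_points_def)
    then obtain k where k: "k < N" "?xs ! k = z" unfolding in_set_conv_nth len by (elim exE conjE)
    have "m \<le> card {y \<in> {1..n} - Y. y < ?xs ! k}" using z unfolding k(2) late_points_def by simp
    then have "m \<le> k" unfolding pos[OF k(1)] .
    then have "Suc k \<in> {m<..N}" using k(1) by simp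
    moreover have "z = relabel n Y (Suc k)" using k(2) by (simp add: relabel_def)
    ultimately show "z \<in> relabel n Y ` {m<..N}" by (rule rev_image_eqI)
  qed
  show "inj_on (relabel n Y) {m<..N}"
  proof (rule inj_onI)
    fix i j assume ij: "i \<in> {m<..N}" "j \<in> {m<..N}" "relabel n Y i = relabel n Y j"
    then have lt: "i - 1 < N" "j - 1 < N" by simp_all linarith+
    have eq: "?xs ! (i - 1) = ?xs ! (j - 1)" using ij(3) unfolding relabel_def .
    have "i - 1 = card {y \<in> {1..n} - Y. y < ?xs ! (i - 1)}" by (rule pos[OF lt(1), symmetric])
    also have "\<dots> = j - 1" unfolding eq by (rule pos[OF lt(2)])
    finally have "i - 1 = j - 1" .
    moreover have "i > 0" "j > 0" using ij(1,2) by auto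
    ultimately show "i = j" by linarith
  qed
qed

lemma u0_sets_eq: "u0_sets a q = {X. X \<subseteq> {a - q + 1<..a + q} \<and> card X = q}"
proof -
  have eq: "{a - q + 1<..a + q} = {1..a + q} - {1..a - q + 1}" by auto
  show ?thesis
    unfolding u0_sets_def subsets_of_size_def mem_Collect_eq eq by (rule Collect_cong) blast
qed

lemma u_Y_eq:
  assumes Y: "card ({1..a+b} - Y) = a + q"
  shows "u_Y a b q Y X = (\<Sum>Q | Q \<subseteq> late_points (a+b) (a-q+1) Y \<and> card Q = q. single (Q \<union> Y) X)"
proof -
  let ?r = "relabel (a+b) Y"
  have "bij_betw (image ?r) (u0_sets a q) {Q. Q \<subseteq> late_points (a+b) (a-q+1) Y \<and> card Q = q}"
    unfolding u0_sets_eq relabel_image(1)[OF Y, symmetric]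
    by (rule bij_betw_image_subsets[OF relabel_image(2)[OF Y]])
  from sum.reindex_bij_betw[OF this, of "\<lambda>Q. single (Q \<union> Y) X"]
  show ?thesis unfolding u_Y_def sum_apply .
qed

text \<open>
  Exchanging the sums over \<open>X\<close> and \<open>Y\<close> shows that the design enters only through its constant \<open>\<alpha>\<close>.
\<close>

lemma u_design_eq:
  assumes "\<And>Y. Y \<in> subsets_of_size (a + b) bh \<Longrightarrow> (\<Sum>X | X \<in> subsets_of_size (a + b) (b - 1) \<and> Y \<subseteq> X. U X) = \<alpha>"
  shows "u_design a b q bh U = (\<lambda>T. \<alpha> * (\<Sum>Y\<in>subsets_of_size (a + b) bh. u_Y a b q Y T))"
proof
  fix T
  let ?X = "subsets_of_size (a + b) (b - 1)" and ?Y = "subsets_of_size (a + b) bh"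
  have fin: "finite (subsets_of_size n r)" for n r by (simp add: subsets_of_size_def)
  have "u_design a b q bh U T = (\<Sum>X\<in>?X. U X * (\<Sum>Y | Y \<subseteq> X \<and> card Y = bh. u_Y a b q Y T))"
    by (simp add: u_design_def u_bar_def sum_apply fscale_def)
  also have "\<dots> = (\<Sum>X\<in>?X. \<Sum>Y | Y \<in> ?Y \<and> Y \<subseteq> X. U X * u_Y a b q Y T)"
  proof (rule sum.cong[OF refl])
    fix X assume "X \<in> ?X"
    then have "{Y. Y \<subseteq> X \<and> card Y = bh} = {Y. Y \<in> ?Y \<and> Y \<subseteq> X}" by (auto simp: subsets_of_size_def)
    then show "U X * (\<Sum>Y | Y \<subseteq> X \<and> card Y = bh. u_Y a b q Y T) = (\<Sum>Y | Y \<in> ?Y \<and> Y \<subseteq> X. U X * u_Y a b q Y T)"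
      by (simp only: sum_distrib_left)
  qed
  also have "\<dots> = (\<Sum>Y\<in>?Y. \<Sum>X | X \<in> ?X \<and> Y \<subseteq> X. U X * u_Y a b q Y T)"
    by (rule sum.swap_restrict[OF fin fin])
  also have "\<dots> = (\<Sum>Y\<in>?Y. \<alpha> * u_Y a b q Y T)"
  proof (rule sum.cong[OF refl])
    fix Y assume "Y \<in> ?Y"
    from assms[OF this]
    show "(\<Sum>X | X \<in> ?X \<and> Y \<subseteq> X. U X * u_Y a b q Y T) = \<alpha> * u_Y a b q Y T"
      unfolding sum_distrib_right[symmetric] by simp
  qed
  finally show "u_design a b q bh U T = \<alpha> * (\<Sum>Y\<in>?Y. u_Y a b q Y T)"
    by (simp only: sum_distrib_left)
qed

context
  fixes p a b \<beta> bh :: nat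
  assumes p: "prime p" and char: "CHAR('k::field) = p" and ab: "b \<le> a"
    and dec: "pointed_decomp p a b \<beta> bh"
begin

lemma pointed_facts:
  shows "b = p ^ \<beta> + bh" "bh < p ^ multiplicity p (a + 1)" "p ^ multiplicity p (a + 1) < p ^ \<beta>"
    "p ^ multiplicity p (a + 1) dvd a + 1" "p ^ multiplicity p (a + 1) dvd p ^ \<beta>"
proof -
  have v: "pval p (a + 1) = multiplicity p (a + 1)" by (rule pval_eq_multiplicity[OF p]) simp
  show 1: "b = p ^ \<beta> + bh" "bh < p ^ multiplicity p (a + 1)" "p ^ multiplicity p (a + 1) < p ^ \<beta>"
    using dec unfolding pointed_decomp_def v by simp_all
  show "p ^ multiplicity p (a + 1) dvd a + 1" by (rule multiplicity_dvd)
  have "multiplicity p (a + 1) < \<beta>"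
    using 1(3) by (rule power_less_imp_less_exp[rotated]) (use prime_gt_1_nat[OF p] in simp)
  then show "p ^ multiplicity p (a + 1) dvd p ^ \<beta>" by (intro le_imp_power_dvd) simp
qed

text \<open>
  Classify the sets \<open>Y\<close> by \<open>i = card (P \<inter> Y)\<close>. If the condition on \<open>P - Y\<close> always holds, their number is
  \<open>a + e choose e\<close>, which is zero modulo \<open>p\<close> since \<open>0 < e < p ^ v\<close> and \<open>p ^ v dvd a + 1\<close>. If it
  holds for \<open>i \<le> w\<close> with \<open>w < e\<close>, the number for each \<open>i\<close> is a multiple of
  \<open>p ^ \<beta> + (e - 1 - w) choose (e - i)\<close>, and is zero modulo \<open>p\<close> because \<open>e - 1 - w < e - i < p ^ \<beta>\<close>.
\<close>

lemma count_leaving_many: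
  assumes U: "finite U" "P \<subseteq> U" "card U = a + e" and e: "0 < e" "e \<le> bh"
  shows "of_nat (card {Y. Y \<subseteq> U \<and> card Y = e \<and> a - p ^ \<beta> + 1 \<le> card (P - Y)}) = (0 :: 'k)"
proof -
  note pf = pointed_facts
  define m where "m = a - p ^ \<beta> + 1"
  have m: "m + p ^ \<beta> = a + 1" using pf(1) ab by (simp add: m_def)
  have fP: "finite P" using U finite_subset by blast
  let ?S = "{Y. Y \<subseteq> U \<and> card Y = e \<and> m \<le> card (P - Y)}"
  have PY: "card (P - Y) = card P - card (P \<inter> Y)" for Y
    using card_Diff_subset_Int[of P Y] fP by simp
  have Pe: "card (P \<inter> Y) \<le> e" if "Y \<subseteq> U" "card Y = e" for Y
  proof -
    have "finite Y" using that U finite_subset by blast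
    from card_mono[OF this, of "P \<inter> Y"] show ?thesis using that by simp
  qed
  consider "card P < m" | "m + e \<le> card P" | w where "card P = m + w" "w < e"
  proof (cases "card P < m \<or> m + e \<le> card P")
    case True
    then show thesis using that(1,2) by (elim disjE)
  next
    case False
    then have "card P = m + (card P - m)" "card P - m < e" by linarith+
    then show thesis by (rule that(3))
  qed
  then have "of_nat (card ?S) = (0 :: 'k)"
  proof cases
    case 1
    then have "\<not> m \<le> card (P - Y)" for Y unfolding PY by simp
    then show ?thesis by simp
  next
    case 2
    have "m \<le> card (P - Y)" if "Y \<subseteq> U" "card Y = e" for Y
      using Pe[OF that] 2 unfolding PY by linarith
    then have "?S = {Y. Y \<subseteq> U \<and> card Y = e}" by blast
    then have "card ?S = (a + e) choose e" using n_subsets[OF U(1), of e] U(3) by simp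
    also have "of_nat \<dots> = (of_nat ((e - 1) choose e) :: 'k)"
      using binomial_shift[OF p char _ pf(4), of e "e - 1"] e pf(2) by simp
    also have "\<dots> = 0" using e by (simp add: binomial_eq_0)
    finally show ?thesis .
  next
    case 3
    have "?S = (\<Union>i\<in>{..w}. {Y. Y \<subseteq> U \<and> card Y = e \<and> card (P \<inter> Y) = i})"
    proof -
      have "m > 0" using m_def by simp
      then have "m \<le> card P - j \<longleftrightarrow> j \<le> w" for j using 3 by linarith
      then show ?thesis unfolding PY by blast
    qed
    then have "card ?S = (\<Sum>i\<le>w. card {Y. Y \<subseteq> U \<and> card Y = e \<and> card (P \<inter> Y) = i})"
      using U by (simp only:) (rule card_UN_disjoint, auto)
    also have "of_nat \<dots> = (\<Sum>i\<le>w. of_nat (card P choose i) * of_nat ((card U - card P) choose (e - i)) :: 'k)"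
      unfolding of_nat_sum
      by (rule sum.cong[OF refl]) (use 3 U in \<open>simp add: card_subsets_with_trace\<close>)
    also have "\<dots> = 0"
    proof (rule sum.neutral, rule ballI)
      fix i assume "i \<in> {..w}"
      then have i: "i \<le> w" by simp
      have eq: "card U - card P = p ^ \<beta> + (e - 1 - w)" using 3 U(3) m by simp
      have "of_nat ((card U - card P) choose (e - i)) = (of_nat ((e - 1 - w) choose (e - i)) :: 'k)"
        unfolding eq by (rule binomial_shift_power[OF p char]) (use e pf(2,3) in simp)
      also have "\<dots> = 0" using i 3 by (simp add: binomial_eq_0)
      finally show "of_nat (card P choose i) * of_nat ((card U - card P) choose (e - i)) = (0 :: 'k)" by simp
    qed
    finally show ?thesis .
  qed
  then show ?thesis by (simp only: m_def)
qed

lemma late_points_subset_iff: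
  assumes Q: "Q \<subseteq> {1..n} - Y" "Q \<noteq> {}"
  shows "Q \<subseteq> late_points n m Y \<longleftrightarrow> m \<le> card {y \<in> {1..n} - Y. y < Min Q}"
proof
  have fQ: "finite Q" using Q finite_subset[of Q "{1..n}"] by blast
  { assume "Q \<subseteq> late_points n m Y"
    moreover have "Min Q \<in> Q" using fQ Q by (intro Min_in)
    ultimately show "m \<le> card {y \<in> {1..n} - Y. y < Min Q}" by (auto simp: late_points_def) }
  assume m: "m \<le> card {y \<in> {1..n} - Y. y < Min Q}"
  show "Q \<subseteq> late_points n m Y"
  proof
    fix z assume z: "z \<in> Q"
    have "Min Q \<le> z" using fQ z by (rule Min_le)
    then have "card {y \<in> {1..n} - Y. y < Min Q} \<le> card {y \<in> {1..n} - Y. y < z}"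
      by (intro card_mono) auto
    then show "z \<in> late_points n m Y" using z Q m by (auto simp: late_points_def)
  qed
qed

text \<open>
  Fix the remainder \<open>Q = Z - Y\<close>. Then \<open>Y\<close> is determined by its part outside \<open>Z\<close>, whose size \<open>e\<close> is positive
  as \<open>card Z < b\<close>, and the condition on late points only concerns the least element of \<open>Q\<close>: it demands that
  \<open>Y\<close> omits enough of the points below it. The number of such \<open>Y\<close> is zero modulo \<open>p\<close>
  for each \<open>Q\<close> separately.
\<close>

lemma count_late_remainder:
  assumes Z: "Z \<subseteq> {1..a+b}" "card Z < b"
  shows "of_nat (card {Y \<in> subsets_of_size (a + b) bh.
      Z - Y \<subseteq> late_points (a+b) (a - p ^ \<beta> + 1) Y \<and> card (Z - Y) = p ^ \<beta>}) = (0 :: 'k)"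
proof -
  note pf = pointed_facts
  let ?V = "{1..a+b}" and ?m = "a - p ^ \<beta> + 1" and ?q = "p ^ \<beta>"
  let ?S = "{Y \<in> subsets_of_size (a + b) bh. Z - Y \<subseteq> late_points (a+b) ?m Y \<and> card (Z - Y) = ?q}"
  let ?F = "\<lambda>Q. {Y \<in> subsets_of_size (a + b) bh. Z - Y = Q \<and> Q \<subseteq> late_points (a+b) ?m Y}"
  let ?Q = "{Q. Q \<subseteq> Z \<and> card Q = ?q}"
  have fZ: "finite Z" using Z finite_subset by blast
  have fs: "finite (subsets_of_size (a + b) bh)" by (simp add: subsets_of_size_def)
  have q: "?q > 0" using prime_gt_0_nat[OF p] by simp
  have "?S = (\<Union>Q\<in>?Q. ?F Q)" by auto
  then have "card ?S = (\<Sum>Q\<in>?Q. card (?F Q))"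
    using fZ fs by (simp only:) (rule card_UN_disjoint, auto)
  also have "of_nat \<dots> = (0 :: 'k)"
    unfolding of_nat_sum
  proof (rule sum.neutral, rule ballI)
    fix Q assume "Q \<in> ?Q"
    then have Q: "Q \<subseteq> Z" "card Q = ?q" by auto
    have fQ: "finite Q" using Q fZ finite_subset by blast
    have Qne: "Q \<noteq> {}" using Q q by auto
    define R where "R = Z - Q"
    have cR: "card R + ?q = card Z" using Q fZ fQ card_mono[OF fZ Q(1)] by (simp add: R_def card_Diff_subset)
    define e where "e = bh - card R"
    have e: "0 < e" "e \<le> bh" "card R + e = bh" using cR Z pf(1) by (auto simp: e_def)
    let ?U = "?V - Z"
    let ?P = "{y \<in> ?U. y < Min Q}"
    have cU: "card ?U = a + e" using Z fZ cR e pf(1) by (simp add: card_Diff_subset)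
    have below: "{y \<in> ?V - Y. y < Min Q} = ?P - Y" if "Z - Y = Q" for Y
    proof -
      have "y \<notin> Z" if "y \<notin> Y" "y < Min Q" for y
      proof
        assume "y \<in> Z"
        then have "y \<in> Q" using that \<open>Z - Y = Q\<close> by blast
        then have "Min Q \<le> y" using fQ by (intro Min_le)
        then show False using that by simp
      qed
      then show ?thesis by auto
    qed
    have "bij_betw (\<lambda>Y. Y - Z) (?F Q) {Y. Y \<subseteq> ?U \<and> card Y = e \<and> ?m \<le> card (?P - Y)}"
    proof (rule bij_betwI[where g = "\<lambda>Y. Y \<union> R"])
      show "(\<lambda>Y. Y - Z) \<in> ?F Q \<rightarrow> {Y. Y \<subseteq> ?U \<and> card Y = e \<and> ?m \<le> card (?P - Y)}"
      proof
        fix Y assume "Y \<in> ?F Q"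
        then have Y: "Y \<subseteq> ?V" "card Y = bh" "Z - Y = Q" "Q \<subseteq> late_points (a+b) ?m Y"
          by (auto simp: subsets_of_size_def)
        have YZ: "Y \<inter> Z = R" using Y(3) by (auto simp: R_def)
        have fY: "finite Y" using Y(1) finite_subset by blast
        have "card (Y - Z) = e" using card_Diff_subset_Int[of Y Z] fY fZ YZ Y(2) by (simp add: e_def R_def)
        moreover have "Q \<subseteq> ?V - Y" using Y(3) Z by blast
        then have "?m \<le> card (?P - Y)"
          using late_points_subset_iff[of Q "a+b" Y ?m] Qne Y(4) below[OF Y(3)] by simp
        moreover have "?P - (Y - Z) = ?P - Y" by auto
        ultimately show "Y - Z \<in> {Y. Y \<subseteq> ?U \<and> card Y = e \<and> ?m \<le> card (?P - Y)}"
          using Y(1) by auto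
      qed
      show "(\<lambda>Y. Y \<union> R) \<in> {Y. Y \<subseteq> ?U \<and> card Y = e \<and> ?m \<le> card (?P - Y)} \<rightarrow> ?F Q"
      proof
        fix Y assume "Y \<in> {Y. Y \<subseteq> ?U \<and> card Y = e \<and> ?m \<le> card (?P - Y)}"
        then have Y: "Y \<subseteq> ?U" "card Y = e" "?m \<le> card (?P - Y)" by auto
        have fY: "finite Y" using Y(1) finite_subset[of Y ?U] by blast
        have ZY: "Z - (Y \<union> R) = Q" using Y(1) Q(1) by (auto simp: R_def)
        have "card (Y \<union> R) = card Y + card R"
          by (rule card_Un_disjoint) (use fY fZ Y(1) in \<open>auto simp: R_def\<close>)
        then have "card (Y \<union> R) = bh" using Y(2) e by simp
        moreover have "Y \<union> R \<subseteq> ?V" using Y(1) Z(1) by (auto simp: R_def)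
        moreover have "?P - (Y \<union> R) = ?P - Y" by (auto simp: R_def)
        then have "?m \<le> card {y \<in> ?V - (Y \<union> R). y < Min Q}" using Y(3) below[OF ZY] by simp
        moreover have "Q \<subseteq> ?V - (Y \<union> R)" using ZY Z by blast
        ultimately have "Q \<subseteq> late_points (a+b) ?m (Y \<union> R)" "card (Y \<union> R) = bh" "Y \<union> R \<subseteq> ?V"
          using late_points_subset_iff[of Q "a+b" "Y \<union> R" ?m] Qne by simp_all
        then show "Y \<union> R \<in> ?F Q" using ZY by (simp add: subsets_of_size_def)
      qed
      show "(\<lambda>Y. Y \<union> R) ((\<lambda>Y. Y - Z) Y) = Y" if "Y \<in> ?F Q" for Y
        using that by (auto simp: R_def)
      show "(\<lambda>Y. Y - Z) ((\<lambda>Y. Y \<union> R) Y) = Y" if "Y \<in> {Y. Y \<subseteq> ?U \<and> card Y = e \<and> ?m \<le> card (?P - Y)}" for Y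
        using that by (auto simp: R_def)
    qed
    then have "card (?F Q) = card {Y. Y \<subseteq> ?U \<and> card Y = e \<and> ?m \<le> card (?P - Y)}"
      by (rule bij_betw_same_card)
    moreover have "of_nat (card {Y. Y \<subseteq> ?U \<and> card Y = e \<and> ?m \<le> card (?P - Y)}) = (0 :: 'k)"
      by (rule count_leaving_many) (use cU e in auto)
    ultimately show "of_nat (card (?F Q)) = (0 :: 'k)" by simp
  qed
  finally show ?thesis .
qed

text \<open>
  With \<open>i = card (Z - Y)\<close> and \<open>q = p ^ \<beta>\<close>, and \<open>Z - Y\<close> contained in the late points, the sum counts the \<open>q\<close>-sets between \<open>Z - Y\<close> and the late points, of
  which there are \<open>2 * q - 1\<close>. So it is \<open>2 * q - 1 - i choose (q - i)\<close>, which modulo \<open>p\<close> is zero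
  unless \<open>i\<close> is \<open>0\<close> or \<open>q\<close>, when it is one.
\<close>

lemma superset_sum_u_Y:
  assumes Y: "Y \<in> subsets_of_size (a + b) bh" and Z: "Z \<subseteq> {1..a+b}"
  shows "superset_sum {1..a+b} (u_Y a b (p ^ \<beta>) Y) Z = ((if Z \<subseteq> Y then 1 else 0) +
    (if Z - Y \<subseteq> late_points (a+b) (a - p ^ \<beta> + 1) Y \<and> card (Z - Y) = p ^ \<beta> then 1 else 0) :: 'k)"
proof -
  note pf = pointed_facts
  let ?V = "{1..a+b}" and ?q = "p ^ \<beta>"
  let ?W = "late_points (a+b) (a - ?q + 1) Y"
  have Y': "Y \<subseteq> ?V" "card Y = bh" using Y by (auto simp: subsets_of_size_def)
  have fY: "finite Y" using Y' finite_subset by blast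
  have cY: "card (?V - Y) = a + ?q" using Y' fY pf(1) by (simp add: card_Diff_subset)
  have WV: "?W \<subseteq> ?V - Y" by (auto simp: late_points_def)
  have fW: "finite ?W" using WV finite_subset by blast
  have "card ?W = card {a - ?q + 1<..a + ?q}"
    using relabel_image[OF cY, of "a - ?q + 1"] by (metis card_image)
  then have cW: "card ?W = 2 * ?q - 1" using pf(1) ab by simp
  have "superset_sum ?V (u_Y a b ?q Y) Z = (\<Sum>Q | Q \<subseteq> ?W \<and> card Q = ?q. superset_sum ?V (single (Q \<union> Y)) Z :: 'k)"
  proof -
    have "u_Y a b ?q Y = (\<lambda>X. \<Sum>Q | Q \<subseteq> ?W \<and> card Q = ?q. single (Q \<union> Y) X :: 'k)"
      by (rule ext) (rule u_Y_eq[OF cY])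
    then show ?thesis by (simp only: superset_sum_sum)
  qed
  also have "\<dots> = (\<Sum>Q | Q \<subseteq> ?W \<and> card Q = ?q. if Z - Y \<subseteq> Q then 1 else 0)"
  proof (rule sum.cong[OF refl])
    fix Q assume "Q \<in> {Q. Q \<subseteq> ?W \<and> card Q = ?q}"
    then have "Q \<union> Y \<subseteq> ?V" using WV Y' by auto
    then have "superset_sum ?V (single (Q \<union> Y)) Z = (if Z \<subseteq> Q \<union> Y then 1 else 0 :: 'k)"
      unfolding single_def by (intro superset_sum_indicator) auto
    moreover have "Z \<subseteq> Q \<union> Y \<longleftrightarrow> Z - Y \<subseteq> Q" by auto
    ultimately show "superset_sum ?V (single (Q \<union> Y)) Z = (if Z - Y \<subseteq> Q then 1 else 0 :: 'k)" by simp
  qed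
  also have "\<dots> = of_nat (card {Q. Z - Y \<subseteq> Q \<and> Q \<subseteq> ?W \<and> card Q = ?q})"
  proof -
    have "{Q. Q \<subseteq> ?W \<and> card Q = ?q} \<inter> {Q. Z - Y \<subseteq> Q} = {Q. Z - Y \<subseteq> Q \<and> Q \<subseteq> ?W \<and> card Q = ?q}" by auto
    then show ?thesis using fW by (simp add: sum.If_cases)
  qed
  also have "\<dots> = ((if Z \<subseteq> Y then 1 else 0) + (if Z - Y \<subseteq> ?W \<and> card (Z - Y) = ?q then 1 else 0) :: 'k)"
  proof (cases "Z - Y \<subseteq> ?W \<and> card (Z - Y) \<le> ?q")
    case False
    have empty: "{Q. Z - Y \<subseteq> Q \<and> Q \<subseteq> ?W \<and> card Q = ?q} = {}"
    proof -
      have False if "Z - Y \<subseteq> Q" "Q \<subseteq> ?W" "card Q = ?q" for Q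
      proof -
        have "finite Q" using that(2) fW by (rule finite_subset)
        from card_mono[OF this that(1)] show False using False that by auto
      qed
      then show ?thesis by blast
    qed
    have n1: "\<not> Z \<subseteq> Y"
    proof
      assume "Z \<subseteq> Y"
      then have ZY: "Z - Y = {}" by blast
      show False using False unfolding ZY by simp
    qed
    have n2: "\<not> (Z - Y \<subseteq> ?W \<and> card (Z - Y) = ?q)" using False by linarith
    show ?thesis unfolding empty if_not_P[OF n1] if_not_P[OF n2] by simp
  next
    case True
    define i where "i = card (Z - Y)"
    have q0: "?q > 0" using prime_gt_0_nat[OF p] by simp
    have cnt: "card {Q. Z - Y \<subseteq> Q \<and> Q \<subseteq> ?W \<and> card Q = ?q} = (2 * ?q - 1 - i) choose (?q - i)"
      using card_intermediate_sets[OF fW, of "Z - Y" ?q] True unfolding cW i_def by blast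
    have bin: "of_nat ((2 * ?q - 1 - i) choose (?q - i)) = (if i = 0 \<or> i = ?q then 1 else 0 :: 'k)"
    proof -
      have "i \<le> ?q" using True by (simp only: i_def)
      then consider "i = 0" | "i = ?q" | "0 < i" "i < ?q" by linarith
      then show ?thesis
      proof cases
        case 1
        have "(2 * y - 1) div y = 1" if "y > 0" for y :: nat
          using that by (intro div_nat_eqI) auto
        from this[OF q0] have "of_nat ((2 * ?q - 1) choose ?q) = (1 :: 'k)"
          unfolding binomial_power_eq_div[OF p char] by simp
        then show ?thesis using 1 by simp
      next
        case 2
        then show ?thesis by simp
      next
        case 3
        then have eq: "2 * ?q - 1 - i = ?q + (?q - 1 - i)" by linarith
        have "of_nat ((2 * ?q - 1 - i) choose (?q - i)) = (of_nat ((?q - 1 - i) choose (?q - i)) :: 'k)"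
          unfolding eq by (rule binomial_shift_power[OF p char]) (use 3 in linarith)
        also have "(?q - 1 - i) choose (?q - i) = 0" by (rule binomial_eq_0) (use 3 in linarith)
        finally show ?thesis using 3 by simp
      qed
    qed
    have "finite (Z - Y)" using Z finite_subset by blast
    then have r1: "Z \<subseteq> Y \<longleftrightarrow> i = 0" by (simp add: i_def)
    have r2: "Z - Y \<subseteq> ?W \<and> card (Z - Y) = ?q \<longleftrightarrow> i = ?q" using True by (simp add: i_def)
    have "(if i = 0 \<or> i = y then 1 else 0) = ((if i = 0 then 1 else 0) + (if i = y then 1 else 0) :: 'k)"
      if "y > 0" for y :: nat
      using that by auto
    from this[OF q0] show ?thesis unfolding cnt bin r1 r2 .
  qed
  finally show ?thesis .
qed

lemma u_Y_homog:
  assumes Y: "Y \<in> subsets_of_size (a + b) bh"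
  shows "(u_Y a b (p ^ \<beta>) Y :: _ \<Rightarrow> 'k) \<in> homog {1..a+b} b"
  unfolding homog_def
proof (intro CollectI allI impI)
  note pf = pointed_facts
  let ?W = "late_points (a+b) (a - p ^ \<beta> + 1) Y"
  have Y': "Y \<subseteq> {1..a+b}" "card Y = bh" using Y by (auto simp: subsets_of_size_def)
  have fY: "finite Y" using Y' finite_subset by blast
  have cY: "card ({1..a+b} - Y) = a + p ^ \<beta>" using Y' fY pf(1) by (simp add: card_Diff_subset)
  fix X assume X: "\<not> (X \<subseteq> {1..a+b} \<and> card X = b)"
  have "single (Q \<union> Y) X = (0 :: 'k)" if Q: "Q \<subseteq> ?W" "card Q = p ^ \<beta>" for Q
  proof -
    have QV: "Q \<subseteq> {1..a+b} - Y" using Q(1) by (auto simp: late_points_def)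
    then have "finite Q" using finite_subset[of Q "{1..a+b}"] by blast
    then have "card (Q \<union> Y) = b" using QV fY Q(2) Y'(2) pf(1) by (subst card_Un_disjoint) auto
    then have "X \<noteq> Q \<union> Y" using X QV Y' by auto
    then show ?thesis by (simp add: single_def)
  qed
  then show "u_Y a b (p ^ \<beta>) Y X = (0 :: 'k)" unfolding u_Y_eq[OF cY] by (intro sum.neutral) auto
qed

text \<open>
  The sets \<open>Y\<close> that contain \<open>Z\<close> give the binomial coefficient, which depends only on \<open>card Z\<close>; the other
  terms of \<open>superset_sum_u_Y\<close> cancel by \<open>count_late_remainder\<close>.
\<close>

lemma has_counts_u_design:
  fixes U :: "nat set \<Rightarrow> 'k"
  assumes U: "\<And>Y. Y \<in> subsets_of_size (a + b) bh \<Longrightarrow> (\<Sum>X | X \<in> subsets_of_size (a + b) (b - 1) \<and> Y \<subseteq> X. U X) = \<alpha>"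
  shows "has_counts a b (u_design a b (p ^ \<beta>) bh U)
     (\<lambda>s. \<alpha> * (if b - s \<le> bh then of_nat ((a + s) choose (bh - (b - s))) else 0))"
proof -
  let ?V = "{1..a+b}" and ?q = "p ^ \<beta>" and ?Y = "subsets_of_size (a + b) bh"
  have fs: "finite ?Y" by (simp add: subsets_of_size_def)
  have "(\<lambda>T. \<Sum>Y\<in>?Y. u_Y a b ?q Y T :: 'k) \<in> homog ?V b"
    unfolding homog_def using homog_eq_zero[OF u_Y_homog] by (auto intro!: sum.neutral)
  then have hom: "(\<lambda>T. \<alpha> * (\<Sum>Y\<in>?Y. u_Y a b ?q Y T)) \<in> homog ?V b" by (rule homog_scale)
  have ups: "superset_sum ?V (\<lambda>T. \<alpha> * (\<Sum>Y\<in>?Y. u_Y a b ?q Y T)) Z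
     = \<alpha> * (if b - (b - card Z) \<le> bh then of_nat ((a + (b - card Z)) choose (bh - (b - (b - card Z)))) else 0)"
    if Z: "Z \<subseteq> ?V" "card Z < b" for Z
  proof -
  let ?L = "\<lambda>Y. Z - Y \<subseteq> late_points (a+b) (a - ?q + 1) Y \<and> card (Z - Y) = ?q"
  have "superset_sum ?V (\<lambda>T. \<Sum>Y\<in>?Y. u_Y a b ?q Y T) Z
      = (\<Sum>Y\<in>?Y. (if Z \<subseteq> Y then 1 else 0) + (if ?L Y then 1 else 0) :: 'k)"
    unfolding superset_sum_sum by (rule sum.cong[OF refl]) (rule superset_sum_u_Y[OF _ Z(1)])
  also have "\<dots> = of_nat (card {Y \<in> ?Y. Z \<subseteq> Y}) + of_nat (card {Y \<in> ?Y. ?L Y})"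
  proof -
    have cnt: "(\<Sum>Y\<in>?Y. if P Y then 1 else 0) = (of_nat (card {Y \<in> ?Y. P Y}) :: 'k)" for P
      using fs by (simp add: sum.If_cases Int_def)
    show ?thesis unfolding sum.distrib cnt ..
  qed
  also have "of_nat (card {Y \<in> ?Y. ?L Y}) = (0 :: 'k)" by (rule count_late_remainder[OF Z])
  also have "card {Y \<in> ?Y. Z \<subseteq> Y} = (if card Z \<le> bh then (a + b - card Z) choose (bh - card Z) else 0)"
  proof (cases "card Z \<le> bh")
    case True
    have "{Y \<in> ?Y. Z \<subseteq> Y} = {T. Z \<subseteq> T \<and> T \<subseteq> ?V \<and> card T = bh}" by (auto simp: subsets_of_size_def)
    then show ?thesis using card_intermediate_sets[OF _ Z(1) True] True by simp
  next
    case False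
    have "\<not> Z \<subseteq> Y" if "Y \<in> ?Y" for Y
    proof
      assume "Z \<subseteq> Y"
      moreover have "finite Y" "card Y = bh" using that finite_subset by (auto simp: subsets_of_size_def)
      ultimately show False using card_mono[of Y Z] False by simp
    qed
    then have e: "{Y \<in> ?Y. Z \<subseteq> Y} = {}" by blast
    show ?thesis unfolding e using False by simp
  qed
  finally have "superset_sum ?V (\<lambda>T. \<Sum>Y\<in>?Y. u_Y a b ?q Y T) Z
      = (if card Z \<le> bh then of_nat ((a + b - card Z) choose (bh - card Z)) else 0 :: 'k)" by simp
  moreover have "b - (b - card Z) = card Z" "a + (b - card Z) = a + b - card Z" using Z by auto
  ultimately show ?thesis unfolding superset_sum_scale by simp
  qed
  have eq: "u_design a b ?q bh U = (\<lambda>T. \<alpha> * (\<Sum>Y\<in>?Y. u_Y a b ?q Y T))"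
    by (rule u_design_eq) (rule U)
  show ?thesis
    unfolding has_counts_def eq by (intro conjI allI impI hom ups)
qed

text \<open>
  The function vanishes at \<open>p ^ v\<close>, where \<open>full_count a\<close> does not, but not at \<open>p ^ \<beta>\<close>.
\<close>

lemma design_counts_nontrivial:
  fixes \<alpha> :: 'k
  assumes "\<alpha> \<noteq> 0"
  shows "\<not> (\<exists>c. \<forall>s. 1 \<le> s \<longrightarrow> s \<le> b \<longrightarrow>
     \<alpha> * (if b - s \<le> bh then of_nat ((a + s) choose (bh - (b - s))) else 0) = c * full_count a s)"
proof
  note pf = pointed_facts
  let ?v = "multiplicity p (a + 1)"
  assume "\<exists>c. \<forall>s. 1 \<le> s \<longrightarrow> s \<le> b \<longrightarrow>
     \<alpha> * (if b - s \<le> bh then of_nat ((a + s) choose (bh - (b - s))) else 0) = c * full_count a s"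
  then obtain c where c: "\<And>s. 1 \<le> s \<Longrightarrow> s \<le> b \<Longrightarrow>
     \<alpha> * (if b - s \<le> bh then of_nat ((a + s) choose (bh - (b - s))) else 0) = c * full_count a s" by blast
  have pos: "1 \<le> p ^ ?v" "1 \<le> p ^ \<beta>" using prime_gt_0_nat[OF p] by (simp_all add: Suc_le_eq)
  have le: "p ^ ?v \<le> b" "p ^ \<beta> \<le> b" "\<not> b - p ^ ?v \<le> bh" "b - p ^ \<beta> = bh" using pf(1,3) by linarith+
  have "c * full_count a (p ^ ?v) = 0" using c[OF pos(1) le(1)] unfolding if_not_P[OF le(3)] by (simp only: mult_zero_right)
  then have "c = 0" using full_count_at[OF p char refl, of a] by (simp only: mult_eq_0_iff) blast
  moreover have "\<alpha> = c * full_count a (p ^ \<beta>)" using c[OF pos(2) le(2)] unfolding le(4) by simp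
  ultimately show False using assms by simp
qed

text \<open>
  All sums may be prescribed to be \<open>1\<close>: the two binomial coefficients in the compatibility condition agree
  modulo \<open>p\<close>, because their upper entries differ by \<open>a + 1\<close>, a multiple of \<open>p ^ v\<close>, and their lower
  entry is at most \<open>bh < p ^ v\<close>.
\<close>

lemma nonnull_design_exists: "\<exists>U :: nat set \<Rightarrow> 'k. nonnull_design (a + b) bh (b - 1) U"
proof -
  note pf = pointed_facts
  let ?V = "{1..a+b}"
  have "\<exists>f \<in> homog ?V (b - 1). \<forall>Z. Z \<subseteq> ?V \<longrightarrow> card Z < Suc bh \<longrightarrow> superset_sum ?V f Z = (\<lambda>_. 1 :: 'k) (card Z)"
  proof (rule design_exists)
    fix i j assume ij: "i < j" "j < Suc bh"
    have "card ?V - i = (a + 1) + (b - 1 - i)" using ij pf(1,3) by simp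
    then have "of_nat ((card ?V - i) choose (j - i)) = (of_nat ((b - 1 - i) choose (j - i)) :: 'k)"
      using binomial_shift[OF p char _ pf(4), of "j - i" "b - 1 - i"] ij pf(2) by simp
    then show "of_nat ((card ?V - i) choose (j - i)) * 1 = (of_nat ((b - 1 - i) choose (j - i)) * 1 :: 'k)" by simp
  qed (use pf ab in auto)
  then obtain f where f: "f \<in> homog ?V (b - 1)" "\<And>Z. Z \<subseteq> ?V \<Longrightarrow> card Z < Suc bh \<Longrightarrow> superset_sum ?V f Z = (1 :: 'k)" by blast
  have "(\<Sum>X | X \<in> subsets_of_size (a + b) (b - 1) \<and> Y \<subseteq> X. f X) = 1" if Y: "Y \<in> subsets_of_size (a + b) bh" for Y
  proof -
    have "{X. X \<in> subsets_of_size (a + b) (b - 1) \<and> Y \<subseteq> X} = {X. X \<subseteq> ?V \<and> card X = b - 1 \<and> Y \<subseteq> X}"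
      by (auto simp: subsets_of_size_def)
    then show ?thesis using superset_sum_homog[OF _ f(1), of Y] f(2)[of Y] Y by (simp add: subsets_of_size_def)
  qed
  then have "nonnull_design (a + b) bh (b - 1) f" unfolding nonnull_design_def by (intro exI[of _ 1]) simp
  then show ?thesis by (intro exI[of _ f])
qed

end

section \<open>The element attached to a James partition\<close>

lemma james_d_dvd:
  assumes p: "prime p" and s: "s < b"
  shows "p ^ james_d p a b dvd (a + b - s) choose a"
proof -
  have "james_d p a b \<le> pval p ((a + b - s) choose a)"
    unfolding james_d_def by (rule Min_le) (use s in auto)
  moreover have "(a + b - s) choose a > 0" using s by simp
  ultimately show ?thesis
    using pval_eq_multiplicity[OF p] by (metis multiplicity_dvd')
qed

lemma james_mu_mult:
  assumes "prime p" "s < b"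
  shows "james_mu p a b s * p ^ james_d p a b = (a + b - s) choose a"
  unfolding james_mu_def using james_d_dvd[OF assms] by (rule dvd_div_mult_self)

lemma james_mu_not_all_divisible:
  assumes p: "prime p" and b: "b > 0"
  shows "\<exists>s<b. \<not> p dvd james_mu p a b s"
proof -
  have "james_d p a b \<in> (\<lambda>s. pval p ((a + b - s) choose a)) ` {..<b}"
    unfolding james_d_def by (rule Min_in) (use b in auto)
  then obtain s where s: "s < b" "james_d p a b = pval p ((a + b - s) choose a)" by blast
  have pos: "(a + b - s) choose a > 0" using s(1) by simp
  have d: "james_d p a b = multiplicity p ((a + b - s) choose a)"
    unfolding s(2) by (rule pval_eq_multiplicity[OF p pos])
  have "\<not> p dvd ((a + b - s) choose a) div p ^ multiplicity p ((a + b - s) choose a)"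
    by (rule multiplicity_decompose) (use pos prime_gt_1_nat[OF p] in auto)
  then show ?thesis using s(1) unfolding james_mu_def d by blast
qed

text \<open>
  This holds for the binomial coefficients \<open>a + b - s choose a\<close> in place of \<open>\<mu>\<^sub>s\<close>, and the common factor
  \<open>p ^ d\<close> cancels.
\<close>

lemma james_mu_compatible:
  assumes p: "prime p" and ij: "i < j" "j < b"
  shows "((a + b - i) choose (j - i)) * james_mu p a b j = ((b - i) choose (j - i)) * james_mu p a b i"
proof -
  let ?D = "p ^ james_d p a b"
  have sym: "(a + b - k) choose a = (a + (b - k)) choose (b - k)" if "k < b" for k
    using binomial_symmetric[of a "a + b - k"] that by simp
  have "((b - i) choose (b - j)) * ((a + (b - i)) choose (b - i))
      = ((a + (b - i)) choose ((b - i) - (b - j))) * ((a + (b - j)) choose (b - j))"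
    by (rule binomial_admissible_identity) (use ij in simp)
  moreover have "(b - i) choose (b - j) = (b - i) choose (j - i)"
    using binomial_symmetric[of "b - j" "b - i"] ij by simp
  moreover have "(b - i) - (b - j) = j - i" "a + (b - i) = a + b - i" using ij by simp_all
  ultimately have "((b - i) choose (j - i)) * ((a + b - i) choose a)
      = ((a + b - i) choose (j - i)) * ((a + b - j) choose a)"
    using sym[of i] sym[of j] ij by simp
  then have "(((b - i) choose (j - i)) * james_mu p a b i) * ?D = (((a + b - i) choose (j - i)) * james_mu p a b j) * ?D"
    using james_mu_mult[OF p, of i b] james_mu_mult[OF p, of j b] ij by (simp add: mult.assoc)
  then show ?thesis using prime_gt_0_nat[OF p] by simp
qed

lemma sum_supersets_eq_superset_sum:
  "(\<Sum>Y | Y \<in> subsets_of_size n r \<and> Z \<subseteq> Y. f Y) = superset_sum {1..n} (\<lambda>Y. if Y \<in> subsets_of_size n r then f Y else 0) Z"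
  unfolding superset_sum_def
  by (rule sum.mono_neutral_cong_left) (auto simp: subsets_of_size_def)

lemma james_coeffs_exist:
  assumes p: "prime p" and ab: "b \<le> a"
  shows "\<exists>c. james_coeffs p a b c"
proof -
  let ?V = "{1..a+b}" and ?\<mu> = "\<lambda>s. int (james_mu p a b s)"
  have "\<exists>f \<in> homog ?V b. \<forall>Z. Z \<subseteq> ?V \<longrightarrow> card Z < b \<longrightarrow> superset_sum ?V f Z = ?\<mu> (card Z)"
  proof (rule design_exists)
    fix i j assume ij: "i < j" "j < b"
    show "of_nat ((card ?V - i) choose (j - i)) * ?\<mu> j = of_nat ((b - i) choose (j - i)) * ?\<mu> i"
      using james_mu_compatible[OF p ij] by (simp flip: of_nat_mult)
  qed (use ab in auto)
  then obtain f where f: "f \<in> homog ?V b" "\<And>Z. Z \<subseteq> ?V \<Longrightarrow> card Z < b \<Longrightarrow> superset_sum ?V f Z = ?\<mu> (card Z)" by blast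
  have fe: "(\<lambda>Y. if Y \<in> subsets_of_size (a + b) b then f Y else 0) = f"
    using homog_eq_zero[OF f(1)] by (auto simp: fun_eq_iff subsets_of_size_def)
  have "james_coeffs p a b f"
    unfolding james_coeffs_def sum_supersets_eq_superset_sum fe
  proof (intro allI impI ballI)
    fix s Z assume s: "s < b" "Z \<in> subsets_of_size (a + b) s"
    then have "Z \<subseteq> ?V" "card Z = s" unfolding subsets_of_size_def by blast+
    then show "superset_sum ?V f Z = ?\<mu> s" using f(2)[of Z] s(1) by simp
  qed
  then show ?thesis by (intro exI[of _ f])
qed

lemma has_counts_u_james:
  assumes c: "james_coeffs p a b c"
  shows "has_counts a b (u_james a b c :: _ \<Rightarrow> 'k::field) (\<lambda>s. of_nat (james_mu p a b (b - s)))"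
proof -
  let ?V = "{1..a+b}" and ?S = "subsets_of_size (a + b) b"
  have fin: "finite ?S" by (simp add: subsets_of_size_def)
  have u: "u_james a b c = (\<lambda>X. if X \<in> ?S then of_int (c X) else 0 :: 'k)"
  proof
    fix X
    have "u_james a b c X = (\<Sum>Y\<in>?S. if X = Y then of_int (c Y) else 0 :: 'k)"
      unfolding u_james_def sum_apply by (rule sum.cong[OF refl]) (simp add: fscale_def single_def)
    then show "u_james a b c X = (if X \<in> ?S then of_int (c X) else 0 :: 'k)"
      using fin by (simp add: sum.delta)
  qed
  have hom: "(u_james a b c :: _ \<Rightarrow> 'k) \<in> homog ?V b"
    unfolding u homog_def by (simp add: subsets_of_size_def)
  have ups: "superset_sum ?V (u_james a b c :: _ \<Rightarrow> 'k) Z = of_nat (james_mu p a b (b - (b - card Z)))"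
    if Z: "Z \<subseteq> ?V" "card Z < b" for Z
  proof -
    have "Z \<in> subsets_of_size (a + b) (card Z)" using Z by (simp add: subsets_of_size_def)
    then have "(\<Sum>Y | Y \<in> ?S \<and> Z \<subseteq> Y. c Y) = int (james_mu p a b (card Z))"
      using c Z(2) unfolding james_coeffs_def by blast
    then have "of_int (\<Sum>Y | Y \<in> ?S \<and> Z \<subseteq> Y. c Y) = (of_nat (james_mu p a b (card Z)) :: 'k)" by simp
    moreover have "b - (b - card Z) = card Z" using Z(2) by simp
    ultimately show ?thesis
      unfolding u sum_supersets_eq_superset_sum[symmetric] of_int_sum by simp
  qed
  show ?thesis unfolding has_counts_def by (intro conjI allI impI hom ups)
qed

text \<open>
  For a James partition \<open>full_count a\<close> is zero on \<open>{1..b}\<close>, whereas \<open>p ^ d\<close> has been divided out so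
  that some \<open>\<mu>\<^sub>s\<close> is not divisible by \<open>p\<close>.
\<close>

lemma james_counts_nontrivial:
  assumes p: "prime p" and b: "b > 0" and char: "CHAR('k::field) = p" and J: "James p a b"
  shows "\<not> (\<exists>c. \<forall>s. 1 \<le> s \<longrightarrow> s \<le> b \<longrightarrow> (of_nat (james_mu p a b (b - s)) :: 'k) = c * full_count a s)"
proof
  assume "\<exists>c. \<forall>s. 1 \<le> s \<longrightarrow> s \<le> b \<longrightarrow> (of_nat (james_mu p a b (b - s)) :: 'k) = c * full_count a s"
  then obtain c where c: "\<And>s. 1 \<le> s \<Longrightarrow> s \<le> b \<Longrightarrow> (of_nat (james_mu p a b (b - s)) :: 'k) = c * full_count a s" by blast
  obtain s where s: "s < b" "\<not> p dvd james_mu p a b s" using james_mu_not_all_divisible[OF p b] by blast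
  have "1 \<le> b - s" "b - s \<le> b" "b - (b - s) = s" using s(1) by simp_all
  then have "(of_nat (james_mu p a b s) :: 'k) = 0"
    using c[of "b - s"] full_count_eq_0_of_James[OF p char J, of "b - s"] by simp
  then show False using s(2) char by (simp add: of_nat_eq_0_iff_char_dvd)
qed

section \<open>Classification of the non-split extensions\<close>

theorem theorem15:
  fixes p a b :: nat and x :: "nat set \<Rightarrow> 'k::field"
  assumes "prime p" and "p \<ge> 3" and "CHAR('k) = p"
    and "a \<ge> b" and "b > 0"
    and "x \<in> perm_module a b"
    and "trivial_extension a b x"
    and "\<not> split_extension a b x"
  shows
    "(pointed p a b \<and>
      (\<forall>\<beta> bh. pointed_decomp p a b \<beta> bh \<longrightarrow>
         (\<exists>U :: nat set \<Rightarrow> 'k. nonnull_design (a + b) bh (b - 1) U) \<and>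
         (\<forall>U :: nat set \<Rightarrow> 'k. nonnull_design (a + b) bh (b - 1) U \<longrightarrow>
            equivalent_extensions a b x (u_design a b (p ^ \<beta>) bh U))))
     \<or>
     (James p a b \<and>
      (\<exists>c. james_coeffs p a b c) \<and>
      (\<forall>c. james_coeffs p a b c \<longrightarrow> equivalent_extensions a b x (u_james a b c)))"
proof -
  note p = assms(1) and char = assms(3) and ab = assms(4) and b = assms(5)
  have nx: "x \<notin> specht a b" using assms(7) by (simp add: trivial_extension_def)
  obtain g where g: "has_counts a b x g" using counts_of_trivial_extension[OF ab assms(6,7)] by blast
  note adm = has_counts_admissible[OF g]
  have equiv: "equivalent_extensions a b x u"
    if u: "has_counts a b u h"
      and nt: "\<not> (\<exists>c. \<forall>s. 1 \<le> s \<longrightarrow> s \<le> b \<longrightarrow> h s = c * full_count a s)" for u h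
  proof -
    obtain c d where "\<And>s. 1 \<le> s \<Longrightarrow> s \<le> b \<Longrightarrow> g s = c * h s + d * full_count a s"
      using admissible_codim_1[OF p char b adm has_counts_admissible[OF u] nt] by blast
    from equivalent_of_counts[OF ab g assms(7,8) u this] show ?thesis .
  qed
  show ?thesis
  proof (cases "James p a b")
    case True
    have "equivalent_extensions a b x (u_james a b c)" if "james_coeffs p a b c" for c
      by (rule equiv[OF has_counts_u_james[OF that] james_counts_nontrivial[OF p b char True]])
    then show ?thesis using True james_coeffs_exist[OF p ab] by blast
  next
    case False
    have "pointed p a b"
    proof (rule ccontr)
      assume "\<not> pointed p a b"
      from admissible_trivial_or_special[OF p char b adm False this]
      obtain c where "\<And>s. 1 \<le> s \<Longrightarrow> s \<le> b \<Longrightarrow> g s = c * full_count a s" by blast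
      from split_of_full_counts[OF ab g nx this] show False using assms(8) by blast
    qed
    moreover have "\<exists>U :: nat set \<Rightarrow> 'k. nonnull_design (a + b) bh (b - 1) U"
      if "pointed_decomp p a b \<beta> bh" for \<beta> bh
      by (rule nonnull_design_exists[OF p char ab that])
    moreover have "equivalent_extensions a b x (u_design a b (p ^ \<beta>) bh U)"
      if dec: "pointed_decomp p a b \<beta> bh" and U: "nonnull_design (a + b) bh (b - 1) U"
      for \<beta> bh and U :: "nat set \<Rightarrow> 'k"
    proof -
      obtain \<alpha> where \<alpha>: "\<alpha> \<noteq> 0" "\<And>Y. Y \<in> subsets_of_size (a + b) bh \<Longrightarrow>
          (\<Sum>X | X \<in> subsets_of_size (a + b) (b - 1) \<and> Y \<subseteq> X. U X) = \<alpha>"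
        using U unfolding nonnull_design_def by blast
      show ?thesis
        by (rule equiv[OF has_counts_u_design[OF p char ab dec \<alpha>(2)] design_counts_nontrivial[OF p char ab dec \<alpha>(1)]])
    qed
    ultimately show ?thesis by blast
  qed
qed

end
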